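(* Let $\Omega=\mathbb{R}^{\mathbb{N}}$, let $\mathbb{E}$ be a regular sublinear expectation on $(\Omega,C_b(\Omega))$, let $\Theta$ be the maximal set of probabilities representing $\mathbb{E}$ and $\Theta^e$ the set of extreme points of $\Theta$. Assume that the coordinate process $\{\xi_k\}_{k\ge1}$ is contained in $L^{\gamma}_{\mathbb{E}}(\Omega)$ for some $\gamma>1$ and is i.i.d. under $\mathbb{E}$. Write $\overline{\mu}=\mathbb{E}[\xi_1]$, $\underline{\mu}=-\mathbb{E}[-\xi_1]$, $\bar{\xi}_n=\frac{\xi_1+\cdots+\xi_n}{n}$. Then for any $d\in\mathbb{N}$, any $\mathcal{F}_d$-measurable random variable $\Pi=\pi(\xi_1,\dots,\xi_d)$ with values in $[\underline{\mu},\overline{\mu}]$, and any $P\in\Theta$, there exists a probability $P^{\Pi}\in\Theta$ such that $P^{\Pi}=P$ on $\mathcal{F}_d$ and $$\lim_{n\rightarrow\infty}\bar{\xi}_n=\Pi,\quad P^{\Pi}\text{-a.s.}$$ Furthermore, if $P_{1,d}\in\Xi_d^e$, then $P^{\Pi}$ can also be chosen from $\Theta^e$.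
   Context: $\Omega=\mathbb{R}^{\mathbb{N}}$ carries the metric $d(x,y)=\sum_{k=1}^\infty 2^{-k}(|x(k)-y(k)|\wedge1)$ (a Polish space); $\xi_k(\omega)=\omega(k)$; $\mathcal{F}_d=\sigma\{\xi_1,\dots,\xi_d\}$. $\mathcal{M}_1(\Omega)$ denotes the Borel probability measures on $\Omega$, and $C_b(\Omega)$ the bounded continuous functions. A sublinear expectation on $(\Omega,C_b(\Omega))$ is a functional of the form $\mathbb{E}[X]=\sup_{P\in\Theta'}E_P[X]$ for some set $\Theta'\subset\mathcal{M}_1(\Omega)$ (such $\Theta'$ is said to represent $\mathbb{E}$). It is regular if $\mathbb{E}[X_n]\downarrow0$ whenever $X_n\in C_b(\Omega)$ and $X_n\downarrow0$ pointwise on $\Omega$. The maximal representing set is $\Theta=\{P\in\mathcal{M}_1(\Omega): E_P[X]\le\mathbb{E}[X]\ \text{for any } X\in C_b(\Omega)\}$. For $p\ge1$, $L^p_{\mathbb{E}}(\Omega)$ is the completion of $C_b(\Omega)$ under $\|X\|_p=(\mathbb{E}[|X|^p])^{1/p}$, identified with Borel functions $X$ for which there are $X_n\in C_b(\Omega)$ with $\sup_{P\in\Theta}E_P[|X-X_n|^p]\to0$ (modulo sets null under every $P\in\Theta$); for such $X$, $\mathbb{E}[X]=\sup_{P\in\Theta}E_P[X]$. For $d\in\mathbb{N}$ and $P\in\Theta$, $P_{1,d}=P\circ(\xi_1,\dots,\xi_d)^{-1}$, $\Xi_d=\{P_{1,d}: P\in\Theta\}$, and $\Xi_d^e$ is the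 set of extreme points of the (convex, closed) set $\Xi_d$. $\pi:\mathbb{R}^d\to\mathbb{R}$ is a Borel function. $C_{b,Lip}(\mathbb{R}^n)$: bounded Lipschitz functions on $\mathbb{R}^n$. $\mathbf{X}$ ($m$-dimensional) is independent of $\mathbf{Y}$ ($n$-dimensional) under $\mathbb{E}$ if $\mathbb{E}[\varphi(\mathbf{Y},\mathbf{X})]=\mathbb{E}\big[\mathbb{E}[\varphi(\mathbf{y},\mathbf{X})]|_{\mathbf{y}=\mathbf{Y}}\big]$ for any $\varphi\in C_{b,Lip}(\mathbb{R}^{n+m})$. $\mathbf{X}\overset{d}{=}\mathbf{Y}$ means $\mathbb{E}[\varphi(\mathbf{X})]=\mathbb{E}[\varphi(\mathbf{Y})]$ for every bounded Lipschitz $\varphi$. $(X_i)_{i\ge1}$ is i.i.d. if, for each $i\ge1$, $X_{i+1}$ is independent of $(X_1,\dots,X_i)$ and $X_{i+1}\overset{d}{=}X_i$. *)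

theory Defs
  imports "HOL-Probability.Probability"
begin

section \<open>The path space and its probability measures\<close>

text \<open>The path space is the type \<open>nat \<Rightarrow> real\<close> with its product topology, which is the topology
  of the metric \<open>d(x,y) = (\<Sum>k. 2\<^sup>-\<^sup>k (\<bar>x(k) - y(k)\<bar> \<and> 1))\<close>; only the topology enters below. Coordinates are numbered from \<open>0\<close>, so
  \<open>xi k\<close> is the mathematical \<open>\<xi>\<^sub>k\<^sub>+\<^sub>1\<close>.\<close>

type_synonym path = "nat \<Rightarrow> real"

definition xi :: "nat \<Rightarrow> path \<Rightarrow> real" where
  "xi k \<omega> = \<omega> k"

definition coord_algebra :: "nat \<Rightarrow> path measure" where
  "coord_algebra d = sigma UNIV (\<Union>k<d. {xi k -` B | B. B \<in> sets borel})"

definition borel_probs :: "path measure set" where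
  "borel_probs = {P. sets P = sets borel \<and> prob_space P}"

definition Cb :: "(path \<Rightarrow> real) set" where
  "Cb = {X. continuous_on UNIV X \<and> bounded (range X)}"

text \<open>There is no real vector space of measures in the library, so extreme points are spelled out
  with convex combinations taken setwise.\<close>

definition extreme_measures :: "'a measure set \<Rightarrow> 'a measure set" where
  "extreme_measures K = {P \<in> K. \<forall>Q\<in>K. \<forall>R\<in>K. \<forall>t\<in>{0<..<1}.
     (\<forall>A\<in>sets P. measure P A = t * measure Q A + (1 - t) * measure R A) \<longrightarrow> Q = P \<and> R = P}"


section \<open>Sublinear expectations\<close>

text \<open>A sublinear expectation is a functional whose values are only relevant on \<^const>\<open>Cb\<close>.\<close>

definition sublinear_expectation :: "((path \<Rightarrow> real) \<Rightarrow> real) \<Rightarrow> bool" where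
  "sublinear_expectation E \<longleftrightarrow>
     (\<exists>\<Theta>'. \<Theta>' \<noteq> {} \<and> \<Theta>' \<subseteq> borel_probs \<and> (\<forall>X\<in>Cb. E X = (SUP P\<in>\<Theta>'. integral\<^sup>L P X)))"

definition regular_expectation :: "((path \<Rightarrow> real) \<Rightarrow> real) \<Rightarrow> bool" where
  "regular_expectation E \<longleftrightarrow>
     (\<forall>X. (\<forall>n. X n \<in> Cb) \<and> (\<forall>\<omega>. decseq (\<lambda>n. X n \<omega>) \<and> (\<lambda>n. X n \<omega>) \<longlonglongrightarrow> 0) \<longrightarrow>
        decseq (\<lambda>n. E (X n)) \<and> (\<lambda>n. E (X n)) \<longlonglongrightarrow> 0)"

definition Theta :: "((path \<Rightarrow> real) \<Rightarrow> real) \<Rightarrow> path measure set" where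
  "Theta E = {P \<in> borel_probs. \<forall>X\<in>Cb. integral\<^sup>L P X \<le> E X}"

text \<open>Borel representatives of the elements of the completion. The upper expectation is computed
  in \<^typ>\<open>ennreal\<close>, since the Bochner integral of a non-integrable function is \<open>0\<close>.\<close>

definition Lp :: "((path \<Rightarrow> real) \<Rightarrow> real) \<Rightarrow> real \<Rightarrow> (path \<Rightarrow> real) set" where
  "Lp E p = {X \<in> borel_measurable borel. \<exists>Y. (\<forall>n. Y n \<in> Cb) \<and>
     (\<lambda>n. SUP P\<in>Theta E. \<integral>\<^sup>+\<omega>. ennreal (\<bar>X \<omega> - Y n \<omega>\<bar> powr p) \<partial>P) \<longlonglongrightarrow> 0}"

text \<open>The extension of \<open>E\<close> to the completion; meaningful for elements of \<open>Lp E p\<close> with \<open>p \<ge> 1\<close>.\<close>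

definition ext :: "((path \<Rightarrow> real) \<Rightarrow> real) \<Rightarrow> (path \<Rightarrow> real) \<Rightarrow> real" where
  "ext E X = (SUP P\<in>Theta E. integral\<^sup>L P X)"

lemma ext_eq_on_Cb:
  assumes E: "sublinear_expectation E" and X: "X \<in> Cb"
  shows "ext E X = E X"
proof -
  obtain T where T: "T \<noteq> {}" "T \<subseteq> borel_probs"
      and ET: "\<And>X. X \<in> Cb \<Longrightarrow> E X = (SUP P\<in>T. integral\<^sup>L P X)"
    using E unfolding sublinear_expectation_def by blast
  have bdd: "bdd_above ((\<lambda>P. integral\<^sup>L P Y) ` T)" if Y: "Y \<in> Cb" for Y
  proof -
    obtain C where C: "\<And>\<omega>. \<bar>Y \<omega>\<bar> \<le> C"
      using Y unfolding Cb_def bounded_iff by auto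
    have "integral\<^sup>L P Y \<le> C" if "P \<in> T" for P
    proof -
      interpret prob_space P using that T by (auto simp: borel_probs_def)
      have s: "sets P = sets borel" using that T by (auto simp: borel_probs_def)
      have "Y \<in> borel_measurable P"
        using Y unfolding measurable_cong_sets[OF s refl] Cb_def
        by (auto intro: borel_measurable_continuous_onI)
      then have "integrable P Y"
        by (intro integrable_const_bound[where B = C]) (use C in auto)
      then show ?thesis
        by (intro integral_le_const) (use C in \<open>auto intro: order_trans[OF abs_ge_self]\<close>)
    qed
    then show ?thesis by (intro bdd_aboveI2)
  qed
  have sub: "T \<subseteq> Theta E"
    using T(2) by (auto simp: Theta_def ET intro!: cSUP_upper bdd)
  then have ne: "Theta E \<noteq> {}" using T(1) by blast
  have le: "integral\<^sup>L P X \<le> E X" if "P \<in> Theta E" for P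
    using that X by (auto simp: Theta_def)
  show ?thesis
  proof (rule antisym)
    show "ext E X \<le> E X"
      unfolding ext_def by (rule cSUP_least[OF ne le])
    show "E X \<le> ext E X"
      unfolding ext_def ET[OF X] by (rule cSUP_subset_mono[OF T(1) bdd_aboveI2[OF le] sub order_refl])
  qed
qed


section \<open>Random vectors, independence and identical distribution\<close>

text \<open>Points of \<open>\<real>\<^sup>n\<close> are the functions in the space of \<open>Rn n\<close>, i.e. those that are
  \<^const>\<open>undefined\<close> off \<open>{..<n}\<close>.\<close>

abbreviation Rn :: "nat \<Rightarrow> (nat \<Rightarrow> real) measure" where
  "Rn n \<equiv> \<Pi>\<^sub>M i\<in>{..<n}. borel"

definition rvec :: "nat \<Rightarrow> (nat \<Rightarrow> path \<Rightarrow> real) \<Rightarrow> path \<Rightarrow> (nat \<Rightarrow> real)" where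
  "rvec n X \<omega> = (\<lambda>i\<in>{..<n}. X i \<omega>)"

definition join :: "nat \<Rightarrow> nat \<Rightarrow> (nat \<Rightarrow> real) \<Rightarrow> (nat \<Rightarrow> real) \<Rightarrow> (nat \<Rightarrow> real)" where
  "join n m y x = (\<lambda>i\<in>{..<n + m}. if i < n then y i else x (i - n))"

text \<open>Lipschitz with respect to the Euclidean norm, which is not the metric of the type
  \<open>nat \<Rightarrow> real\<close>; hence \<open>lipschitz_on\<close> is not used.\<close>

definition CbLip :: "nat \<Rightarrow> ((nat \<Rightarrow> real) \<Rightarrow> real) set" where
  "CbLip n = {\<phi>. bounded (\<phi> ` space (Rn n)) \<and>
     (\<exists>L. \<forall>x\<in>space (Rn n). \<forall>y\<in>space (Rn n).
        \<bar>\<phi> x - \<phi> y\<bar> \<le> L * L2_set (\<lambda>i. x i - y i) {..<n})}"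

text \<open>\<open>independent E m X n Y\<close>: the \<open>m\<close>-dimensional \<open>X\<close> is independent of the \<open>n\<close>-dimensional \<open>Y\<close>
  (this relation is not symmetric).\<close>

definition independent ::
    "((path \<Rightarrow> real) \<Rightarrow> real) \<Rightarrow> nat \<Rightarrow> (path \<Rightarrow> nat \<Rightarrow> real) \<Rightarrow> nat \<Rightarrow> (path \<Rightarrow> nat \<Rightarrow> real) \<Rightarrow> bool" where
  "independent E m X n Y \<longleftrightarrow> (\<forall>\<phi>\<in>CbLip (n + m).
     ext E (\<lambda>\<omega>. \<phi> (join n m (Y \<omega>) (X \<omega>))) =
     ext E (\<lambda>\<omega>. ext E (\<lambda>\<omega>'. \<phi> (join n m (Y \<omega>) (X \<omega>')))))"

definition ident_distr ::
    "((path \<Rightarrow> real) \<Rightarrow> real) \<Rightarrow> nat \<Rightarrow> (path \<Rightarrow> nat \<Rightarrow> real) \<Rightarrow> (path \<Rightarrow> nat \<Rightarrow> real) \<Rightarrow> bool" where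
  "ident_distr E n X Y \<longleftrightarrow>
     (\<forall>\<phi>\<in>CbLip n. ext E (\<lambda>\<omega>. \<phi> (X \<omega>)) = ext E (\<lambda>\<omega>. \<phi> (Y \<omega>)))"

definition iid :: "((path \<Rightarrow> real) \<Rightarrow> real) \<Rightarrow> (nat \<Rightarrow> path \<Rightarrow> real) \<Rightarrow> bool" where
  "iid E X \<longleftrightarrow> (\<forall>i.
     independent E 1 (rvec 1 (\<lambda>_. X (Suc i))) (Suc i) (rvec (Suc i) X) \<and>
     ident_distr E 1 (rvec 1 (\<lambda>_. X (Suc i))) (rvec 1 (\<lambda>_. X i)))"


section \<open>Finite-dimensional marginals and means\<close>

definition marginal :: "nat \<Rightarrow> path measure \<Rightarrow> (nat \<Rightarrow> real) measure" where
  "marginal d P = distr P (Rn d) (rvec d xi)"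

definition Xi :: "((path \<Rightarrow> real) \<Rightarrow> real) \<Rightarrow> nat \<Rightarrow> (nat \<Rightarrow> real) measure set" where
  "Xi E d = marginal d ` Theta E"

definition upper_mean :: "((path \<Rightarrow> real) \<Rightarrow> real) \<Rightarrow> real" where
  "upper_mean E = ext E (xi 0)"

definition lower_mean :: "((path \<Rightarrow> real) \<Rightarrow> real) \<Rightarrow> real" where
  "lower_mean E = - ext E (\<lambda>\<omega>. - xi 0 \<omega>)"

definition sample_mean :: "nat \<Rightarrow> path \<Rightarrow> real" where
  "sample_mean n \<omega> = (\<Sum>k<n. xi k \<omega>) / real n"

end

theory Submission
  imports Defs
begin

text \<open>Independence and identical distribution make \<^term>\<open>Theta E\<close> a set of laws described one step at
a time. Let \<open>L\<close> be the set of laws \<open>\<mu>\<close> on the line with \<open>\<integral>g d\<mu> \<le> E[g(\<xi>)]\<close> for all bounded Lipschitz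
\<open>g\<close>, where \<open>\<xi>\<close> is the first coordinate. If \<open>P\<close> is in \<open>Theta E\<close> and \<open>A\<close> is an event of positive
probability that is determined by the first \<open>n \<ge> 1\<close> coordinates, then the law of the next coordinate
given \<open>A\<close> belongs to \<open>L\<close>: with \<open>c = E[g(\<xi>)]\<close>, independence gives \<open>E[\<psi>(y)(g(x) - c)] \<le> 0\<close> for every
Lipschitz \<open>\<psi> \<ge> 0\<close> of the past \<open>y\<close>, and indicators of \<open>A\<close> are approximated by such \<open>\<psi>\<close>. Conversely, a
law whose marginal on \<open>\<real>\<^sup>d\<close> is that of a member of \<open>Theta E\<close> and whose later coordinates are drawn
from \<open>L\<close> given the past is in \<open>Theta E\<close>: by induction on \<open>n\<close> its integrals of Lipschitz functions of
\<open>n\<close> coordinates are bounded by \<open>E\<close>, since independence evaluates \<open>E\<close> by integrating out the last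
coordinate first, and every bounded continuous function on path space is a limit from below of such
functions.

So one may keep \<open>P\<close> on the first \<open>d\<close> coordinates and draw the later ones from \<open>L\<close>. Choose
\<open>\<kappa>\<^sub>1\<close> in \<open>L\<close> with the largest and \<open>\<kappa>\<^sub>0\<close> in \<open>L\<close> with the smallest mean. The value \<open>z\<close> of \<open>Z\<close> is known at
time \<open>d\<close> and lies between these means, so \<open>z\<close> is the limit of the averages of a sequence of the two
means. Given the first \<open>d\<close> coordinates, draw the later ones independently, the \<open>k\<close>-th from \<open>\<kappa>\<^sub>1\<close> or
\<open>\<kappa>\<^sub>0\<close> according to that sequence. The strong law of large numbers for independent variables with
bounded moments of some order above one (\<open>slln\<close>) shows that the sample means converge to \<open>z\<close>.

Switching between two laws, instead of drawing from one mixture with mean \<open>z\<close>, is what makes the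
second claim work. The laws \<open>\<kappa>\<^sub>1\<close> and \<open>\<kappa>\<^sub>0\<close> can be taken to be extreme points of \<open>L\<close>: the moment bound
makes \<open>L\<close> weakly sequentially compact, so among the laws with the optimal mean some law maximises a
weakly continuous strictly convex functional, and such a law is extreme
(\<open>extreme_point_maximal_mean\<close>). Suppose that the constructed law \<open>Q\<close> is a proper convex combination
of \<open>R\<close> and \<open>S\<close> from \<open>Theta E\<close>. If its marginal on \<open>\<real>\<^sup>d\<close> is extreme, then \<open>Q\<close>, \<open>R\<close> and \<open>S\<close> agree up to
time \<open>d\<close>. If they agree up to time \<open>n\<close>, then on any past event on which the rule picks \<open>\<kappa>\<^sub>i\<close> the
conditional laws of the next coordinate under \<open>R\<close> and \<open>S\<close> are members of \<open>L\<close> whose combination is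
\<open>\<kappa>\<^sub>i\<close>. By extremality both equal \<open>\<kappa>\<^sub>i\<close>, so the agreement extends to time \<open>n + 1\<close>.\<close>


section \<open>Strong law of large numbers with moments of order above one\<close>

lemma abs_add_powr_le:
  fixes a b g :: real assumes "g \<ge> 0"
  shows "\<bar>a + b\<bar> powr g \<le> 2 powr g * (\<bar>a\<bar> powr g + \<bar>b\<bar> powr g)"
proof -
  have "\<bar>a + b\<bar> powr g \<le> (2 * max \<bar>a\<bar> \<bar>b\<bar>) powr g"
    by (intro powr_mono2) (use assms in auto)
  also have "\<dots> = 2 powr g * max \<bar>a\<bar> \<bar>b\<bar> powr g"
    by (simp add: powr_mult)
  also have "\<dots> \<le> 2 powr g * (\<bar>a\<bar> powr g + \<bar>b\<bar> powr g)"
    by (intro mult_left_mono) (auto simp: max_def)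
  finally show ?thesis .
qed

lemma powr_add_le:
  fixes p x y :: real assumes p: "0 < p" "p \<le> 1" and xy: "x \<ge> 0" "y \<ge> 0"
  shows "(x + y) powr p \<le> x powr p + y powr p"
proof (cases "x + y = 0")
  case True then show ?thesis using xy by auto
next
  case False
  define s where "s = x + y"
  have s: "s > 0" using False xy by (auto simp: s_def)
  have "s powr p = s powr p * (x / s + y / s)"
    using s by (simp add: s_def add_divide_distrib[symmetric])
  also have "\<dots> \<le> s powr p * ((x / s) powr p + (y / s) powr p)"
    using s xy p powr_mono'[of p 1 "x / s"] powr_mono'[of p 1 "y / s"]
    by (intro mult_left_mono add_mono) (auto simp: s_def)
  also have "\<dots> = x powr p + y powr p"
    using s xy by (simp add: powr_divide distrib_left)
  finally show ?thesis by (simp add: s_def)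
qed

text \<open>Young's inequality for the product of \<open>x\<^sup>g\<^sup>-\<^sup>1\<close> and \<open>y\<close>, rearranged; this expresses convexity without
differentiation.\<close>

lemma powr_tangent:
  fixes g x y :: real assumes g: "g > 1" and xy: "x > 0" "y > 0"
  shows "x powr g + g * x powr (g - 1) * (y - x) \<le> y powr g"
proof -
  have "(x powr g) powr ((g - 1) / g) * (y powr g) powr (1 / g) \<le> (g - 1) / g * x powr g + 1 / g * y powr g"
    by (intro Youngs_inequality_0) (use g xy in \<open>auto simp: field_simps\<close>)
  then have "x powr (g - 1) * y \<le> (g - 1) / g * x powr g + 1 / g * y powr g"
    using g xy by (simp add: powr_powr)
  then have "g * (x powr (g - 1) * y) \<le> (g - 1) * x powr g + y powr g"
    using g by (simp add: field_simps)
  moreover have "x powr (g - 1) * x = x powr g"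
    using xy by (simp add: powr_diff)
  ultimately show ?thesis by (simp add: algebra_simps)
qed

text \<open>If \<open>a\<close> and \<open>a + b\<close> have the same sign, use that the tangent at \<open>a + b\<close> lies below the power
function at \<open>a\<close>, and then replace its slope by the one at \<open>a\<close>: as \<open>g - 1 \<le> 1\<close>, the two slopes differ by at most
\<open>g\<bar>b\<bar>\<^sup>g\<^sup>-\<^sup>1\<close>. Otherwise \<open>\<bar>a\<bar>\<close> and \<open>\<bar>a + b\<bar>\<close> are at most \<open>\<bar>b\<bar>\<close>. What matters is that the error term does
not depend on \<open>a\<close>.\<close>

lemma abs_add_powr_expand:
  fixes g a b :: real assumes g: "1 < g" "g \<le> 2"
  shows "\<bar>a + b\<bar> powr g \<le> \<bar>a\<bar> powr g + g * (sgn a * \<bar>a\<bar> powr (g - 1)) * b + 3 * \<bar>b\<bar> powr g"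
proof -
  have pos: "\<bar>a + b\<bar> powr g \<le> a powr g + g * a powr (g - 1) * b + 3 * \<bar>b\<bar> powr g" if a: "a > 0" for a b :: real
  proof (cases "a + b > 0")
    case False
    have b: "\<bar>b\<bar> powr (g - 1) * \<bar>b\<bar> = \<bar>b\<bar> powr g" using False a by (simp add: powr_diff)
    have "a powr (g - 1) * \<bar>b\<bar> \<le> \<bar>b\<bar> powr (g - 1) * \<bar>b\<bar>"
      by (intro mult_right_mono powr_mono2) (use False a g in auto)
    then have "g * (a powr (g - 1) * \<bar>b\<bar>) \<le> 2 * \<bar>b\<bar> powr g"
      unfolding b using g by (intro mult_mono) auto
    moreover have "\<bar>b\<bar> = - b" using False a by auto
    then have "g * a powr (g - 1) * b = - (g * (a powr (g - 1) * \<bar>b\<bar>))" by simp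
    moreover have "\<bar>a + b\<bar> powr g \<le> \<bar>b\<bar> powr g"
      by (intro powr_mono2) (use False a g in auto)
    moreover have "a powr g \<ge> 0" "\<bar>b\<bar> powr g \<ge> 0" by simp_all
    ultimately show ?thesis by linarith
  next
    case True
    have "(a + b) powr g + g * (a + b) powr (g - 1) * (a - (a + b)) \<le> a powr g"
      by (rule powr_tangent) (use True a g in auto)
    then have 1: "(a + b) powr g \<le> a powr g + g * ((a + b) powr (g - 1) * b)" by simp
    have b: "\<bar>b\<bar> powr (g - 1) * \<bar>b\<bar> = \<bar>b\<bar> powr g" by (cases "b = 0") (simp_all add: powr_diff)
    have 2: "(a + b) powr (g - 1) * b \<le> a powr (g - 1) * b + \<bar>b\<bar> powr g"
    proof (cases "b \<ge> 0")
      case b0: True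
      have "(a + b) powr (g - 1) \<le> a powr (g - 1) + b powr (g - 1)"
        by (rule powr_add_le) (use b0 a g in auto)
      then have "(a + b) powr (g - 1) * b \<le> (a powr (g - 1) + b powr (g - 1)) * b"
        by (rule mult_right_mono) (use b0 in auto)
      then show ?thesis using b b0 by (simp add: algebra_simps)
    next
      case b0: False
      have "((a + b) + (- b)) powr (g - 1) \<le> (a + b) powr (g - 1) + (- b) powr (g - 1)"
        by (rule powr_add_le) (use b0 True a g in auto)
      then have "a powr (g - 1) * (- b) \<le> ((a + b) powr (g - 1) + (- b) powr (g - 1)) * (- b)"
        by (intro mult_right_mono) (use b0 in auto)
      then show ?thesis using b b0 by (simp add: algebra_simps)
    qed
    have "g * ((a + b) powr (g - 1) * b) \<le> g * (a powr (g - 1) * b + \<bar>b\<bar> powr g)"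
      using 2 g by (intro mult_left_mono) auto
    also have "\<dots> \<le> g * a powr (g - 1) * b + 3 * \<bar>b\<bar> powr g"
      using mult_right_mono[of g 3 "\<bar>b\<bar> powr g"] g by (simp add: algebra_simps)
    finally show ?thesis using 1 True by simp
  qed
  consider "a > 0" | "a < 0" | "a = 0" by linarith
  then show ?thesis
  proof cases
    case 1 then show ?thesis using pos[of a b] by simp
  next
    case 2
    have "\<bar>- a - b\<bar> = \<bar>a + b\<bar>" by linarith
    then show ?thesis using pos[of "- a" "- b"] 2 by simp
  next
    case 3 then show ?thesis by simp
  qed
qed

lemma abs_le_one_add_powr:
  fixes x p g :: real assumes "0 \<le> p" "p \<le> g"
  shows "\<bar>x\<bar> powr p \<le> 1 + \<bar>x\<bar> powr g"
proof (cases "\<bar>x\<bar> \<le> 1")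
  case True
  then have "\<bar>x\<bar> powr p \<le> 1" using assms by (simp add: powr_le1)
  moreover have "\<bar>x\<bar> powr g \<ge> 0" by simp
  ultimately show ?thesis by linarith
next
  case False
  then have "\<bar>x\<bar> powr p \<le> \<bar>x\<bar> powr g" using assms by (intro powr_mono) auto
  then show ?thesis by simp
qed

lemma integrable_powr_mono:
  fixes X :: "'a \<Rightarrow> real"
  assumes fin: "finite_measure M" and X: "X \<in> borel_measurable M" and "integrable M (\<lambda>\<omega>. \<bar>X \<omega>\<bar> powr g)" "0 \<le> p" "p \<le> g"
  shows "integrable M (\<lambda>\<omega>. \<bar>X \<omega>\<bar> powr p)"
proof (rule Bochner_Integration.integrable_bound)
  show "integrable M (\<lambda>\<omega>. 1 + \<bar>X \<omega>\<bar> powr g)"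
    using assms by (auto intro: finite_measure.integrable_const)
  show "AE x in M. norm (\<bar>X x\<bar> powr p) \<le> norm (1 + \<bar>X x\<bar> powr g)"
    using abs_le_one_add_powr[OF assms(4,5)] by (auto simp: abs_of_nonneg add_nonneg_nonneg)
qed (use X in measurable)

lemma integrable_if_powr:
  fixes X :: "'a \<Rightarrow> real"
  assumes "finite_measure M" "X \<in> borel_measurable M" "integrable M (\<lambda>\<omega>. \<bar>X \<omega>\<bar> powr g)" "1 \<le> g"
  shows "integrable M X"
  using integrable_powr_mono[OF assms(1-3), of 1] assms(4)
  by (subst integrable_abs_iff[symmetric]) (use assms in auto)

text \<open>The von Bahr--Esseen bound. In the expansion of \<open>\<bar>S + X\<bar>\<^sup>g\<close> around \<open>S\<close> the linear term has
mean zero, because \<open>X\<close> is centred and independent of \<open>S\<close>; so each summand adds at most three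
times its own moment.\<close>

lemma (in prob_space) sum_moment_bound:
  fixes X :: "nat \<Rightarrow> 'a \<Rightarrow> real"
  assumes g: "1 < g" "g \<le> 2"
    and ind: "indep_vars (\<lambda>_. borel) X UNIV"
    and int: "\<And>k. integrable M (\<lambda>\<omega>. \<bar>X k \<omega>\<bar> powr g)"
    and mean: "\<And>k. expectation (X k) = 0"
    and C: "\<And>k. expectation (\<lambda>\<omega>. \<bar>X k \<omega>\<bar> powr g) \<le> C"
  shows "integrable M (\<lambda>\<omega>. \<bar>\<Sum>k<n. X k \<omega>\<bar> powr g)
    \<and> expectation (\<lambda>\<omega>. \<bar>\<Sum>k<n. X k \<omega>\<bar> powr g) \<le> 3 * C * real n"
proof (induction n)
  case 0 then show ?case using g by simp
next
  case (Suc n)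
  have rv[measurable]: "X k \<in> borel_measurable M" for k
    using ind by (auto simp: indep_vars_def)
  define S where "S \<omega> = (\<Sum>k<n. X k \<omega>)" for \<omega>
  have [measurable]: "S \<in> borel_measurable M" unfolding S_def by measurable
  define H where "H a = sgn a * \<bar>a\<bar> powr (g - 1)" for a :: real
  have [measurable]: "H \<in> borel_measurable borel" unfolding H_def by measurable
  have S1: "integrable M (\<lambda>\<omega>. \<bar>S \<omega>\<bar> powr g)" and S2: "expectation (\<lambda>\<omega>. \<bar>S \<omega>\<bar> powr g) \<le> 3 * C * real n"
    using Suc by (auto simp: S_def)
  have "integrable M (\<lambda>\<omega>. \<bar>S \<omega>\<bar> powr (g - 1))"
    by (rule integrable_powr_mono[OF _ _ S1]) (use g finite_measure_axioms in auto)
  then have HS: "integrable M (\<lambda>\<omega>. H (S \<omega>))"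
    by (rule Bochner_Integration.integrable_bound) (auto simp: H_def abs_mult abs_sgn_eq)
  have XI: "integrable M (X k)" for k
    by (rule integrable_if_powr[OF _ _ int]) (use g finite_measure_axioms in auto)
  have "indep_var borel (X n) borel S"
    unfolding S_def by (rule indep_vars_sum) (auto intro: indep_vars_subset[OF ind])
  then have "indep_var borel (id \<circ> X n) borel (H \<circ> S)"
    by (rule indep_var_compose) auto
  then have iv: "indep_var borel (X n) borel (\<lambda>\<omega>. H (S \<omega>))"
    by (simp add: comp_def)
  have P1: "integrable M (\<lambda>\<omega>. X n \<omega> * H (S \<omega>))" and P2: "expectation (\<lambda>\<omega>. X n \<omega> * H (S \<omega>)) = 0"
    using indep_var_integrable[OF iv XI HS] indep_var_lebesgue_integral[OF iv XI HS] mean by auto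
  let ?R = "\<lambda>\<omega>. \<bar>S \<omega>\<bar> powr g + g * (X n \<omega> * H (S \<omega>)) + 3 * \<bar>X n \<omega>\<bar> powr g"
  have R: "integrable M ?R"
    by (intro Bochner_Integration.integrable_add integrable_mult_right S1 P1 int)
  have le: "\<bar>S \<omega> + X n \<omega>\<bar> powr g \<le> ?R \<omega>" for \<omega>
    using abs_add_powr_expand[OF g, of "S \<omega>" "X n \<omega>"] by (simp add: H_def mult_ac)
  have I: "integrable M (\<lambda>\<omega>. \<bar>S \<omega> + X n \<omega>\<bar> powr g)"
    by (rule Bochner_Integration.integrable_bound[OF R]) (use le in \<open>auto intro: order_trans[OF le abs_ge_self]\<close>)
  have "expectation (\<lambda>\<omega>. \<bar>S \<omega> + X n \<omega>\<bar> powr g) \<le> expectation ?R"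
    by (rule integral_mono[OF I R le])
  also have "\<dots> = expectation (\<lambda>\<omega>. \<bar>S \<omega>\<bar> powr g) + 3 * expectation (\<lambda>\<omega>. \<bar>X n \<omega>\<bar> powr g)"
    using S1 P1 P2 int by simp
  also have "\<dots> \<le> 3 * C * real (Suc n)"
    using S2 C[of n] by (simp add: algebra_simps)
  finally show ?case using I by (simp add: S_def)
qed

text \<open>Consecutive powers \<open>j\<^sup>p\<close> and \<open>(j+1)\<^sup>p\<close> have ratio tending to one. Between them the partial sums
of \<open>x\<close> are monotone and those of \<open>m\<close> grow by at most \<open>C\<close> per step, so the centred averages cannot move by
more than a vanishing amount.\<close>

lemma average_limit_from_subsequence:
  fixes x :: "nat \<Rightarrow> real" and m :: "nat \<Rightarrow> real"
  assumes x: "\<And>k. 0 \<le> x k" and m: "\<And>k. 0 \<le> m k" "\<And>k. m k \<le> C"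
    and p: "p \<ge> 1"
    and lim: "(\<lambda>j. (\<Sum>k<Suc j ^ p. x k - m k) / real (Suc j ^ p)) \<longlonglongrightarrow> 0"
  shows "(\<lambda>n. (\<Sum>k<n. x k - m k) / real n) \<longlonglongrightarrow> 0"
proof -
  define D where "D n = (\<Sum>k<n. x k - m k)" for n
  define N where "N j = Suc j ^ p" for j
  \<comment> \<open>For \<open>n \<ge> 1\<close>, the index with \<open>N (J n) \<le> n < N (J n + 1)\<close>.\<close>
  define J where "J n = (LEAST j. n < N (Suc j))" for n
  have Ninc: "N j < N (Suc j)" for j
    unfolding N_def using p by (intro power_strict_mono) auto
  have Nge: "j < N j" for j
    unfolding N_def using p self_le_power[of "Suc j" p] by simp
  have J1: "n < N (Suc (J n))" for n
    unfolding J_def by (rule LeastI[of _ n]) (use Nge[of "Suc n"] in simp)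
  have J2: "N (J n) \<le> n" if "n \<ge> 1" for n
  proof (cases "J n")
    case 0 then show ?thesis using that by (simp add: N_def)
  next
    case (Suc i)
    have "\<not> n < N (Suc i)"
      using not_less_Least[of i "\<lambda>j. n < N (Suc j)"] Suc by (simp add: J_def)
    then show ?thesis using Suc by simp
  qed
  have Jtop: "filterlim J at_top sequentially"
    unfolding filterlim_at_top
  proof
    fix Z
    have "J n \<ge> Z" if "n \<ge> N Z" for n
    proof (rule ccontr)
      assume "\<not> Z \<le> J n"
      then have "Suc (J n) \<le> Z" by simp
      then have "N (Suc (J n)) \<le> N Z" unfolding N_def by (intro power_mono) auto
      then show False using J1[of n] that by simp
    qed
    then show "eventually (\<lambda>n. Z \<le> J n) sequentially"
      unfolding eventually_sequentially by blast
  qed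
  define r where "r j = real (N (Suc j)) / real (N j)" for j
  have r: "r \<longlonglongrightarrow> 1"
  proof -
    have "(\<lambda>j. (1 + 1 / real (Suc j)) ^ p) \<longlonglongrightarrow> (1 + 0) ^ p"
      by (intro tendsto_intros LIMSEQ_Suc lim_const_over_n)
    moreover have "(1 + 1 / real (Suc j)) ^ p = r j" for j
      unfolding r_def N_def of_nat_power power_divide[symmetric] by (simp add: field_simps)
    ultimately show ?thesis by simp
  qed
  define e where "e j = \<bar>D (N j) / real (N j)\<bar>" for j
  have e: "e \<longlonglongrightarrow> 0"
    using tendsto_rabs_zero[OF lim] unfolding e_def D_def N_def .
  have Npos: "N j > 0" for j by (simp add: N_def)
  define b where "b j = e j + e (Suc j) * r j + C * (r j - 1)" for j
  have "b \<longlonglongrightarrow> 0 + 0 * 1 + C * (1 - 1)"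
    unfolding b_def by (intro tendsto_intros e r LIMSEQ_Suc[OF e])
  then have bJ: "(\<lambda>n. b (J n)) \<longlonglongrightarrow> 0"
    using filterlim_compose[OF _ Jtop] by auto
  have split: "D n = D l + (\<Sum>k=l..<n. x k - m k)" if "l \<le> n" for l n
    unfolding D_def using sum.atLeastLessThan_concat[of 0 l n "\<lambda>k. x k - m k"] that
    by (simp add: atLeast0LessThan)
  have C0: "C \<ge> 0" using m[of 0] by simp
  have low: "D l - C * (real n - real l) \<le> D n" if "l \<le> n" for l n
  proof -
    have "(\<Sum>k=l..<n. x k - m k) \<ge> (\<Sum>k=l..<n. - C)"
      by (rule sum_mono) (use x m in \<open>smt (verit)\<close>)
    then show ?thesis using split[OF that] that by (simp add: algebra_simps of_nat_diff)
  qed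
  have bound: "\<bar>D n / real n\<bar> \<le> b (J n)" if n: "n \<ge> 1" for n
  proof -
    define l where "l = N (J n)"
    define u where "u = N (Suc (J n))"
    have lu: "l \<le> n" "n \<le> u" "0 < l" using J2[OF n] J1[of n] Npos by (auto simp: l_def u_def)
    have 1: "\<bar>D n\<bar> \<le> \<bar>D l\<bar> + \<bar>D u\<bar> + C * (real u - real l)"
    proof -
      have "C * (real n - real l) \<le> C * (real u - real l)" "C * (real u - real n) \<le> C * (real u - real l)"
        using C0 lu by (auto intro!: mult_left_mono)
      then show ?thesis using low[of l n] low[of n u] lu by linarith
    qed
    have "\<bar>D n / real n\<bar> = \<bar>D n\<bar> / real n" by simp
    also have "\<dots> \<le> \<bar>D n\<bar> / real l" using lu by (intro divide_left_mono) auto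
    also have "\<dots> \<le> (\<bar>D l\<bar> + \<bar>D u\<bar> + C * (real u - real l)) / real l"
      using 1 by (rule divide_right_mono) simp
    also have "\<dots> = b (J n)"
    proof -
      have "\<bar>D u / real u\<bar> * (real u / real l) = \<bar>D u\<bar> / real l"
        using lu by simp
      moreover have "C * (real u - real l) / real l = C * (real u / real l - 1)"
        using lu by (simp add: diff_divide_distrib right_diff_distrib)
      ultimately show ?thesis
        unfolding b_def e_def r_def l_def[symmetric] u_def[symmetric]
        using lu by (simp add: add_divide_distrib)
    qed
    finally show ?thesis .
  qed
  have "(\<lambda>n. D n / real n) \<longlonglongrightarrow> 0"
    by (rule Lim_null_comparison[OF _ bJ]) (use bound in \<open>auto simp: eventually_sequentially intro!: exI[of _ 1]\<close>)
  then show ?thesis by (simp add: D_def)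
qed

text \<open>Along the indices \<open>j\<^sup>p\<close> the \<open>g\<close>-th moments of the averages are summable, because the
average of \<open>n\<close> terms has a moment of order \<open>n\<^sup>1\<^sup>-\<^sup>g\<close>. Hence almost surely the \<open>g\<close>-th
powers of the averages are summable, and in particular tend to zero.\<close>

lemma (in prob_space) slln_subsequence:
  fixes X :: "nat \<Rightarrow> 'a \<Rightarrow> real"
  assumes g: "1 < g" "g \<le> 2"
    and ind: "indep_vars (\<lambda>_. borel) X UNIV"
    and int: "\<And>k. integrable M (\<lambda>\<omega>. \<bar>X k \<omega>\<bar> powr g)"
    and mean: "\<And>k. expectation (X k) = 0"
    and C: "\<And>k. expectation (\<lambda>\<omega>. \<bar>X k \<omega>\<bar> powr g) \<le> C"
    and p: "real p * (g - 1) \<ge> 2"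
  shows "AE \<omega> in M. (\<lambda>j. (\<Sum>k<Suc j ^ p. X k \<omega>) / real (Suc j ^ p)) \<longlonglongrightarrow> 0"
proof -
  have rv[measurable]: "X k \<in> borel_measurable M" for k
    using ind by (auto simp: indep_vars_def)
  define Y where "Y j \<omega> = (\<Sum>k<Suc j ^ p. X k \<omega>) / real (Suc j ^ p)" for j \<omega>
  have [measurable]: "Y j \<in> borel_measurable M" for j unfolding Y_def by measurable
  have C0: "C \<ge> 0"
    using order_trans[OF _ C[of 0]] by (auto intro!: integral_nonneg_AE)
  have Yint: "integrable M (\<lambda>\<omega>. \<bar>Y j \<omega>\<bar> powr g)"
    and Yle: "expectation (\<lambda>\<omega>. \<bar>Y j \<omega>\<bar> powr g) \<le> 3 * C * inverse (real (Suc j) ^ 2)" for j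
  proof -
    define n where "n = Suc j ^ p"
    have n: "n > 0" by (simp add: n_def)
    note * = sum_moment_bound[OF g ind int mean C, of n]
    have eq: "\<bar>Y j \<omega>\<bar> powr g = \<bar>\<Sum>k<n. X k \<omega>\<bar> powr g / real n powr g" for \<omega>
      unfolding Y_def n_def[symmetric] using n by (simp add: abs_divide powr_divide)
    show "integrable M (\<lambda>\<omega>. \<bar>Y j \<omega>\<bar> powr g)" unfolding eq using * by auto
    have "expectation (\<lambda>\<omega>. \<bar>Y j \<omega>\<bar> powr g) = expectation (\<lambda>\<omega>. \<bar>\<Sum>k<n. X k \<omega>\<bar> powr g) / real n powr g"
      unfolding eq by simp
    also have "\<dots> \<le> 3 * C * real n / real n powr g"
      using * by (intro divide_right_mono) auto
    also have "\<dots> = 3 * C * real n powr (1 - g)"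
      using n by (simp add: powr_diff)
    also have "real n powr (1 - g) = real (Suc j) powr (real p * (1 - g))"
      by (simp add: n_def powr_powr[symmetric] powr_realpow del: of_nat_Suc)
    also have "\<dots> \<le> real (Suc j) powr (- 2)"
      using p by (intro powr_mono) (auto simp: algebra_simps)
    also have "real (Suc j) powr (- 2) = inverse (real (Suc j) ^ 2)"
      by (simp add: powr_minus powr_numeral del: of_nat_Suc)
    finally show "expectation (\<lambda>\<omega>. \<bar>Y j \<omega>\<bar> powr g) \<le> 3 * C * inverse (real (Suc j) ^ 2)"
      using C0 by (simp add: mult_left_mono)
  qed
  have sm: "summable (\<lambda>j. 3 * C * inverse (real (Suc j) ^ 2))"
    by (intro summable_mult, subst summable_Suc_iff) (rule inverse_power_summable, simp)
  have "(\<integral>\<^sup>+\<omega>. (\<Sum>j. ennreal (\<bar>Y j \<omega>\<bar> powr g)) \<partial>M) = (\<Sum>j. \<integral>\<^sup>+\<omega>. ennreal (\<bar>Y j \<omega>\<bar> powr g) \<partial>M)"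
    by (rule nn_integral_suminf) measurable
  also have "\<dots> = (\<Sum>j. ennreal (expectation (\<lambda>\<omega>. \<bar>Y j \<omega>\<bar> powr g)))"
    by (intro suminf_cong nn_integral_eq_integral Yint) auto
  also have "\<dots> \<le> (\<Sum>j. ennreal (3 * C * inverse (real (Suc j) ^ 2)))"
    by (intro suminf_le ennreal_leI Yle) auto
  also have "\<dots> < \<infinity>"
    using sm C0 by (subst suminf_ennreal_eq[OF _ summable_sums]) (auto)
  finally have "AE \<omega> in M. (\<Sum>j. ennreal (\<bar>Y j \<omega>\<bar> powr g)) \<noteq> \<infinity>"
    by (intro nn_integral_PInf_AE) auto
  then have "AE \<omega> in M. (\<lambda>j. Y j \<omega>) \<longlonglongrightarrow> 0"
  proof eventually_elim
    case (elim \<omega>)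
    have "summable (\<lambda>j. \<bar>Y j \<omega>\<bar> powr g)"
      using elim by (intro summable_suminf_not_top) (auto simp: top_unique)
    then have "(\<lambda>j. \<bar>Y j \<omega>\<bar> powr g) \<longlonglongrightarrow> 0" by (rule summable_LIMSEQ_zero)
    then have "(\<lambda>j. (\<bar>Y j \<omega>\<bar> powr g) powr (1 / g)) \<longlonglongrightarrow> 0 powr (1 / g)"
      by (intro tendsto_powr') (use g in auto)
    then have "(\<lambda>j. \<bar>Y j \<omega>\<bar>) \<longlonglongrightarrow> 0"
      using g by (simp add: powr_powr)
    then show ?case by (rule tendsto_rabs_zero_cancel)
  qed
  then show ?thesis by (simp add: Y_def)
qed

lemma (in prob_space) slln_nonneg:
  fixes X :: "nat \<Rightarrow> 'a \<Rightarrow> real"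
  assumes g: "1 < g" "g \<le> 2"
    and ind: "indep_vars (\<lambda>_. borel) X UNIV"
    and int: "\<And>k. integrable M (\<lambda>\<omega>. \<bar>X k \<omega>\<bar> powr g)"
    and C: "\<And>k. expectation (\<lambda>\<omega>. \<bar>X k \<omega>\<bar> powr g) \<le> C"
    and nonneg: "\<And>k \<omega>. 0 \<le> X k \<omega>"
  shows "AE \<omega> in M. (\<lambda>n. (\<Sum>k<n. X k \<omega> - expectation (X k)) / real n) \<longlonglongrightarrow> 0"
proof -
  have rv[measurable]: "X k \<in> borel_measurable M" for k
    using ind by (auto simp: indep_vars_def)
  have XI: "integrable M (X k)" for k
    by (rule integrable_if_powr[OF _ _ int]) (use g finite_measure_axioms in auto)
  have m0: "0 \<le> expectation (X k)" for k
    by (intro integral_nonneg_AE) (use nonneg in auto)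
  have m1: "expectation (X k) \<le> 1 + C" for k
  proof -
    have "expectation (X k) \<le> expectation (\<lambda>\<omega>. 1 + \<bar>X k \<omega>\<bar> powr g)"
    proof (rule integral_mono[OF XI])
      show "X k \<omega> \<le> 1 + \<bar>X k \<omega>\<bar> powr g" for \<omega>
        using abs_le_one_add_powr[of 1 g "X k \<omega>"] g nonneg[of k \<omega>] by simp
    qed (use int in auto)
    also have "\<dots> = 1 + expectation (\<lambda>\<omega>. \<bar>X k \<omega>\<bar> powr g)"
      using int by (simp add: prob_space)
    finally show ?thesis using C[of k] by simp
  qed
  define Y where "Y k \<omega> = X k \<omega> - expectation (X k)" for k \<omega>
  have Yind: "indep_vars (\<lambda>_. borel) Y UNIV"
    unfolding Y_def by (rule indep_vars_compose2[OF ind]) auto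
  have Yle: "\<bar>Y k \<omega>\<bar> powr g \<le> 2 powr g * (\<bar>X k \<omega>\<bar> powr g + (1 + C) powr g)" for k \<omega>
  proof -
    have "\<bar>X k \<omega> + - expectation (X k)\<bar> powr g \<le> 2 powr g * (\<bar>X k \<omega>\<bar> powr g + \<bar>- expectation (X k)\<bar> powr g)"
      by (rule abs_add_powr_le) (use g in auto)
    also have "\<dots> \<le> 2 powr g * (\<bar>X k \<omega>\<bar> powr g + (1 + C) powr g)"
      using m0[of k] m1[of k] g by (intro mult_left_mono add_left_mono powr_mono2) auto
    finally show ?thesis by (simp add: Y_def)
  qed
  have Yint: "integrable M (\<lambda>\<omega>. \<bar>Y k \<omega>\<bar> powr g)" for k
  proof (rule Bochner_Integration.integrable_bound)
    show "integrable M (\<lambda>\<omega>. 2 powr g * (\<bar>X k \<omega>\<bar> powr g + (1 + C) powr g))" using int by auto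
  qed (use Yle in \<open>auto simp: Y_def intro!: AE_I2 order_trans[OF _ abs_ge_self]\<close>)
  have YC: "expectation (\<lambda>\<omega>. \<bar>Y k \<omega>\<bar> powr g) \<le> 2 powr g * (C + (1 + C) powr g)" for k
  proof -
    have "expectation (\<lambda>\<omega>. \<bar>Y k \<omega>\<bar> powr g) \<le> expectation (\<lambda>\<omega>. 2 powr g * (\<bar>X k \<omega>\<bar> powr g + (1 + C) powr g))"
      by (rule integral_mono[OF Yint _ Yle]) (use int in auto)
    also have "\<dots> = 2 powr g * (expectation (\<lambda>\<omega>. \<bar>X k \<omega>\<bar> powr g) + (1 + C) powr g)"
      using int by (simp add: prob_space)
    also have "\<dots> \<le> 2 powr g * (C + (1 + C) powr g)" using C by (intro mult_left_mono) auto
    finally show ?thesis .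
  qed
  have Ymean: "expectation (Y k) = 0" for k
    unfolding Y_def using XI by (simp add: prob_space)
  \<comment> \<open>With this exponent the moments along \<open>j\<^sup>p\<close> are dominated by \<open>j\<^sup>-\<^sup>2\<close>.\<close>
  obtain p :: nat where p: "2 / (g - 1) \<le> real p" using real_arch_simple by blast
  then have p2: "real p * (g - 1) \<ge> 2" using g by (simp add: field_simps)
  have p1: "p \<ge> 1" using p2 by (cases p) auto
  from slln_subsequence[OF g Yind Yint Ymean YC p2] show ?thesis
  proof eventually_elim
    case (elim \<omega>)
    show ?case
      by (rule average_limit_from_subsequence[where C = "1 + C" and p = p])
         (use elim p1 m0 m1 nonneg in \<open>auto simp: Y_def\<close>)
  qed
qed

text \<open>Positive and negative parts are treated separately, since the passage from a subsequence to all
indices needs monotone partial sums.\<close>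

lemma (in prob_space) slln:
  fixes X :: "nat \<Rightarrow> 'a \<Rightarrow> real"
  assumes g: "1 < g" "g \<le> 2"
    and ind: "indep_vars (\<lambda>_. borel) X UNIV"
    and int: "\<And>k. integrable M (\<lambda>\<omega>. \<bar>X k \<omega>\<bar> powr g)"
    and C: "\<And>k. expectation (\<lambda>\<omega>. \<bar>X k \<omega>\<bar> powr g) \<le> C"
  shows "AE \<omega> in M. (\<lambda>n. (\<Sum>k<n. X k \<omega> - expectation (X k)) / real n) \<longlonglongrightarrow> 0"
proof -
  have rv[measurable]: "X k \<in> borel_measurable M" for k
    using ind by (auto simp: indep_vars_def)
  have XI: "integrable M (X k)" for k
    by (rule integrable_if_powr[OF _ _ int]) (use g finite_measure_axioms in auto)
  have part: "AE \<omega> in M. (\<lambda>n. (\<Sum>k<n. max 0 (s * X k \<omega>) - expectation (\<lambda>\<omega>. max 0 (s * X k \<omega>))) / real n) \<longlonglongrightarrow> 0"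
    if s: "\<bar>s\<bar> = 1" for s :: real
  proof (rule slln_nonneg[OF g, where C = C])
    show "indep_vars (\<lambda>_. borel) (\<lambda>k \<omega>. max 0 (s * X k \<omega>)) UNIV"
      by (rule indep_vars_compose2[OF ind]) auto
    have le: "\<bar>max 0 (s * X k \<omega>)\<bar> powr g \<le> \<bar>X k \<omega>\<bar> powr g" for k \<omega>
      using s g abs_ge_self[of "s * X k \<omega>"] by (intro powr_mono2) (auto simp: max_def abs_mult)
    show i: "integrable M (\<lambda>\<omega>. \<bar>max 0 (s * X k \<omega>)\<bar> powr g)" for k
      by (rule Bochner_Integration.integrable_bound[OF int[of k]]) (use le in auto)
    show "expectation (\<lambda>\<omega>. \<bar>max 0 (s * X k \<omega>)\<bar> powr g) \<le> C" for k
      using integral_mono[OF i int le] C[of k] by (rule order_trans)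
  qed auto
  have mean: "expectation (X k) = expectation (\<lambda>\<omega>. max 0 (1 * X k \<omega>)) - expectation (\<lambda>\<omega>. max 0 (- 1 * X k \<omega>))" for k
  proof -
    have "expectation (X k) = expectation (\<lambda>\<omega>. max 0 (1 * X k \<omega>) - max 0 (- 1 * X k \<omega>))"
      by (rule Bochner_Integration.integral_cong) (auto simp: max_def)
    also have "\<dots> = expectation (\<lambda>\<omega>. max 0 (1 * X k \<omega>)) - expectation (\<lambda>\<omega>. max 0 (- 1 * X k \<omega>))"
      using XI[of k] by (intro Bochner_Integration.integral_diff integrable_max) auto
    finally show ?thesis .
  qed
  show ?thesis
    using part[of 1, simplified] part[of "-1", simplified]
  proof eventually_elim
    case (elim \<omega>)
    define A where "A k = max 0 (X k \<omega>) - expectation (\<lambda>\<omega>. max 0 (X k \<omega>))" for k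
    define B where "B k = max 0 (- X k \<omega>) - expectation (\<lambda>\<omega>. max 0 (- X k \<omega>))" for k
    have eq: "X k \<omega> - expectation (X k) = A k - B k" for k
    proof -
      have "X k \<omega> = max 0 (X k \<omega>) - max 0 (- X k \<omega>)" by (simp add: max_def)
      then show ?thesis using mean[of k, simplified] unfolding A_def B_def by linarith
    qed
    have "(\<lambda>n. (\<Sum>k<n. A k) / real n - (\<Sum>k<n. B k) / real n) \<longlonglongrightarrow> 0 - 0"
      by (rule tendsto_diff) (use elim in \<open>simp_all add: A_def B_def\<close>)
    then show ?case
      by (simp add: eq sum_subtractf diff_divide_distrib)
  qed
qed

section \<open>Extreme laws with extremal mean\<close>

lemma convex_nn_integral:
  assumes sets: "sets Q = sets P" "sets R = sets P"
    and fin: "finite_measure P" "finite_measure Q" "finite_measure R"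
    and t: "0 \<le> t" "t \<le> 1"
    and conv: "\<And>A. A \<in> sets P \<Longrightarrow> measure P A = t * measure Q A + (1 - t) * measure R A"
    and f: "f \<in> borel_measurable P"
  shows "(\<integral>\<^sup>+x. f x \<partial>P) = ennreal t * (\<integral>\<^sup>+x. f x \<partial>Q) + ennreal (1 - t) * (\<integral>\<^sup>+x. f x \<partial>R)"
  using f
proof (induction rule: borel_measurable_induct)
  case (cong f g)
  have sp: "space Q = space P" "space R = space P" using sets by (auto dest: sets_eq_imp_space_eq)
  have "(\<integral>\<^sup>+x. f x \<partial>P) = (\<integral>\<^sup>+x. g x \<partial>P)" "(\<integral>\<^sup>+x. f x \<partial>Q) = (\<integral>\<^sup>+x. g x \<partial>Q)" "(\<integral>\<^sup>+x. f x \<partial>R) = (\<integral>\<^sup>+x. g x \<partial>R)"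
    using cong(3) sp by (auto intro!: nn_integral_cong)
  then show ?case using cong by simp
next
  case (set A)
  then have "emeasure P A = ennreal t * emeasure Q A + ennreal (1 - t) * emeasure R A"
    using t sets fin by (simp add: finite_measure.emeasure_eq_measure conv ennreal_mult ennreal_plus)
  then show ?case using set sets by simp
next
  case (mult u c)
  then have [measurable]: "u \<in> borel_measurable P" "u \<in> borel_measurable Q" "u \<in> borel_measurable R"
    using sets by (auto cong: measurable_cong_sets)
  show ?case using mult by (simp add: nn_integral_cmult distrib_left mult_ac)
next
  case (add u v)
  then have [measurable]: "u \<in> borel_measurable P" "u \<in> borel_measurable Q" "u \<in> borel_measurable R"
      "v \<in> borel_measurable P" "v \<in> borel_measurable Q" "v \<in> borel_measurable R"
    using sets by (auto cong: measurable_cong_sets)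
  show ?case using add by (simp add: nn_integral_add distrib_left add_ac)
next
  case (seq U)
  then have [measurable]: "U i \<in> borel_measurable P" "U i \<in> borel_measurable Q" "U i \<in> borel_measurable R" for i
    using sets by (auto cong: measurable_cong_sets)
  have inc: "incseq (\<lambda>i. integral\<^sup>N M (U i))" for M
    using seq(3) by (auto simp: incseq_def le_fun_def intro!: nn_integral_mono)
  have "(\<integral>\<^sup>+x. (SUP i. U i) x \<partial>P) = (SUP i. \<integral>\<^sup>+x. U i x \<partial>P)"
    using seq by (simp add: nn_integral_monotone_convergence_SUP SUP_apply image_comp)
  also have "\<dots> = (SUP i. ennreal t * (\<integral>\<^sup>+x. U i x \<partial>Q) + ennreal (1 - t) * (\<integral>\<^sup>+x. U i x \<partial>R))"
    using seq by simp
  also have "\<dots> = ennreal t * (SUP i. \<integral>\<^sup>+x. U i x \<partial>Q) + ennreal (1 - t) * (SUP i. \<integral>\<^sup>+x. U i x \<partial>R)"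
    using inc[of Q] inc[of R]
    by (subst ennreal_SUP_add) (auto simp: SUP_mult_left_ennreal incseq_def intro!: mult_left_mono)
  also have "\<dots> = ennreal t * (\<integral>\<^sup>+x. (SUP i. U i) x \<partial>Q) + ennreal (1 - t) * (\<integral>\<^sup>+x. (SUP i. U i) x \<partial>R)"
    using seq by (simp add: nn_integral_monotone_convergence_SUP SUP_apply image_comp)
  finally show ?case .
qed

lemma convex_integral:
  fixes f :: "'a \<Rightarrow> real"
  assumes sets: "sets Q = sets P" "sets R = sets P"
    and fin: "finite_measure P" "finite_measure Q" "finite_measure R"
    and t: "0 \<le> t" "t \<le> 1"
    and conv: "\<And>A. A \<in> sets P \<Longrightarrow> measure P A = t * measure Q A + (1 - t) * measure R A"
    and f: "integrable Q f" "integrable R f"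
  shows "integrable P f \<and> (\<integral>x. f x \<partial>P) = t * (\<integral>x. f x \<partial>Q) + (1 - t) * (\<integral>x. f x \<partial>R)"
proof -
  have fQ: "f \<in> borel_measurable Q" using f by auto
  then have [measurable]: "f \<in> borel_measurable P"
    using sets by (auto cong: measurable_cong_sets)
  note nn = convex_nn_integral[OF sets fin t conv]
  have fin: "(\<integral>\<^sup>+x. ennreal (g (f x)) \<partial>M) < \<infinity>" if "integrable M f" "\<And>x. g x \<le> \<bar>x\<bar>" for g :: "real \<Rightarrow> real" and M
  proof -
    have "(\<integral>\<^sup>+x. ennreal (g (f x)) \<partial>M) \<le> (\<integral>\<^sup>+x. ennreal (norm (f x)) \<partial>M)"
      using that by (intro nn_integral_mono ennreal_leI) auto
    also have "\<dots> < \<infinity>" using that by (simp add: integrable_iff_bounded)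
    finally show ?thesis .
  qed
  have "(\<integral>\<^sup>+x. ennreal (norm (f x)) \<partial>P) = ennreal t * (\<integral>\<^sup>+x. ennreal (norm (f x)) \<partial>Q) + ennreal (1 - t) * (\<integral>\<^sup>+x. ennreal (norm (f x)) \<partial>R)"
    by (rule nn) auto
  also have "\<dots> < \<infinity>"
    using f by (auto simp: integrable_iff_bounded ennreal_mult_less_top)
  finally have P: "integrable P f"
    by (auto simp: integrable_iff_bounded)
  have part: "enn2real (\<integral>\<^sup>+x. ennreal (g (f x)) \<partial>P) = t * enn2real (\<integral>\<^sup>+x. ennreal (g (f x)) \<partial>Q) + (1 - t) * enn2real (\<integral>\<^sup>+x. ennreal (g (f x)) \<partial>R)"
    if g: "\<And>x. g x \<le> \<bar>x\<bar>" and [measurable]: "g \<in> borel_measurable borel" for g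
  proof -
    have "(\<integral>\<^sup>+x. ennreal (g (f x)) \<partial>P) = ennreal t * (\<integral>\<^sup>+x. ennreal (g (f x)) \<partial>Q) + ennreal (1 - t) * (\<integral>\<^sup>+x. ennreal (g (f x)) \<partial>R)"
      by (rule nn) auto
    then show ?thesis
      using fin[OF f(1) g] fin[OF f(2) g] t
      by (simp add: enn2real_plus enn2real_mult ennreal_mult_less_top)
  qed
  have "(\<integral>x. f x \<partial>P) = t * (\<integral>x. f x \<partial>Q) + (1 - t) * (\<integral>x. f x \<partial>R)"
    unfolding real_lebesgue_integral_def[OF P] real_lebesgue_integral_def[OF f(1)] real_lebesgue_integral_def[OF f(2)]
    using part[of "\<lambda>x. x", OF abs_ge_self] part[of uminus, OF abs_ge_minus_self] by (simp add: algebra_simps)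
  then show ?thesis using P by simp
qed

definition moment_bounded :: "real \<Rightarrow> real \<Rightarrow> real measure \<Rightarrow> bool" where
  "moment_bounded g C \<mu> \<longleftrightarrow> real_distribution \<mu> \<and> (\<integral>\<^sup>+x. ennreal (\<bar>x\<bar> powr g) \<partial>\<mu>) \<le> ennreal C"

lemma moment_bounded_integrable:
  assumes "moment_bounded g C \<mu>" "C \<ge> 0"
  shows "integrable \<mu> (\<lambda>x. \<bar>x\<bar> powr g)" "(\<integral>x. \<bar>x\<bar> powr g \<partial>\<mu>) \<le> C"
proof -
  interpret real_distribution \<mu> using assms by (simp add: moment_bounded_def)
  have le: "(\<integral>\<^sup>+x. ennreal (\<bar>x\<bar> powr g) \<partial>\<mu>) \<le> ennreal C" using assms by (simp add: moment_bounded_def)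
  show I: "integrable \<mu> (\<lambda>x. \<bar>x\<bar> powr g)"
    using le by (auto simp: integrable_iff_bounded intro: le_less_trans)
  have "ennreal (\<integral>x. \<bar>x\<bar> powr g \<partial>\<mu>) \<le> ennreal C"
    using le nn_integral_eq_integral[OF I] by simp
  then show "(\<integral>x. \<bar>x\<bar> powr g \<partial>\<mu>) \<le> C" using assms by simp
qed

lemma moment_bounded_mean:
  assumes "moment_bounded g C \<mu>" "C \<ge> 0" "g \<ge> 1"
  shows "integrable \<mu> (\<lambda>x. x)"
proof -
  interpret real_distribution \<mu> using assms by (simp add: moment_bounded_def)
  show ?thesis
    by (rule integrable_if_powr[OF _ _ moment_bounded_integrable(1)[OF assms(1,2)]])
       (use assms finite_measure_axioms in auto)
qed

lemma moment_bounded_tight: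
  assumes mb: "\<And>n. moment_bounded g C (u n)" and C: "C \<ge> 0" and g: "g \<ge> 1"
  shows "tight u"
  unfolding tight_def
proof (intro conjI allI impI)
  show rd: "real_distribution (u n)" for n using mb by (simp add: moment_bounded_def)
  fix \<epsilon> :: real assume e: "\<epsilon> > 0"
  \<comment> \<open>Markov's inequality with \<open>\<integral>\<bar>x\<bar> \<le> 1 + C\<close>; the additional one makes the bound strict.\<close>
  define K where "K = (C + 2) / \<epsilon>"
  have K: "K > 0" using C e by (simp add: K_def)
  show "\<exists>a b. a < b \<and> (\<forall>n. 1 - \<epsilon> < measure (u n) {a<..b})"
  proof (intro exI conjI allI)
    show "- K < K" using K by simp
    fix n
    interpret real_distribution "u n" by (rule rd)
    have i: "integrable (u n) (\<lambda>x. \<bar>x\<bar>)"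
      using moment_bounded_mean[OF mb C g] by simp
    have "measure (u n) {x \<in> space (u n). K \<le> \<bar>x\<bar>} \<le> expectation (\<lambda>x. \<bar>x\<bar>) / K"
      by (rule integral_Markov_inequality_measure[OF i]) (use K in auto)
    also have "expectation (\<lambda>x. \<bar>x\<bar>) \<le> expectation (\<lambda>x. 1 + \<bar>x\<bar> powr g)"
    proof (rule integral_mono[OF i])
      show "\<bar>x\<bar> \<le> 1 + \<bar>x\<bar> powr g" for x :: real using abs_le_one_add_powr[of 1 g x] g by simp
    qed (use moment_bounded_integrable(1)[OF mb C] in auto)
    also have "\<dots> \<le> 1 + C"
      using moment_bounded_integrable[OF mb C, of n] prob_space by simp
    finally have "measure (u n) {x \<in> space (u n). K \<le> \<bar>x\<bar>} \<le> (1 + C) / K" using K by (simp add: divide_right_mono)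
    also have "\<dots> < \<epsilon>" using e C by (simp add: K_def field_simps)
    finally have "measure (u n) {x. K \<le> \<bar>x\<bar>} < \<epsilon>" by simp
    moreover have "measure (u n) (- {- K<..K}) \<le> measure (u n) {x. K \<le> \<bar>x\<bar>}"
      by (intro finite_measure_mono) auto
    moreover have "measure (u n) (- {- K<..K}) = 1 - measure (u n) {- K<..K}"
      using prob_compl[of "{- K<..K}"] by (simp add: Compl_eq_Diff_UNIV)
    ultimately show "1 - \<epsilon> < measure (u n) {- K<..K}" by linarith
  qed
qed

text \<open>The mean is approximated by integrals of bounded continuous functions, uniformly over laws with
a common moment bound; this is the uniform integrability behind the next lemma.\<close>

lemma mean_truncation:
  assumes mb: "moment_bounded g C \<mu>" and C: "C \<ge> 0" and g: "g > 1" and K: "K > 0"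
  shows "\<bar>(\<integral>x. x \<partial>\<mu>) - (\<integral>x. max (- K) (min K x) \<partial>\<mu>)\<bar> \<le> C / K powr (g - 1)"
proof -
  interpret real_distribution \<mu> using mb by (simp add: moment_bounded_def)
  have i: "integrable \<mu> (\<lambda>x. x)" using moment_bounded_mean[OF mb C] g by simp
  have i2: "integrable \<mu> (\<lambda>x. max (- K) (min K x))" using i by auto
  have le: "\<bar>x - max (- K) (min K x)\<bar> \<le> \<bar>x\<bar> powr g / K powr (g - 1)" for x
  proof (cases "\<bar>x\<bar> \<le> K")
    case True then show ?thesis by (auto simp: max_def min_def)
  next
    case False
    have "\<bar>x - max (- K) (min K x)\<bar> \<le> \<bar>x\<bar>" using K by (auto simp: max_def min_def)
    also have "\<dots> = \<bar>x\<bar> powr g / \<bar>x\<bar> powr (g - 1)" using False K by (simp add: powr_diff)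
    also have "\<dots> \<le> \<bar>x\<bar> powr g / K powr (g - 1)"
      using False K g by (intro divide_left_mono powr_mono2) auto
    finally show ?thesis .
  qed
  have "\<bar>(\<integral>x. x \<partial>\<mu>) - (\<integral>x. max (- K) (min K x) \<partial>\<mu>)\<bar> = \<bar>\<integral>x. x - max (- K) (min K x) \<partial>\<mu>\<bar>"
    using i i2 by simp
  also have "\<dots> \<le> (\<integral>x. \<bar>x - max (- K) (min K x)\<bar> \<partial>\<mu>)" by (rule integral_abs_bound)
  also have "\<dots> \<le> (\<integral>x. \<bar>x\<bar> powr g / K powr (g - 1) \<partial>\<mu>)"
    by (rule integral_mono[OF _ _ le]) (use i i2 moment_bounded_integrable(1)[OF mb C] in auto)
  also have "\<dots> = (\<integral>x. \<bar>x\<bar> powr g \<partial>\<mu>) / K powr (g - 1)" by simp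
  also have "\<dots> \<le> C / K powr (g - 1)"
    by (intro divide_right_mono moment_bounded_integrable(2)[OF mb C]) auto
  finally show ?thesis .
qed

lemma mean_weakly_continuous:
  assumes mb: "\<And>n. moment_bounded g C (u n)" "moment_bounded g C \<mu>" and C: "C \<ge> 0" and g: "g > 1"
    and conv: "weak_conv_m u \<mu>"
  shows "(\<lambda>n. \<integral>x. x \<partial>u n) \<longlonglongrightarrow> (\<integral>x. x \<partial>\<mu>)"
proof (rule LIMSEQ_I)
  fix r :: real assume r: "r > 0"
  have "((\<lambda>K. C / K powr (g - 1)) \<longlongrightarrow> 0) at_top"
    using tendsto_mult_left[OF tendsto_neg_powr[OF _ filterlim_ident], of "- (g - 1)" C] g
    unfolding powr_minus divide_inverse by simp
  then have "eventually (\<lambda>K. C / K powr (g - 1) < r / 3) at_top"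
    using r by (intro order_tendstoD(2)) auto
  then have "eventually (\<lambda>K. C / K powr (g - 1) < r / 3 \<and> K > 0) at_top"
    using eventually_gt_at_top by (rule eventually_conj)
  then obtain K where K: "C / K powr (g - 1) < r / 3" "K > 0"
    by (auto simp: eventually_at_top_linorder)
  have "(\<lambda>n. \<integral>x. max (- K) (min K x) \<partial>u n) \<longlonglongrightarrow> (\<integral>x. max (- K) (min K x) \<partial>\<mu>)"
    by (rule weak_conv_imp_integral_bdd_continuous_conv[where B = K, OF _ _ conv])
       (use mb K in \<open>auto simp: moment_bounded_def intro!: continuous_intros\<close>)
  then have "\<exists>N. \<forall>n\<ge>N. norm ((\<integral>x. max (- K) (min K x) \<partial>u n) - (\<integral>x. max (- K) (min K x) \<partial>\<mu>)) < r / 3"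
    using r by (intro LIMSEQ_D) auto
  then obtain N where N: "\<And>n. n \<ge> N \<Longrightarrow> \<bar>(\<integral>x. max (- K) (min K x) \<partial>u n) - (\<integral>x. max (- K) (min K x) \<partial>\<mu>)\<bar> < r / 3"
    by auto
  have "norm ((\<integral>x. x \<partial>u n) - (\<integral>x. x \<partial>\<mu>)) < r" if "n \<ge> N" for n
    using N[OF that] mean_truncation[OF mb(1) C g K(2), of n] mean_truncation[OF mb(2) C g K(2)] K(1)
    by (simp only: real_norm_def)
  then show "\<exists>N. \<forall>n\<ge>N. norm ((\<integral>x. x \<partial>u n) - (\<integral>x. x \<partial>\<mu>)) < r" by blast
qed

text \<open>Weak compactness enters only through this form, which needs no topology on the space of
measures.\<close>

lemma attains_sup_subsequence:
  fixes F :: "'a \<Rightarrow> real"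
  assumes ne: "K \<noteq> {}"
    and sub: "\<And>u. (\<And>n. u n \<in> K) \<Longrightarrow> \<exists>s \<mu>. strict_mono (s :: nat \<Rightarrow> nat) \<and> \<mu> \<in> K \<and> (\<lambda>n. F (u (s n))) \<longlonglongrightarrow> F \<mu>"
  shows "\<exists>\<mu>\<in>K. \<forall>\<nu>\<in>K. F \<nu> \<le> F \<mu>"
proof -
  have "seq_compact (F ` K)"
    unfolding seq_compact_def
  proof (intro allI impI)
    fix f :: "nat \<Rightarrow> real" assume "\<forall>n. f n \<in> F ` K"
    then have "\<forall>n. \<exists>x. x \<in> K \<and> f n = F x" by blast
    then obtain u where u: "\<And>n. u n \<in> K" "\<And>n. f n = F (u n)" by metis
    obtain s \<mu> where "strict_mono (s :: nat \<Rightarrow> nat)" "\<mu> \<in> K" "(\<lambda>n. F (u (s n))) \<longlonglongrightarrow> F \<mu>"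
      using sub[of u] u by blast
    then show "\<exists>l\<in>F ` K. \<exists>r. strict_mono r \<and> (f \<circ> r) \<longlonglongrightarrow> l"
      using u by (intro bexI[of _ "F \<mu>"] exI[of _ s]) (auto simp: comp_def)
  qed
  then have "compact (F ` K)" by (simp add: compact_eq_seq_compact_metric)
  then show ?thesis using compact_attains_sup[of "F ` K"] ne by auto
qed

text \<open>A weakly continuous strictly convex functional on laws. The weights charge every rational
number, and the values at the rationals determine a characteristic function because it is continuous.\<close>

definition char_energy :: "real measure \<Rightarrow> real" where
  "char_energy \<mu> = measure_pmf.expectation (map_pmf from_nat (geometric_pmf (1/2)) :: rat pmf)
     (\<lambda>q. (cmod (char \<mu> (of_rat q)))\<^sup>2)"

lemma char_energy_continuous:
  assumes rd: "\<And>n. real_distribution (u n)" "real_distribution \<mu>" and conv: "weak_conv_m u \<mu>"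
  shows "(\<lambda>n. char_energy (u n)) \<longlonglongrightarrow> char_energy \<mu>"
  unfolding char_energy_def
proof (rule integral_dominated_convergence[where w = "\<lambda>_. 1"])
  show "AE q in measure_pmf (map_pmf from_nat (geometric_pmf (1 / 2))). (\<lambda>n. (cmod (char (u n) (of_rat q)))\<^sup>2) \<longlonglongrightarrow> (cmod (char \<mu> (of_rat q)))\<^sup>2"
    by (intro AE_I2 tendsto_intros levy_continuity1 rd conv)
  show "AE q in measure_pmf (map_pmf from_nat (geometric_pmf (1 / 2))). norm ((cmod (char (u n) (of_rat q)))\<^sup>2) \<le> 1" for n
    using real_distribution.cmod_char_le_1[OF rd(1)] by (auto intro!: AE_I2 power_le_one)
qed auto

lemma char_convex:
  assumes rd: "real_distribution P" "real_distribution Q" "real_distribution R"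
    and t: "0 \<le> t" "t \<le> 1"
    and conv: "\<And>A. A \<in> sets P \<Longrightarrow> measure P A = t * measure Q A + (1 - t) * measure R A"
  shows "char P x = of_real t * char Q x + of_real (1 - t) * char R x"
proof -
  have char: "char M x = Complex (\<integral>y. cos (x * y) \<partial>M) (\<integral>y. sin (x * y) \<partial>M)"
    and int: "integrable M (\<lambda>y. cos (x * y))" "integrable M (\<lambda>y. sin (x * y))"
    if "real_distribution M" for M
  proof -
    interpret real_distribution M by fact
    have I: "integrable M (\<lambda>y. iexp (x * y))" by (intro integrable_iexp) auto
    show "integrable M (\<lambda>y. cos (x * y))" "integrable M (\<lambda>y. sin (x * y))"
      by (auto intro!: integrable_const_bound[where B = 1])
    show "char M x = Complex (\<integral>y. cos (x * y) \<partial>M) (\<integral>y. sin (x * y) \<partial>M)"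
      unfolding char_def using I
      by (intro complex_eqI) (simp_all add: integral_Re[symmetric] integral_Im[symmetric] Re_exp Im_exp)
  qed
  have s: "sets Q = sets P" "sets R = sets P"
    using rd by (auto simp: real_distribution.events_eq_borel)
  have f: "finite_measure P" "finite_measure Q" "finite_measure R"
    using rd by (auto simp: real_distribution_def prob_space_def)
  note c = convex_integral[OF s f t conv]
  have "(\<integral>y. cos (x * y) \<partial>P) = t * (\<integral>y. cos (x * y) \<partial>Q) + (1 - t) * (\<integral>y. cos (x * y) \<partial>R)"
    using c[OF _ int(1)[OF rd(2)] int(1)[OF rd(3)]] by simp
  moreover have "(\<integral>y. sin (x * y) \<partial>P) = t * (\<integral>y. sin (x * y) \<partial>Q) + (1 - t) * (\<integral>y. sin (x * y) \<partial>R)"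
    using c[OF _ int(2)[OF rd(2)] int(2)[OF rd(3)]] by simp
  ultimately show ?thesis
    by (simp add: char rd complex_eq_iff)
qed

text \<open>In a convex combination, the squared modulus of a convex combination of \<open>z\<close> and \<open>w\<close> falls short
of the combination of the squared moduli by \<open>t(1-t)\<bar>z-w\<bar>\<^sup>2\<close>. If neither component has more energy than the
combination, all these deficits vanish and the characteristic functions agree.\<close>

lemma char_energy_strictly_convex:
  assumes rd: "real_distribution P" "real_distribution Q" "real_distribution R"
    and t: "0 < t" "t < 1"
    and conv: "\<And>A. A \<in> sets P \<Longrightarrow> measure P A = t * measure Q A + (1 - t) * measure R A"
    and le: "char_energy Q \<le> char_energy P" "char_energy R \<le> char_energy P"
  shows "Q = R"
proof -
  let ?p = "map_pmf from_nat (geometric_pmf (1/2)) :: rat pmf"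
  define D where "D q = (cmod (char Q (of_rat q) - char R (of_rat q)))\<^sup>2" for q :: rat
  have b1: "(cmod (char M x))\<^sup>2 \<le> 1" if "real_distribution M" for M x
    using real_distribution.cmod_char_le_1[OF that] by (auto intro!: power_le_one)
  have I: "integrable (measure_pmf ?p) (\<lambda>q. (cmod (char M (of_rat q)))\<^sup>2)" if "real_distribution M" for M
    by (rule measure_pmf.integrable_const_bound[where B = 1]) (use b1[OF that] in auto)
  have ID: "integrable (measure_pmf ?p) D"
  proof (rule measure_pmf.integrable_const_bound[where B = 4])
    have "D q \<le> 2\<^sup>2" for q
      unfolding D_def
      using norm_triangle_ineq4[of "char Q (of_rat q)" "char R (of_rat q)"]
        real_distribution.cmod_char_le_1[OF rd(2), of "of_rat q"] real_distribution.cmod_char_le_1[OF rd(3), of "of_rat q"]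
      by (intro power_mono) auto
    then show "AE q in measure_pmf ?p. norm (D q) \<le> 4" by (auto simp: D_def)
  qed auto
  \<comment> \<open>The deficit of convexity of the squared modulus.\<close>
  have par: "(cmod (of_real t * z + of_real (1 - t) * w))\<^sup>2 = t * (cmod z)\<^sup>2 + (1 - t) * (cmod w)\<^sup>2 - t * (1 - t) * (cmod (z - w))\<^sup>2"
    for z w :: complex
    unfolding cmod_power2 by (simp add: power2_eq_square algebra_simps)
  have "char_energy P = measure_pmf.expectation ?p
      (\<lambda>q. t * (cmod (char Q (of_rat q)))\<^sup>2 + (1 - t) * (cmod (char R (of_rat q)))\<^sup>2 - t * (1 - t) * D q)"
    unfolding char_energy_def D_def
    by (intro Bochner_Integration.integral_cong refl) (subst char_convex[OF rd _ _ conv], use t par in auto)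
  also have "\<dots> = t * char_energy Q + (1 - t) * char_energy R - t * (1 - t) * measure_pmf.expectation ?p D"
    unfolding char_energy_def using I[OF rd(2)] I[OF rd(3)] ID by simp
  also have "\<dots> \<le> t * char_energy P + (1 - t) * char_energy P - t * (1 - t) * measure_pmf.expectation ?p D"
    using le t by (intro diff_right_mono add_mono mult_left_mono) auto
  finally have "t * (1 - t) * measure_pmf.expectation ?p D \<le> 0" by (simp add: algebra_simps)
  then have "measure_pmf.expectation ?p D \<le> 0" using t by (simp add: mult_le_0_iff)
  moreover have "measure_pmf.expectation ?p D \<ge> 0" by (intro integral_nonneg_AE) (auto simp: D_def)
  ultimately have "measure_pmf.expectation ?p D = 0" by simp
  then have "AE q in measure_pmf ?p. D q = 0"
    using integral_nonneg_eq_0_iff_AE[OF ID] by (auto simp: D_def)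
  then have D0: "D q = 0" for q
  proof -
    have "q \<in> set_pmf ?p"
      by (auto simp: set_pmf_geometric intro!: image_eqI[of _ _ "to_nat q"])
    then show ?thesis using \<open>AE q in measure_pmf ?p. D q = 0\<close> by (auto simp: AE_measure_pmf_iff)
  qed
  have "char Q x = char R x" for x
  proof -
    have cl: "closed {x. char Q x = char R x}"
      using real_distribution.isCont_char[OF rd(2)] real_distribution.isCont_char[OF rd(3)]
      by (intro closed_Collect_eq continuous_at_imp_continuous_on) auto
    have "\<rat> \<subseteq> {x. char Q x = char R x}"
      using D0 by (auto simp: D_def Rats_def)
    then have "closure \<rat> \<subseteq> {x. char Q x = char R x}" by (rule closure_minimal[OF _ cl])
    moreover have "closure \<rat> = (UNIV :: real set)" by (rule Rats_closure_real)
    ultimately show ?thesis by auto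
  qed
  then show ?thesis by (intro Levy_uniqueness rd) auto
qed

text \<open>The laws with maximal \<open>s\<close>-fold mean form a face \<open>F\<close> of \<open>K\<close>. A law in \<open>F\<close> of maximal energy cannot be
split inside \<open>F\<close>, by strict convexity, hence not inside \<open>K\<close>. The factor \<open>s\<close> covers maximal and
minimal means at once.\<close>

lemma extreme_point_maximal_mean:
  fixes K :: "real measure set"
  assumes mb: "\<And>\<mu>. \<mu> \<in> K \<Longrightarrow> moment_bounded g C \<mu>" and C: "C \<ge> 0" and g: "g > 1"
    and closed: "\<And>u \<mu>. (\<And>n. u n \<in> K) \<Longrightarrow> real_distribution \<mu> \<Longrightarrow> weak_conv_m u \<mu> \<Longrightarrow> \<mu> \<in> K"
    and ne: "K \<noteq> {}"
  shows "\<exists>\<kappa>\<in>extreme_measures K. \<forall>\<mu>\<in>K. s * (\<integral>x. x \<partial>\<mu>) \<le> s * (\<integral>x. x \<partial>\<kappa>)"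
proof -
  define m where "m \<mu> = s * (\<integral>x. x \<partial>\<mu>)" for \<mu> :: "real measure"
  have rd: "real_distribution \<mu>" if "\<mu> \<in> K" for \<mu> using mb[OF that] by (simp add: moment_bounded_def)
  have sub: "\<exists>r \<mu>. strict_mono (r :: nat \<Rightarrow> nat) \<and> \<mu> \<in> K \<and> weak_conv_m (\<lambda>n. u (r n)) \<mu> \<and> (\<lambda>n. m (u (r n))) \<longlonglongrightarrow> m \<mu>"
    if u: "\<And>n. u n \<in> K" for u
  proof -
    have "tight u" using mb u C g by (intro moment_bounded_tight) auto
    then obtain r \<mu> where r: "strict_mono (r :: nat \<Rightarrow> nat)" "real_distribution \<mu>" "weak_conv_m (\<lambda>n. u (r n)) \<mu>"
      using tight_imp_convergent_subsubsequence[of u id] by (auto simp: strict_mono_def comp_def)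
    have "\<mu> \<in> K" using closed[of "\<lambda>n. u (r n)"] u r by auto
    moreover have "(\<lambda>n. m (u (r n))) \<longlonglongrightarrow> m \<mu>"
      unfolding m_def
      by (intro tendsto_mult_left mean_weakly_continuous[OF _ _ C g r(3)] mb u \<open>\<mu> \<in> K\<close>)
    ultimately show ?thesis using r by blast
  qed
  have "\<exists>\<mu>\<in>K. \<forall>\<nu>\<in>K. m \<nu> \<le> m \<mu>"
  proof (rule attains_sup_subsequence[OF ne])
    fix u :: "nat \<Rightarrow> real measure" assume "\<And>n. u n \<in> K"
    from sub[of u, OF this]
    show "\<exists>r \<mu>. strict_mono (r :: nat \<Rightarrow> nat) \<and> \<mu> \<in> K \<and> (\<lambda>n. m (u (r n))) \<longlonglongrightarrow> m \<mu>"
      by (elim exE conjE) (intro exI conjI)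
  qed
  then obtain \<mu>0 where \<mu>0: "\<mu>0 \<in> K" "\<And>\<nu>. \<nu> \<in> K \<Longrightarrow> m \<nu> \<le> m \<mu>0" by blast
  define F where "F = {\<mu> \<in> K. m \<mu> = m \<mu>0}"
  have "\<exists>\<mu>\<in>F. \<forall>\<nu>\<in>F. char_energy \<nu> \<le> char_energy \<mu>"
  proof (rule attains_sup_subsequence)
    show "F \<noteq> {}" using \<mu>0 by (auto simp: F_def)
    fix u :: "nat \<Rightarrow> real measure" assume u: "\<And>n. u n \<in> F"
    then have uK: "\<And>n. u n \<in> K" by (auto simp: F_def)
    obtain r \<mu> where r: "strict_mono (r :: nat \<Rightarrow> nat)" "\<mu> \<in> K" "weak_conv_m (\<lambda>n. u (r n)) \<mu>" "(\<lambda>n. m (u (r n))) \<longlonglongrightarrow> m \<mu>"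
      using sub[of u, OF uK] by (elim exE conjE)
    have "(\<lambda>n. m (u (r n))) = (\<lambda>n. m \<mu>0)" using u by (auto simp: F_def)
    then have "m \<mu> = m \<mu>0" using r(4) by (simp add: LIMSEQ_const_iff)
    then have "\<mu> \<in> F" using r by (simp add: F_def)
    moreover have "(\<lambda>n. char_energy (u (r n))) \<longlonglongrightarrow> char_energy \<mu>"
      by (rule char_energy_continuous) (use rd uK r in auto)
    ultimately show "\<exists>s \<mu>. strict_mono (s :: nat \<Rightarrow> nat) \<and> \<mu> \<in> F \<and> (\<lambda>n. char_energy (u (s n))) \<longlonglongrightarrow> char_energy \<mu>"
      using r(1) by blast
  qed
  then obtain \<kappa> where \<kappa>: "\<kappa> \<in> F" "\<And>\<nu>. \<nu> \<in> F \<Longrightarrow> char_energy \<nu> \<le> char_energy \<kappa>" by blast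
  have \<kappa>K: "\<kappa> \<in> K" and m\<kappa>: "m \<kappa> = m \<mu>0" using \<kappa> by (auto simp: F_def)
  have "Q = \<kappa> \<and> R = \<kappa>"
    if QR: "Q \<in> K" "R \<in> K" and t: "0 < t" "t < 1"
      and conv: "\<And>A. A \<in> sets \<kappa> \<Longrightarrow> measure \<kappa> A = t * measure Q A + (1 - t) * measure R A" for Q R t
  proof -
    note rds = rd[OF \<kappa>K] rd[OF QR(1)] rd[OF QR(2)]
    have s: "sets Q = sets \<kappa>" "sets R = sets \<kappa>" using rds by (auto simp: real_distribution.events_eq_borel)
    have f: "finite_measure \<kappa>" "finite_measure Q" "finite_measure R"
      using rds by (auto simp: real_distribution_def prob_space_def)
    have i: "integrable Q (\<lambda>x. x)" "integrable R (\<lambda>x. x)"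
      using moment_bounded_mean[OF mb C] QR g by auto
    have "m \<kappa> = s * (t * (\<integral>x. x \<partial>Q) + (1 - t) * (\<integral>x. x \<partial>R))"
      unfolding m_def using convex_integral[OF s f _ _ conv i] t by simp
    then have c: "m \<kappa> = t * m Q + (1 - t) * m R" by (simp add: m_def algebra_simps)
    have le: "m Q \<le> m \<kappa>" "m R \<le> m \<kappa>" using \<mu>0 QR m\<kappa> by auto
    \<comment> \<open>A convex combination of numbers that are at most the maximum attains it only if both do.\<close>
    have "t * (m \<kappa> - m Q) + (1 - t) * (m \<kappa> - m R) = 0" using c by (simp add: algebra_simps)
    moreover have "t * (m \<kappa> - m Q) \<ge> 0" "(1 - t) * (m \<kappa> - m R) \<ge> 0" using le t by auto
    ultimately have "t * (m \<kappa> - m Q) = 0" "(1 - t) * (m \<kappa> - m R) = 0" by linarith+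
    then have "Q \<in> F" "R \<in> F" using t m\<kappa> QR by (auto simp: F_def)
    then have QR_eq: "Q = R"
      using \<kappa>(2) by (intro char_energy_strictly_convex[OF rds t conv]) auto
    have "Q = \<kappa>"
    proof (rule measure_eqI[OF s(1)])
      fix A assume A: "A \<in> sets Q"
      then have "measure \<kappa> A = measure Q A" using conv[of A] s QR_eq by (simp add: algebra_simps)
      then show "emeasure Q A = emeasure \<kappa> A" using f by (simp add: finite_measure.emeasure_eq_measure)
    qed
    then show ?thesis using QR_eq by simp
  qed
  then have "\<kappa> \<in> extreme_measures K" using \<kappa>K by (auto simp: extreme_measures_def)
  then show ?thesis using \<mu>0 m\<kappa> by (intro bexI[of _ \<kappa>]) (auto simp: m_def)
qed

section \<open>Lipschitz cylinder functions and independence\<close>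

lemma tendsto_path:
  fixes w :: "nat \<Rightarrow> path"
  assumes "\<And>i. (\<lambda>k. w k i) \<longlonglongrightarrow> x i"
  shows "w \<longlonglongrightarrow> x"
proof -
  have "limitin (product_topology (\<lambda>_. euclidean) UNIV) w x sequentially"
    unfolding limitin_componentwise using assms by simp
  then show ?thesis by (simp add: euclidean_product_topology)
qed

lemma tendsto_coordinate: "((\<lambda>x::path. x i) \<longlongrightarrow> y i) (at y)"
  using continuous_on_product_coordinates[of i, where 'b = real]
  unfolding continuous_on_eq_continuous_at[OF open_UNIV] isCont_def by simp

text \<open>The functions \<open>\<phi>(\<xi>\<^sub>1,\<dots>,\<xi>\<^sub>n)\<close> with \<open>\<phi>\<close> bounded and Lipschitz on \<open>\<real>\<^sup>n\<close>, regarded as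
functions of the whole path, so that different \<open>n\<close> are compared without changing the type or the domain.\<close>

definition cylinder_lipschitz :: "nat \<Rightarrow> (path \<Rightarrow> real) set" where
  "cylinder_lipschitz n = {f. bounded (range f) \<and> (\<exists>L. \<forall>x y. \<bar>f x - f y\<bar> \<le> L * L2_set (\<lambda>i. x i - y i) {..<n})}"

definition bounded_lipschitz :: "(real \<Rightarrow> real) set" where
  "bounded_lipschitz = {g. bounded (range g) \<and> (\<exists>L. \<forall>x y. \<bar>g x - g y\<bar> \<le> L * \<bar>x - y\<bar>)}"

lemma cylinder_lipschitzI:
  assumes "\<And>x. \<bar>f x\<bar> \<le> B" "\<And>x y. \<bar>f x - f y\<bar> \<le> L * L2_set (\<lambda>i. x i - y i) {..<n}"
  shows "f \<in> cylinder_lipschitz n"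
  unfolding cylinder_lipschitz_def using assms by (auto simp: bounded_iff)

lemma cylinder_lipschitzE:
  assumes "f \<in> cylinder_lipschitz n"
  obtains B L where "\<And>x. \<bar>f x\<bar> \<le> B" "B \<ge> 0" "L \<ge> 0" "\<And>x y. \<bar>f x - f y\<bar> \<le> L * L2_set (\<lambda>i. x i - y i) {..<n}"
proof -
  obtain L B where L: "\<And>x y. \<bar>f x - f y\<bar> \<le> L * L2_set (\<lambda>i. x i - y i) {..<n}" and B: "\<And>x. \<bar>f x\<bar> \<le> B"
    using assms by (auto simp: cylinder_lipschitz_def bounded_iff)
  have "\<bar>f x - f y\<bar> \<le> \<bar>L\<bar> * L2_set (\<lambda>i. x i - y i) {..<n}" for x y
    by (rule order_trans[OF L mult_right_mono]) auto
  then show ?thesis using that[of B "\<bar>L\<bar>"] B order_trans[OF abs_ge_zero B] by auto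
qed

lemma cylinder_lipschitz_Cb: "f \<in> cylinder_lipschitz n \<Longrightarrow> f \<in> Cb"
proof -
  assume f: "f \<in> cylinder_lipschitz n"
  obtain B L where L: "\<And>x y. \<bar>f x - f y\<bar> \<le> L * L2_set (\<lambda>i. x i - y i) {..<n}" using cylinder_lipschitzE[OF f] by metis
  have "isCont f y" for y
  proof -
    have "((\<lambda>x. L * sqrt (\<Sum>i<n. (x i - y i)\<^sup>2)) \<longlongrightarrow> L * sqrt (\<Sum>i<n. (y i - y i)\<^sup>2)) (at y)"
      by (intro tendsto_intros tendsto_coordinate)
    then have "((\<lambda>x. L * sqrt (\<Sum>i<n. (x i - y i)\<^sup>2)) \<longlongrightarrow> 0) (at y)" by simp
    then have "((\<lambda>x. f x - f y) \<longlongrightarrow> 0) (at y)"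
      by (rule Lim_null_comparison[rotated]) (use L in \<open>auto simp: L2_set_def\<close>)
    then show ?thesis by (simp add: isCont_def LIM_zero_iff)
  qed
  then show ?thesis using f by (auto simp: Cb_def cylinder_lipschitz_def intro: continuous_at_imp_continuous_on)
qed

lemma cylinder_lipschitz_cong:
  assumes "f \<in> cylinder_lipschitz n" "\<And>i. i < n \<Longrightarrow> x i = y i" shows "f x = f y"
proof -
  obtain B L where L: "\<And>x y. \<bar>f x - f y\<bar> \<le> L * L2_set (\<lambda>i. x i - y i) {..<n}" using cylinder_lipschitzE[OF assms(1)] by metis
  have "L2_set (\<lambda>i. x i - y i) {..<n} = 0" using assms(2) by (auto intro: L2_set_0')
  then show ?thesis using L[of x y] by simp
qed

lemma L2_set_subset_mono:
  assumes "n \<le> m" shows "L2_set f {..<n} \<le> L2_set f {..<m::nat}"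
  unfolding L2_set_def using assms by (intro real_sqrt_le_mono sum_mono2) auto

lemma coordinate_le_L2_set: "i < n \<Longrightarrow> \<bar>x i - y i\<bar> \<le> L2_set (\<lambda>i. x i - y i) {..<n::nat}"
  using member_le_L2_set[of "{..<n}" i "\<lambda>i. \<bar>x i - y i\<bar>"] by (simp add: L2_set_def)

lemma cylinder_lipschitz_mono: "f \<in> cylinder_lipschitz n \<Longrightarrow> n \<le> m \<Longrightarrow> f \<in> cylinder_lipschitz m"
proof -
  assume f: "f \<in> cylinder_lipschitz n" and nm: "n \<le> m"
  obtain B L where *: "\<And>x. \<bar>f x\<bar> \<le> B" "L \<ge> 0" "\<And>x y. \<bar>f x - f y\<bar> \<le> L * L2_set (\<lambda>i. x i - y i) {..<n}"
    using cylinder_lipschitzE[OF f] by metis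
  show "f \<in> cylinder_lipschitz m"
    by (rule cylinder_lipschitzI[where L = L, OF *(1) order_trans[OF *(3)]]) (intro mult_left_mono L2_set_subset_mono nm *(2))
qed

lemma cylinder_lipschitz_mult:
  assumes "f \<in> cylinder_lipschitz n" "h \<in> cylinder_lipschitz n" shows "(\<lambda>x. f x * h x) \<in> cylinder_lipschitz n"
proof -
  obtain B L where f: "\<And>x. \<bar>f x\<bar> \<le> B" "B \<ge> 0" "L \<ge> 0" "\<And>x y. \<bar>f x - f y\<bar> \<le> L * L2_set (\<lambda>i. x i - y i) {..<n}"
    using cylinder_lipschitzE[OF assms(1)] by metis
  obtain B' L' where h: "\<And>x. \<bar>h x\<bar> \<le> B'" "B' \<ge> 0" "L' \<ge> 0" "\<And>x y. \<bar>h x - h y\<bar> \<le> L' * L2_set (\<lambda>i. x i - y i) {..<n}"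
    using cylinder_lipschitzE[OF assms(2)] by metis
  show ?thesis
  proof (rule cylinder_lipschitzI)
    show "\<bar>f x * h x\<bar> \<le> B * B'" for x unfolding abs_mult using f h by (intro mult_mono) auto
    fix x y
    let ?D = "L2_set (\<lambda>i. x i - y i) {..<n}"
    have "f x * h x - f y * h y = f x * (h x - h y) + (f x - f y) * h y" by (simp add: algebra_simps)
    then have "\<bar>f x * h x - f y * h y\<bar> \<le> \<bar>f x\<bar> * \<bar>h x - h y\<bar> + \<bar>f x - f y\<bar> * \<bar>h y\<bar>"
      by (metis abs_mult abs_triangle_ineq)
    also have "\<dots> \<le> B * (L' * ?D) + (L * ?D) * B'"
      using f h by (intro add_mono mult_mono) auto
    finally show "\<bar>f x * h x - f y * h y\<bar> \<le> (B * L' + L * B') * ?D" by (simp add: algebra_simps)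
  qed
qed

lemma bounded_lipschitz_cylinder_diff:
  assumes "g \<in> bounded_lipschitz" "k < n" shows "(\<lambda>\<omega>. g (\<omega> k) - c) \<in> cylinder_lipschitz n"
proof -
  obtain L B where L: "\<And>x y. \<bar>g x - g y\<bar> \<le> L * \<bar>x - y\<bar>" and B: "\<And>x. \<bar>g x\<bar> \<le> B"
    using assms(1) by (auto simp: bounded_lipschitz_def bounded_iff)
  show ?thesis
  proof (rule cylinder_lipschitzI)
    show "\<bar>g (x k) - c\<bar> \<le> B + \<bar>c\<bar>" for x :: path using B[of "x k"] by linarith
    fix x y :: path
    have "\<bar>g (x k) - g (y k)\<bar> \<le> \<bar>L\<bar> * \<bar>x k - y k\<bar>"
      by (rule order_trans[OF L mult_right_mono]) auto
    also have "\<dots> \<le> \<bar>L\<bar> * L2_set (\<lambda>i. x i - y i) {..<n}"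
      by (intro mult_left_mono coordinate_le_L2_set assms) auto
    finally show "\<bar>g (x k) - c - (g (y k) - c)\<bar> \<le> \<bar>L\<bar> * L2_set (\<lambda>i. x i - y i) {..<n}" by simp
  qed
qed

lemma bounded_lipschitz_cylinder: "g \<in> bounded_lipschitz \<Longrightarrow> k < n \<Longrightarrow> (\<lambda>\<omega>. g (\<omega> k)) \<in> cylinder_lipschitz n"
  using bounded_lipschitz_cylinder_diff[of g k n 0] by simp

lemma bounded_lipschitz_isCont: "g \<in> bounded_lipschitz \<Longrightarrow> isCont g x"
proof -
  assume "g \<in> bounded_lipschitz"
  then obtain L where L: "\<And>x y. \<bar>g x - g y\<bar> \<le> L * \<bar>x - y\<bar>" by (auto simp: bounded_lipschitz_def)
  have "((\<lambda>y. L * \<bar>y - x\<bar>) \<longlongrightarrow> L * \<bar>x - x\<bar>) (at x)" by (intro tendsto_intros)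
  then have "((\<lambda>y. L * \<bar>y - x\<bar>) \<longlongrightarrow> 0) (at x)" by simp
  then have "((\<lambda>y. g y - g x) \<longlongrightarrow> 0) (at x)"
    by (rule Lim_null_comparison[rotated]) (use L in auto)
  then show ?thesis by (simp add: isCont_def LIM_zero_iff)
qed

lemma bounded_lipschitz_measurable: "g \<in> bounded_lipschitz \<Longrightarrow> g \<in> borel_measurable borel"
  by (auto intro!: borel_measurable_continuous_onI continuous_at_imp_continuous_on bounded_lipschitz_isCont)

lemma cylinder_lipschitz_measurable: "f \<in> cylinder_lipschitz n \<Longrightarrow> f \<in> borel_measurable borel"
  using cylinder_lipschitz_Cb by (auto simp: Cb_def intro!: borel_measurable_continuous_onI)

lemma Cb_integrable:
  assumes "P \<in> borel_probs" "X \<in> Cb" shows "integrable P X"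
proof -
  interpret prob_space P using assms by (auto simp: borel_probs_def)
  have s: "sets P = sets borel" using assms by (auto simp: borel_probs_def)
  obtain C where "\<And>\<omega>. \<bar>X \<omega>\<bar> \<le> C" using assms(2) by (auto simp: Cb_def bounded_iff)
  moreover have "X \<in> borel_measurable P"
    using assms unfolding measurable_cong_sets[OF s refl] Cb_def by (auto intro: borel_measurable_continuous_onI)
  ultimately show ?thesis by (intro integrable_const_bound[where B = C]) auto
qed

lemma ThetaD: "P \<in> Theta E \<Longrightarrow> P \<in> borel_probs" by (simp add: Theta_def)

lemma borel_probsD:
  assumes "P \<in> borel_probs" shows "prob_space P" "sets P = sets borel" "space P = UNIV"
  using assms sets_eq_imp_space_eq[of P borel] by (auto simp: borel_probs_def)

text \<open>The approximations are \<open>f\<^sub>k(\<omega>) = inf\<^sub>w X(w) + k D\<^sub>k(\<omega>,w)\<close> with \<open>D\<^sub>k\<close> the Euclidean distance of the first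
\<open>k\<close> coordinates. An almost minimal \<open>w\<close> has \<open>D\<^sub>k(\<omega>,w) = O(1/k)\<close>, because \<open>X\<close> is bounded. So these \<open>w\<close>
converge to \<open>\<omega>\<close> in the product topology, and continuity of \<open>X\<close> gives \<open>f\<^sub>k(\<omega>) \<rightarrow> X(\<omega>)\<close>.\<close>

lemma inf_convolution:
  assumes X: "X \<in> Cb"
  obtains f M where "\<And>k. f k \<in> cylinder_lipschitz k" "\<And>k \<omega>. f k \<omega> \<le> X \<omega>" "\<And>\<omega>. (\<lambda>k. f k \<omega>) \<longlonglongrightarrow> X \<omega>" "\<And>k \<omega>. \<bar>f k \<omega>\<bar> \<le> M"
proof -
  obtain M where M: "\<And>\<omega>. \<bar>X \<omega>\<bar> \<le> M" using X by (auto simp: Cb_def bounded_iff)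
  define D where "D k x y = L2_set (\<lambda>i. x i - y i) {..<k}" for k and x y :: path
  define f where "f k \<omega> = (INF w. X w + real k * D k \<omega> w)" for k \<omega>
  have D0: "D k x y \<ge> 0" for k x y by (simp add: D_def)
  have low: "- M \<le> X w + real k * D k \<omega> w" for w \<omega> k
    using M[of w] mult_nonneg_nonneg[of "real k" "D k \<omega> w"] D0[of k \<omega> w] by linarith
  have bdd: "bdd_below (range (\<lambda>w. X w + real k * D k \<omega> w))" for k \<omega>
    by (rule bdd_belowI2[OF low])
  have fle: "f k \<omega> \<le> X w + real k * D k \<omega> w" for k \<omega> w
    unfolding f_def by (rule cINF_lower[OF bdd]) simp
  have Dxx: "D k x x = 0" for k x by (simp add: D_def L2_set_def)
  have fX: "f k \<omega> \<le> X \<omega>" for k \<omega> using fle[of k \<omega> \<omega>] by (simp add: Dxx)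
  have fM: "- M \<le> f k \<omega>" for k \<omega>
    unfolding f_def by (rule cINF_greatest) (use low in auto)
  have fabs: "\<bar>f k \<omega>\<bar> \<le> M" for k \<omega> using fM[of k \<omega>] fX[of k \<omega>] M[of \<omega>] by linarith
  have tri: "D k x z \<le> D k x y + D k y z" for k x y z
    using L2_set_triangle_ineq[of "\<lambda>i. x i - y i" "\<lambda>i. y i - z i" "{..<k}"] by (simp add: D_def)
  have sym: "D k x y = D k y x" for k x y by (simp add: D_def L2_set_def power2_commute)
  have one: "f k x \<le> f k y + real k * D k x y" for k x y
  proof -
    have "f k x - real k * D k x y \<le> X w + real k * D k y w" for w
      using fle[of k x w] mult_left_mono[OF tri[of k x w y], of "real k"] by (simp add: algebra_simps)
    then have "f k x - real k * D k x y \<le> f k y" unfolding f_def[of k y] by (intro cINF_greatest) auto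
    then show ?thesis by simp
  qed
  have "f k \<in> cylinder_lipschitz k" for k
  proof (rule cylinder_lipschitzI[OF fabs])
    show "\<bar>f k x - f k y\<bar> \<le> real k * L2_set (\<lambda>i. x i - y i) {..<k}" for x y
      using one[of k x y] one[of k y x] sym[of k x y] by (simp add: D_def[symmetric])
  qed
  moreover have "(\<lambda>k. f k \<omega>) \<longlonglongrightarrow> X \<omega>" for \<omega>
  proof -
    have "\<exists>w. X w + real k * D k \<omega> w < f k \<omega> + inverse (real (Suc k))" for k
      using cINF_less_iff[OF _ bdd, of k \<omega> "f k \<omega> + inverse (real (Suc k))"] unfolding f_def by (auto simp del: of_nat_Suc)
    then obtain w where w: "\<And>k. X (w k) + real k * D k \<omega> (w k) < f k \<omega> + inverse (real (Suc k))" by metis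
    have Dle: "real k * D k \<omega> (w k) \<le> 2 * M + 1" for k
    proof -
      have "inverse (real (Suc k)) \<le> 1" by (simp add: inverse_le_1_iff)
      then show ?thesis using w[of k] fX[of k \<omega>] M[of \<omega>] M[of "w k"] by linarith
    qed
    have "(\<lambda>k. w k i) \<longlonglongrightarrow> \<omega> i" for i
    proof -
      have "(\<lambda>k. (2 * M + 1) / real k) \<longlonglongrightarrow> 0" by (rule lim_const_over_n)
      then have "(\<lambda>k. w k i - \<omega> i) \<longlonglongrightarrow> 0"
      proof (rule Lim_null_comparison[rotated])
        have "norm (w k i - \<omega> i) \<le> (2 * M + 1) / real k" if "k > i" for k
        proof -
          have "\<bar>\<omega> i - w k i\<bar> \<le> D k \<omega> (w k)" unfolding D_def by (rule coordinate_le_L2_set[OF that])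
          also have "\<dots> \<le> (2 * M + 1) / real k" using Dle[of k] that by (simp add: field_simps)
          finally show ?thesis by (simp add: abs_minus_commute)
        qed
        then show "eventually (\<lambda>k. norm (w k i - \<omega> i) \<le> (2 * M + 1) / real k) sequentially"
          by (rule eventually_mono[OF eventually_gt_at_top[of i]])
      qed
      then show ?thesis by (simp add: LIM_zero_iff)
    qed
    then have "w \<longlonglongrightarrow> \<omega>" by (rule tendsto_path)
    then have "(\<lambda>k. X (w k)) \<longlonglongrightarrow> X \<omega>"
      using X continuous_on_tendsto_compose[of UNIV X w \<omega>] by (auto simp: Cb_def)
    then have "(\<lambda>k. X (w k) - inverse (real (Suc k))) \<longlonglongrightarrow> X \<omega> - 0"
      by (intro tendsto_diff LIMSEQ_inverse_real_of_nat)
    then have l: "(\<lambda>k. X (w k) - inverse (real (Suc k))) \<longlonglongrightarrow> X \<omega>" by simp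
    have "X (w k) - inverse (real (Suc k)) \<le> f k \<omega>" for k
      using w[of k] mult_nonneg_nonneg[of "real k" "D k \<omega> (w k)"] D0[of k \<omega> "w k"] by linarith
    then show ?thesis
      by (intro tendsto_sandwich[OF _ _ l tendsto_const]) (use fX in auto)
  qed
  ultimately show ?thesis using that fX fabs by blast
qed

locale iid_coordinates =
  fixes E :: "(path \<Rightarrow> real) \<Rightarrow> real"
  assumes sublinear: "sublinear_expectation E" and iid: "iid E xi"
begin

lemma Theta_nonempty: "Theta E \<noteq> {}"
proof -
  obtain T where T: "T \<noteq> {}" "T \<subseteq> borel_probs"
      and ET: "\<And>X. X \<in> Cb \<Longrightarrow> E X = (SUP P\<in>T. integral\<^sup>L P X)"
    using sublinear unfolding sublinear_expectation_def by blast
  have "bdd_above ((\<lambda>P. integral\<^sup>L P Y) ` T)" if Y: "Y \<in> Cb" for Y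
  proof -
    obtain C where C: "\<And>\<omega>. \<bar>Y \<omega>\<bar> \<le> C" using Y unfolding Cb_def bounded_iff by auto
    have "integral\<^sup>L P Y \<le> C" if "P \<in> T" for P
    proof -
      have "P \<in> borel_probs" using that T by auto
      then interpret prob_space P by (rule borel_probsD)
      show ?thesis using Cb_integrable[OF \<open>P \<in> borel_probs\<close> Y] C
        by (intro integral_le_const) (auto intro: order_trans[OF abs_ge_self])
    qed
    then show ?thesis by (intro bdd_aboveI2)
  qed
  then have "T \<subseteq> Theta E"
    using T(2) by (auto simp: Theta_def ET intro!: cSUP_upper)
  then show ?thesis using T(1) by blast
qed

lemma ext_upper: "P \<in> Theta E \<Longrightarrow> X \<in> Cb \<Longrightarrow> integral\<^sup>L P X \<le> ext E X"
  using ext_eq_on_Cb[OF sublinear] by (auto simp: Theta_def)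

lemma ext_least: "(\<And>P. P \<in> Theta E \<Longrightarrow> integral\<^sup>L P X \<le> c) \<Longrightarrow> ext E X \<le> c"
  unfolding ext_def by (rule cSUP_least[OF Theta_nonempty]) auto

lemma ext_le_ext_add:
  assumes "X \<in> Cb" "Y \<in> Cb" "\<And>\<omega>. X \<omega> \<le> Y \<omega> + c"
  shows "ext E X \<le> ext E Y + c"
proof (rule ext_least)
  fix P assume P: "P \<in> Theta E"
  then have bp: "P \<in> borel_probs" by (rule ThetaD)
  interpret prob_space P by (rule borel_probsD[OF bp])
  have "integral\<^sup>L P X \<le> (\<integral>\<omega>. Y \<omega> + c \<partial>P)"
    using assms Cb_integrable[OF bp] by (intro integral_mono) auto
  also have "\<dots> = integral\<^sup>L P Y + c" using assms Cb_integrable[OF bp] by (simp add: prob_space)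
  also have "\<dots> \<le> ext E Y + c" using ext_upper[OF P assms(2)] by simp
  finally show "integral\<^sup>L P X \<le> ext E Y + c" .
qed

lemma ext_bounded:
  assumes "X \<in> Cb" "\<And>\<omega>. \<bar>X \<omega>\<bar> \<le> B" shows "\<bar>ext E X\<bar> \<le> B"
proof -
  have "ext E (\<lambda>_. 0) = 0" unfolding ext_def using Theta_nonempty by simp
  moreover have "(\<lambda>_. 0) \<in> Cb" by (auto simp: Cb_def)
  moreover have "X \<omega> \<le> 0 + B" "0 \<le> X \<omega> + B" for \<omega> using assms(2)[of \<omega>] by auto
  ultimately show ?thesis
    using ext_le_ext_add[of X "\<lambda>_. 0" B] ext_le_ext_add[of "\<lambda>_. 0" X B] assms(1) by auto
qed

text \<open>Independence of the coordinate \<open>n\<close> from the earlier ones, for functions on path space: the inner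
expectation replaces that coordinate by an independent copy.\<close>

lemma ext_independent:
  assumes n: "n \<ge> 1" and f: "f \<in> cylinder_lipschitz (Suc n)"
  shows "ext E f = ext E (\<lambda>w. ext E (\<lambda>w'. f (w(n := w' n))))"
proof -
  obtain i where i: "n = Suc i" using n by (cases n) auto
  obtain B L where fb: "\<And>x. \<bar>f x\<bar> \<le> B" and fL: "\<And>x y. \<bar>f x - f y\<bar> \<le> L * L2_set (\<lambda>i. x i - y i) {..<Suc n}"
    using cylinder_lipschitzE[OF f] by metis
  define \<phi> where "\<phi> v = f (\<lambda>j. if j < Suc n then v j else 0)" for v
  have "\<phi> \<in> CbLip (Suc i + 1)"
  proof -
    have "\<bar>\<phi> x - \<phi> y\<bar> \<le> L * L2_set (\<lambda>i. x i - y i) {..<Suc i + 1}" for x y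
    proof -
      have "L2_set (\<lambda>k. (if k < Suc n then x k else 0) - (if k < Suc n then y k else 0)) {..<Suc n}
        = L2_set (\<lambda>i. x i - y i) {..<Suc i + 1}"
        unfolding i by (intro L2_set_cong) auto
      then show ?thesis
        using fL[of "\<lambda>j. if j < Suc n then x j else 0" "\<lambda>j. if j < Suc n then y j else 0"] unfolding \<phi>_def by simp
    qed
    then show ?thesis using fb by (auto simp: CbLip_def bounded_iff \<phi>_def)
  qed
  moreover have "independent E 1 (rvec 1 (\<lambda>_. xi (Suc i))) (Suc i) (rvec (Suc i) xi)"
    using iid by (simp add: iid_def)
  ultimately have "ext E (\<lambda>w. \<phi> (join (Suc i) 1 (rvec (Suc i) xi w) (rvec 1 (\<lambda>_. xi (Suc i)) w)))
      = ext E (\<lambda>w. ext E (\<lambda>w'. \<phi> (join (Suc i) 1 (rvec (Suc i) xi w) (rvec 1 (\<lambda>_. xi (Suc i)) w'))))"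
    unfolding independent_def by blast
  moreover have "\<phi> (join (Suc i) 1 (rvec (Suc i) xi w) (rvec 1 (\<lambda>_. xi (Suc i)) w')) = f (w(n := w' n))" for w w'
    unfolding \<phi>_def by (rule cylinder_lipschitz_cong[OF f]) (auto simp: join_def rvec_def xi_def i less_Suc_eq)
  ultimately show ?thesis by simp
qed

lemma ext_coordinate:
  assumes g: "g \<in> bounded_lipschitz"
  shows "ext E (\<lambda>\<omega>. g (\<omega> k)) = ext E (\<lambda>\<omega>. g (\<omega> 0))"
proof (induction k)
  case (Suc k)
  obtain L where L: "\<And>x y. \<bar>g x - g y\<bar> \<le> L * \<bar>x - y\<bar>" using g by (auto simp: bounded_lipschitz_def)
  have 1: "(\<lambda>v. g (v 0)) \<in> CbLip 1"
    using g L by (auto simp: CbLip_def bounded_lipschitz_def bounded_iff L2_set_def lessThan_Suc)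
  have 2: "ident_distr E 1 (rvec 1 (\<lambda>_. xi (Suc k))) (rvec 1 (\<lambda>_. xi k))"
    using iid by (simp add: iid_def)
  have "ext E (\<lambda>\<omega>. g (rvec 1 (\<lambda>_. xi (Suc k)) \<omega> 0)) = ext E (\<lambda>\<omega>. g (rvec 1 (\<lambda>_. xi k) \<omega> 0))"
    using bspec[OF 2[unfolded ident_distr_def] 1] .
  then show ?case using Suc by (simp add: rvec_def xi_def)
qed simp

text \<open>Applied to \<open>\<psi>(y)(g(x) - c)\<close>, independence gives the upper expectation of
\<open>\<psi>(y)(E[g] - c) = 0\<close>. Nonnegativity of \<open>\<psi>\<close> is what allows it to be taken out of the sublinear inner
expectation.\<close>

lemma one_step_le:
  assumes P: "P \<in> Theta E" and n: "n \<ge> 1" and \<psi>: "\<psi> \<in> cylinder_lipschitz n" "\<And>w. \<psi> w \<ge> 0" and g: "g \<in> bounded_lipschitz"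
  shows "(\<integral>w. \<psi> w * (g (w n) - ext E (\<lambda>w. g (w 0))) \<partial>P) \<le> 0"
proof -
  define c where "c = ext E (\<lambda>w. g (w 0))"
  define f where "f w = \<psi> w * (g (w n) - c)" for w
  have f: "f \<in> cylinder_lipschitz (Suc n)"
    unfolding f_def by (intro cylinder_lipschitz_mult bounded_lipschitz_cylinder_diff g cylinder_lipschitz_mono[OF \<psi>(1)]) auto
  have "integral\<^sup>L P f \<le> ext E f" by (rule ext_upper[OF P cylinder_lipschitz_Cb[OF f]])
  also have "\<dots> = ext E (\<lambda>w. ext E (\<lambda>w'. f (w(n := w' n))))" by (rule ext_independent[OF n f])
  also have "\<dots> \<le> 0"
  proof (rule ext_least)
    fix P' assume P': "P' \<in> Theta E"
    have "ext E (\<lambda>w'. f (w(n := w' n))) \<le> 0" for w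
    proof (rule ext_least)
      fix R assume R: "R \<in> Theta E"
      interpret prob_space R by (rule borel_probsD[OF ThetaD[OF R]])
      have \<psi>eq: "\<psi> (w(n := x)) = \<psi> w" for x by (rule cylinder_lipschitz_cong[OF \<psi>(1)]) auto
      have cb: "(\<lambda>w. g (w n)) \<in> Cb" by (rule cylinder_lipschitz_Cb[OF bounded_lipschitz_cylinder[OF g lessI]])
      have "(\<integral>w'. f (w(n := w' n)) \<partial>R) = \<psi> w * ((\<integral>w'. g (w' n) \<partial>R) - c)"
        using Cb_integrable[OF ThetaD[OF R] cb] by (simp add: f_def \<psi>eq prob_space)
      moreover have "(\<integral>w'. g (w' n) \<partial>R) \<le> c"
        using ext_upper[OF R cb] ext_coordinate[OF g, of n] by (simp add: c_def)
      ultimately show "(\<integral>w'. f (w(n := w' n)) \<partial>R) \<le> 0"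
        using \<psi>(2)[of w] by (simp add: mult_nonneg_nonpos)
    qed
    then show "(\<integral>w. ext E (\<lambda>w'. f (w(n := w' n))) \<partial>P') \<le> 0"
      using integral_nonneg_AE[where M = P' and f = "\<lambda>w. - ext E (\<lambda>w'. f (w(n := w' n)))"] by simp
  qed
  finally show ?thesis unfolding f_def[abs_def] c_def .
qed

end

section \<open>Conditional laws of the next coordinate\<close>

definition trunc :: "nat \<Rightarrow> path \<Rightarrow> path" where
  "trunc n w = (\<lambda>i. if i < n then w i else 0)"

lemma trunc_measurable[measurable]: "trunc n \<in> borel_measurable borel"
  by (rule measurable_coordinatewise_then_product) (auto simp: trunc_def)

text \<open>A function that is Lipschitz for the metric of path space becomes, after truncation, Lipschitz in
the Euclidean norm of the first \<open>n\<close> coordinates. The factor two is the total weight of the series that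
defines the metric.\<close>

lemma dist_trunc_le: "dist (trunc n x) (trunc n y) \<le> 2 * L2_set (\<lambda>i. x i - y i) {..<n}"
proof -
  define D where "D = L2_set (\<lambda>i. x i - y i) {..<n}"
  have D0: "D \<ge> 0" by (simp add: D_def)
  have c: "dist (trunc n x i) (trunc n y i) \<le> D" for i
    using D0 coordinate_le_L2_set[of i n x y] by (auto simp: trunc_def dist_real_def D_def)
  have s1: "summable (\<lambda>k. (1/2::real)^k * D)" by (intro summable_mult2 summable_geometric) auto
  have le: "(1/2)^k * min (dist (trunc n x (from_nat k)) (trunc n y (from_nat k))) 1 \<le> (1/2)^k * D" for k
    using c[of "from_nat k"] by (intro mult_left_mono) auto
  have s2: "summable (\<lambda>k. (1/2)^k * min (dist (trunc n x (from_nat k)) (trunc n y (from_nat k))) 1)"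
    by (rule summable_comparison_test[OF _ s1]) (use le in auto)
  have "dist (trunc n x) (trunc n y) \<le> (\<Sum>k. (1/2)^k * D)"
    unfolding dist_fun_def by (rule suminf_le[OF le s2 s1])
  also have "\<dots> = 2 * D"
    using suminf_mult2[of "\<lambda>k. (1/2::real)^k" D] suminf_geometric[of "1/2::real"] summable_geometric[of "1/2::real"]
    by simp
  finally show ?thesis by (simp add: D_def)
qed

definition cylinder :: "nat \<Rightarrow> path set \<Rightarrow> bool" where
  "cylinder n A \<longleftrightarrow> A \<in> sets borel \<and> (\<forall>x y. (\<forall>i<n. x i = y i) \<longrightarrow> x \<in> A \<longrightarrow> y \<in> A)"

lemma cylinder_trunc: "cylinder n A \<Longrightarrow> trunc n -` A = A"
proof (intro set_eqI)
  fix w assume A: "cylinder n A"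
  have "\<forall>i<n. trunc n w i = w i" "\<forall>i<n. w i = trunc n w i" by (auto simp: trunc_def)
  then have "trunc n w \<in> A \<longrightarrow> w \<in> A" "w \<in> A \<longrightarrow> trunc n w \<in> A"
    using A unfolding cylinder_def by blast+
  then show "w \<in> trunc n -` A \<longleftrightarrow> w \<in> A" by auto
qed

lemma integral_uniform_measure:
  fixes f :: "'a \<Rightarrow> real"
  assumes P: "finite_measure P" and A: "A \<in> sets P" "measure P A > 0" and f: "f \<in> borel_measurable P"
  shows "(\<integral>x. f x \<partial>uniform_measure P A) = (\<integral>x. indicator A x * f x \<partial>P) / measure P A"
proof -
  interpret finite_measure P by fact
  have eq: "indicator A x / emeasure P A = ennreal (indicator A x / measure P A)" for x
    using A by (auto simp: emeasure_eq_measure indicator_def divide_ennreal ennreal_1[symmetric] simp del: ennreal_1)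
  have "(\<integral>x. f x \<partial>uniform_measure P A) = (\<integral>x. (indicator A x / measure P A) *\<^sub>R f x \<partial>P)"
    unfolding uniform_measure_def eq using A f by (intro integral_density) auto
  also have "\<dots> = (\<integral>x. (indicator A x * f x) / measure P A \<partial>P)"
    by (intro Bochner_Integration.integral_cong) auto
  finally show ?thesis by simp
qed

text \<open>Contains the law of the first coordinate under every member of \<open>Theta E\<close>, and the laws of the later
coordinates given events of the past. Lipschitz test functions are used because independence and equality
in distribution are stated for them.\<close>

definition coordinate_laws :: "((path \<Rightarrow> real) \<Rightarrow> real) \<Rightarrow> real measure set" where
  "coordinate_laws E = {\<mu>. real_distribution \<mu> \<and> (\<forall>g\<in>bounded_lipschitz. (\<integral>x. g x \<partial>\<mu>) \<le> ext E (\<lambda>w. g (w 0)))}"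

lemma bounded_lipschitz_powr_min:
  assumes N: "N > 0" and g: "g > 1"
  shows "(\<lambda>x. (min \<bar>x\<bar> N) powr g) \<in> bounded_lipschitz"
proof -
  define L where "L = g * N powr (g - 1)"
  have mono: "x powr g - y powr g \<le> L * (x - y)" if "0 \<le> y" "y \<le> x" "x \<le> N" for x y
  proof (cases "y = 0 \<or> x = y")
    case False
    then have "x powr g + g * x powr (g - 1) * (y - x) \<le> y powr g"
      using that by (intro powr_tangent g) auto
    then have "x powr g - y powr g \<le> g * x powr (g - 1) * (x - y)" by (simp add: algebra_simps)
    also have "\<dots> \<le> L * (x - y)"
      unfolding L_def using that g by (intro mult_right_mono mult_left_mono powr_mono2) auto
    finally show ?thesis .
  next
    case True
    have "x powr g \<le> L * x"
    proof -
      have "x powr g = x powr (g - 1) * x" using that by (cases "x = 0") (auto simp: powr_diff)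
      also have "\<dots> \<le> N powr (g - 1) * x"
        using that g by (intro mult_right_mono powr_mono2) auto
      also have "\<dots> \<le> L * x"
        using mult_right_mono[of 1 g "N powr (g - 1) * x"] that g by (simp add: L_def mult_ac)
      finally show ?thesis .
    qed
    then show ?thesis using True by auto
  qed
  have L0: "L \<ge> 0" using g by (simp add: L_def)
  have "\<bar>(min \<bar>x\<bar> N) powr g - (min \<bar>y\<bar> N) powr g\<bar> \<le> L * \<bar>x - y\<bar>" for x y
  proof -
    have *: "\<bar>a powr g - b powr g\<bar> \<le> L * \<bar>a - b\<bar>" if "0 \<le> a" "a \<le> N" "0 \<le> b" "b \<le> N" for a b
    proof (cases "b \<le> a")
      case True
      moreover have "b powr g \<le> a powr g" using True that g by (intro powr_mono2) auto
      ultimately show ?thesis using mono[of b a] that by auto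
    next
      case False
      moreover have "a powr g \<le> b powr g" using False that g by (intro powr_mono2) auto
      ultimately show ?thesis using mono[of a b] that by auto
    qed
    have "\<bar>(min \<bar>x\<bar> N) powr g - (min \<bar>y\<bar> N) powr g\<bar> \<le> L * \<bar>min \<bar>x\<bar> N - min \<bar>y\<bar> N\<bar>"
      using N by (intro *) auto
    also have "\<dots> \<le> L * \<bar>x - y\<bar>" by (intro mult_left_mono L0) (auto simp: min_def)
    finally show ?thesis .
  qed
  moreover have "bounded (range (\<lambda>x. (min \<bar>x\<bar> N) powr g))"
    using N g by (auto simp: bounded_iff intro!: exI[of _ "N powr g"] powr_mono2)
  ultimately show ?thesis by (auto simp: bounded_lipschitz_def)
qed

context iid_coordinates
begin

text \<open>The indicator of an open set is the increasing limit of the Lipschitz functions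
\<open>min 1 (k dist(\<cdot>, complement))\<close>, which may serve as \<open>\<psi>\<close> in the previous lemma.\<close>

lemma open_cylinder_le:
  assumes P: "P \<in> Theta E" and n: "n \<ge> 1" and U: "open U" and g: "g \<in> bounded_lipschitz"
  shows "(\<integral>w. indicator (trunc n -` U) w * (g (w n) - ext E (\<lambda>w. g (w 0))) \<partial>P) \<le> 0"
proof -
  define c where "c = ext E (\<lambda>w. g (w 0))"
  interpret prob_space P by (rule borel_probsD[OF ThetaD[OF P]])
  have [measurable_cong]: "sets P = sets borel" by (rule borel_probsD[OF ThetaD[OF P]])
  have [measurable]: "g \<in> borel_measurable borel" by (rule bounded_lipschitz_measurable[OF g])
  have [measurable]: "U \<in> sets borel" using U by simp
  obtain G where G: "\<And>x. \<bar>g x\<bar> \<le> G" using g by (auto simp: bounded_lipschitz_def bounded_iff)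
  \<comment> \<open>The distance to the empty set is zero by convention, so the whole space is treated apart.\<close>
  define \<psi> where "\<psi> k w = (if U = UNIV then 1 else min 1 (real k * infdist (trunc n w) (- U)))" for k w
  have \<psi>01: "0 \<le> \<psi> k w" "\<psi> k w \<le> 1" for k w by (auto simp: \<psi>_def infdist_nonneg)
  have \<psi>: "\<psi> k \<in> cylinder_lipschitz n" for k
  proof (rule cylinder_lipschitzI)
    show "\<bar>\<psi> k x\<bar> \<le> 1" for x using \<psi>01[of k x] by auto
    fix x y
    have "\<bar>infdist (trunc n x) (- U) - infdist (trunc n y) (- U)\<bar> \<le> 2 * L2_set (\<lambda>i. x i - y i) {..<n}"
      by (rule order_trans[OF infdist_triangle_abs dist_trunc_le])
    then have "real k * \<bar>infdist (trunc n x) (- U) - infdist (trunc n y) (- U)\<bar> \<le> real k * (2 * L2_set (\<lambda>i. x i - y i) {..<n})"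
      by (intro mult_left_mono) auto
    then have le: "\<bar>real k * infdist (trunc n x) (- U) - real k * infdist (trunc n y) (- U)\<bar> \<le> real k * (2 * L2_set (\<lambda>i. x i - y i) {..<n})"
      by (simp add: abs_mult flip: right_diff_distrib)
    have "\<bar>\<psi> k x - \<psi> k y\<bar> \<le> \<bar>real k * infdist (trunc n x) (- U) - real k * infdist (trunc n y) (- U)\<bar>"
      by (auto simp: \<psi>_def)
    then show "\<bar>\<psi> k x - \<psi> k y\<bar> \<le> real k * 2 * L2_set (\<lambda>i. x i - y i) {..<n}"
      using le by simp
  qed
  have [measurable]: "\<psi> k \<in> borel_measurable borel" for k by (rule cylinder_lipschitz_measurable[OF \<psi>])
  have lim: "(\<lambda>k. \<psi> k w) \<longlonglongrightarrow> indicator (trunc n -` U) w" for w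
  proof (cases "U = UNIV")
    case True then show ?thesis by (simp add: \<psi>_def)
  next
    case U': False
    show ?thesis
    proof (cases "trunc n w \<in> U")
      case False
      then have "infdist (trunc n w) (- U) = 0" by (intro infdist_zero) auto
      then show ?thesis using False U' by (simp add: \<psi>_def)
    next
      case True
      define \<delta> where "\<delta> = infdist (trunc n w) (- U)"
      have \<delta>: "\<delta> > 0" unfolding \<delta>_def using U U' True by (intro infdist_pos_not_in_closed) auto
      obtain N where N: "1 / \<delta> < real N" using reals_Archimedean2 by blast
      have "\<psi> k w = 1" if "k \<ge> N" for k
      proof -
        have "1 < real N * \<delta>" using N \<delta> by (simp add: field_simps)
        also have "\<dots> \<le> real k * \<delta>" using that \<delta> by (intro mult_right_mono) auto
        finally show ?thesis using U' by (simp add: \<psi>_def \<delta>_def)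
      qed
      then have "eventually (\<lambda>k. \<psi> k w = 1) sequentially" by (auto simp: eventually_sequentially)
      then show ?thesis using True by (simp add: tendsto_eventually)
    qed
  qed
  have "(\<lambda>k. \<integral>w. \<psi> k w * (g (w n) - c) \<partial>P) \<longlonglongrightarrow> (\<integral>w. indicator (trunc n -` U) w * (g (w n) - c) \<partial>P)"
  proof (rule integral_dominated_convergence[where w = "\<lambda>_. G + \<bar>c\<bar>"])
    show "AE w in P. (\<lambda>k. \<psi> k w * (g (w n) - c)) \<longlonglongrightarrow> indicator (trunc n -` U) w * (g (w n) - c)"
      by (intro AE_I2 tendsto_intros lim)
    show "AE w in P. norm (\<psi> k w * (g (w n) - c)) \<le> G + \<bar>c\<bar>" for k
    proof (rule AE_I2)
      fix w
      have "\<bar>g (w n) - c\<bar> \<le> G + \<bar>c\<bar>" using G[of "w n"] by linarith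
      then have "\<bar>\<psi> k w\<bar> * \<bar>g (w n) - c\<bar> \<le> 1 * (G + \<bar>c\<bar>)"
        using \<psi>01[of k w] by (intro mult_mono) auto
      then show "norm (\<psi> k w * (g (w n) - c)) \<le> G + \<bar>c\<bar>" by (simp add: abs_mult)
    qed
  qed auto
  then show ?thesis
    unfolding c_def by (rule LIMSEQ_le_const2) (use one_step_le[OF P n \<psi> \<psi>01(1) g] in auto)
qed

text \<open>Outer regularity passes from open sets to Borel sets. It is used for the law of the truncated
path, so that the approximating open sets are again events of the first \<open>n\<close> coordinates.\<close>

lemma cylinder_le:
  assumes P: "P \<in> Theta E" and n: "n \<ge> 1" and A: "cylinder n A" and g: "g \<in> bounded_lipschitz"
  shows "(\<integral>w. indicator A w * g (w n) \<partial>P) \<le> measure P A * ext E (\<lambda>w. g (w 0))"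
proof -
  define c where "c = ext E (\<lambda>w. g (w 0))"
  interpret prob_space P by (rule borel_probsD[OF ThetaD[OF P]])
  have [measurable_cong]: "sets P = sets borel" by (rule borel_probsD[OF ThetaD[OF P]])
  have sp: "space P = UNIV" by (rule borel_probsD[OF ThetaD[OF P]])
  have [measurable]: "g \<in> borel_measurable borel" by (rule bounded_lipschitz_measurable[OF g])
  obtain G where G: "\<And>x. \<bar>g x\<bar> \<le> G" using g by (auto simp: bounded_lipschitz_def bounded_iff)
  have [measurable]: "A \<in> sets borel" using A by (simp add: cylinder_def)
  have cG: "0 \<le> c + G"
    using ext_bounded[OF cylinder_lipschitz_Cb[OF bounded_lipschitz_cylinder[OF g zero_less_one]], of G] G by (simp add: c_def)
  have int: "integrable P (\<lambda>w. indicator B w * h (g (w n)))" if [measurable]: "B \<in> sets borel" "h \<in> borel_measurable borel"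
     and h: "\<And>x. \<bar>h (g x)\<bar> \<le> K" for B K and h :: "real \<Rightarrow> real"
  proof (rule integrable_const_bound[where B = K])
    have "0 \<le> K" using h[of 0] by linarith
    then show "AE w in P. norm (indicator B w * h (g (w n))) \<le> K"
      using h by (auto simp: indicator_def)
  qed auto
  have key: "(\<integral>w. indicator A w * (g (w n) + G) \<partial>P) \<le> (c + G) * (measure P A + e)" if e: "e > 0" for e
  proof -
    let ?T = "distr P borel (trunc n)"
    interpret T: prob_space ?T by (rule prob_space_distr) auto
    have "emeasure ?T A = (INF U \<in> {U. A \<subseteq> U \<and> open U}. emeasure ?T U)"
      by (rule outer_regular) auto
    moreover have "emeasure ?T A < emeasure ?T A + ennreal e"
      using e by (simp add: T.emeasure_eq_measure ennreal_plus[symmetric] ennreal_less_iff del: ennreal_plus)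
    ultimately obtain U where U: "A \<subseteq> U" "open U" "emeasure ?T U < emeasure ?T A + ennreal e"
      by (metis (mono_tags, lifting) INF_less_iff mem_Collect_eq)
    have [measurable]: "U \<in> sets borel" using U by simp
    define V where "V = trunc n -` U"
    have V[measurable]: "V \<in> sets borel"
      unfolding V_def using measurable_sets[OF trunc_measurable, of U n] by simp
    have "measure ?T U < measure ?T A + e"
      using U(3) e by (simp add: T.emeasure_eq_measure ennreal_plus[symmetric] ennreal_less_iff del: ennreal_plus)
    then have PV: "measure P V < measure P A + e"
      by (simp add: measure_distr sp cylinder_trunc[OF A] V_def)
    have AV: "A \<subseteq> V" using U(1) cylinder_trunc[OF A] unfolding V_def by blast
    have g0: "0 \<le> g x + G" for x using G[of x] by linarith
    have i1: "integrable P (\<lambda>w. indicator V w * (g (w n) - c))"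
      by (rule int[of _ "\<lambda>x. x - c" "G + \<bar>c\<bar>"]) (use G in \<open>auto intro: order_trans[OF abs_triangle_ineq4]\<close>)
    have i2: "integrable P (\<lambda>w. indicator B w * (g (w n) + G))" if "B \<in> sets borel" for B
      by (rule int[of _ "\<lambda>x. x + G" "2 * G", OF that]) (use G g0 in \<open>auto simp: abs_le_iff\<close>)
    have i3: "integrable P (\<lambda>w. (c + G) * indicator V w)"
      by (intro integrable_mult_right integrable_const_bound[where B = 1]) auto
    \<comment> \<open>The constant \<open>G\<close> makes the integrand nonnegative, so that enlarging \<open>A\<close> to \<open>V\<close> increases the integral.\<close>
    have "(\<integral>w. indicator A w * (g (w n) + G) \<partial>P) \<le> (\<integral>w. indicator V w * (g (w n) + G) \<partial>P)"
      by (intro integral_mono i2 mult_right_mono g0) (use AV in \<open>auto simp: indicator_def\<close>)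
    also have "\<dots> = (\<integral>w. indicator V w * (g (w n) - c) + (c + G) * indicator V w \<partial>P)"
      by (intro Bochner_Integration.integral_cong) (auto simp: algebra_simps)
    also have "\<dots> = (\<integral>w. indicator V w * (g (w n) - c) \<partial>P) + (c + G) * measure P V"
      using i1 i3 by (simp add: sp)
    also have "\<dots> \<le> (c + G) * measure P V"
      using open_cylinder_le[OF P n U(2) g] by (simp add: c_def V_def)
    also have "\<dots> \<le> (c + G) * (measure P A + e)"
      using PV cG by (intro mult_left_mono) auto
    finally show ?thesis .
  qed
  have i4: "integrable P (\<lambda>w. indicator A w * g (w n))"
    by (rule int[of _ "\<lambda>x. x" G]) (use G in auto)
  have "(\<integral>w. indicator A w * (g (w n) + G) \<partial>P) \<le> (c + G) * measure P A"
  proof (rule field_le_epsilon)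
    fix e :: real assume e: "e > 0"
    have "(\<integral>w. indicator A w * (g (w n) + G) \<partial>P) \<le> (c + G) * (measure P A + e / (c + G + 1))"
      by (rule key) (use e cG in auto)
    also have "\<dots> \<le> (c + G) * measure P A + e"
      using e cG by (simp add: field_simps)
    finally show "(\<integral>w. indicator A w * (g (w n) + G) \<partial>P) \<le> (c + G) * measure P A + e" .
  qed
  also have "(\<integral>w. indicator A w * (g (w n) + G) \<partial>P) = (\<integral>w. indicator A w * g (w n) + G * indicator A w \<partial>P)"
    by (intro Bochner_Integration.integral_cong) (auto simp: algebra_simps)
  also have "\<dots> = (\<integral>w. indicator A w * g (w n) \<partial>P) + G * measure P A"
  proof -
    have "integrable P (\<lambda>w. G * indicator A w)"
      by (intro integrable_mult_right integrable_const_bound[where B = 1]) auto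
    then show ?thesis using i4 by (simp add: sp)
  qed
  finally show ?thesis by (simp add: c_def algebra_simps)
qed

lemma first_coordinate_law:
  assumes P: "P \<in> Theta E" shows "distr P borel (\<lambda>w. w 0) \<in> coordinate_laws E"
proof -
  interpret prob_space P by (rule borel_probsD[OF ThetaD[OF P]])
  have [measurable_cong]: "sets P = sets borel" by (rule borel_probsD[OF ThetaD[OF P]])
  have "real_distribution (distr P borel (\<lambda>w. w 0))" by (rule real_distribution_distr) auto
  moreover have "(\<integral>x. g x \<partial>distr P borel (\<lambda>w. w 0)) \<le> ext E (\<lambda>w. g (w 0))" if g: "g \<in> bounded_lipschitz" for g
  proof -
    have [measurable]: "g \<in> borel_measurable borel" by (rule bounded_lipschitz_measurable[OF g])
    have "(\<integral>x. g x \<partial>distr P borel (\<lambda>w. w 0)) = (\<integral>w. g (w 0) \<partial>P)" by (rule integral_distr) auto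
    then show ?thesis using ext_upper[OF P cylinder_lipschitz_Cb[OF bounded_lipschitz_cylinder[OF g zero_less_one]]] by simp
  qed
  ultimately show ?thesis by (auto simp: coordinate_laws_def)
qed

lemma conditional_coordinate_law:
  assumes P: "P \<in> Theta E" and n: "n \<ge> 1" and A: "cylinder n A" "measure P A > 0"
  shows "distr (uniform_measure P A) borel (\<lambda>w. w n) \<in> coordinate_laws E"
proof -
  interpret prob_space P by (rule borel_probsD[OF ThetaD[OF P]])
  have [measurable_cong]: "sets P = sets borel" by (rule borel_probsD[OF ThetaD[OF P]])
  have [measurable]: "A \<in> sets borel" using A by (simp add: cylinder_def)
  interpret U: prob_space "uniform_measure P A"
    by (rule prob_space_uniform_measure) (use A(2) in \<open>auto simp: emeasure_eq_measure\<close>)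
  have "real_distribution (distr (uniform_measure P A) borel (\<lambda>w. w n))" by (rule U.real_distribution_distr) auto
  moreover have "(\<integral>x. g x \<partial>distr (uniform_measure P A) borel (\<lambda>w. w n)) \<le> ext E (\<lambda>w. g (w 0))" if g: "g \<in> bounded_lipschitz" for g
  proof -
    have [measurable]: "g \<in> borel_measurable borel" by (rule bounded_lipschitz_measurable[OF g])
    have "(\<integral>x. g x \<partial>distr (uniform_measure P A) borel (\<lambda>w. w n)) = (\<integral>w. g (w n) \<partial>uniform_measure P A)"
      by (rule integral_distr) auto
    also have "\<dots> = (\<integral>w. indicator A w * g (w n) \<partial>P) / measure P A"
      by (rule integral_uniform_measure) (use A finite_measure_axioms in auto)
    also have "\<dots> \<le> ext E (\<lambda>w. g (w 0))"
      using cylinder_le[OF P n A(1) g] A(2) by (simp add: divide_le_eq mult.commute)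
    finally show ?thesis .
  qed
  ultimately show ?thesis by (auto simp: coordinate_laws_def)
qed

lemma coordinate_laws_closed:
  assumes u: "\<And>n. u n \<in> coordinate_laws E" and \<mu>: "real_distribution \<mu>" and conv: "weak_conv_m u \<mu>"
  shows "\<mu> \<in> coordinate_laws E"
proof -
  have "(\<integral>x. g x \<partial>\<mu>) \<le> ext E (\<lambda>w. g (w 0))" if g: "g \<in> bounded_lipschitz" for g
  proof -
    obtain G where G: "\<And>x. \<bar>g x\<bar> \<le> G" using g by (auto simp: bounded_lipschitz_def bounded_iff)
    have "(\<lambda>n. \<integral>x. g x \<partial>u n) \<longlonglongrightarrow> (\<integral>x. g x \<partial>\<mu>)"
      by (rule weak_conv_imp_integral_bdd_continuous_conv[where B = G, OF _ _ conv])
         (use u \<mu> G bounded_lipschitz_isCont[OF g] in \<open>auto simp: coordinate_laws_def\<close>)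
    then show ?thesis by (rule LIMSEQ_le_const2) (use u g in \<open>auto simp: coordinate_laws_def\<close>)
  qed
  then show ?thesis using \<mu> by (auto simp: coordinate_laws_def)
qed

text \<open>The function \<open>\<bar>x\<bar>\<^sup>g\<close> is not an admissible test function, but its truncations are bounded and
Lipschitz; monotone convergence transfers the bound.\<close>

lemma coordinate_laws_moment_bounded:
  assumes C: "\<And>P. P \<in> Theta E \<Longrightarrow> (\<integral>\<^sup>+w. ennreal (\<bar>w 0\<bar> powr g) \<partial>P) \<le> ennreal C" and C0: "C \<ge> 0"
    and g: "g > 1" and \<mu>: "\<mu> \<in> coordinate_laws E"
  shows "moment_bounded g C \<mu>"
proof -
  interpret real_distribution \<mu> using \<mu> by (simp add: coordinate_laws_def)
  define h where "h N x = (min \<bar>x\<bar> (real (Suc N))) powr g" for N x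
  have h: "h N \<in> bounded_lipschitz" for N unfolding h_def by (rule bounded_lipschitz_powr_min) (use g in auto)
  have [measurable]: "h N \<in> borel_measurable borel" for N by (rule bounded_lipschitz_measurable[OF h])
  have h0: "0 \<le> h N x" for N x by (simp add: h_def)
  have hle: "h N x \<le> \<bar>x\<bar> powr g" for N x unfolding h_def using g by (intro powr_mono2) auto
  have hb: "h N x \<le> real (Suc N) powr g" for N x unfolding h_def using g by (intro powr_mono2) auto
  have "ext E (\<lambda>w. h N (w 0)) \<le> C" for N
  proof (rule ext_least)
    fix P assume P: "P \<in> Theta E"
    have [measurable_cong]: "sets P = sets borel" by (rule borel_probsD[OF ThetaD[OF P]])
    have "ennreal (\<integral>w. h N (w 0) \<partial>P) = (\<integral>\<^sup>+w. ennreal (h N (w 0)) \<partial>P)"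
      by (rule nn_integral_eq_integral[symmetric])
         (use h0 Cb_integrable[OF ThetaD[OF P] cylinder_lipschitz_Cb[OF bounded_lipschitz_cylinder[OF h zero_less_one]]] in auto)
    also have "\<dots> \<le> (\<integral>\<^sup>+w. ennreal (\<bar>w 0\<bar> powr g) \<partial>P)" by (intro nn_integral_mono ennreal_leI hle)
    also have "\<dots> \<le> ennreal C" by (rule C[OF P])
    finally show "(\<integral>w. h N (w 0) \<partial>P) \<le> C" using C0 by simp
  qed
  moreover have "(\<integral>x. h N x \<partial>\<mu>) \<le> ext E (\<lambda>w. h N (w 0))" for N
    using \<mu> h[of N] by (simp add: coordinate_laws_def)
  ultimately have le: "(\<integral>x. h N x \<partial>\<mu>) \<le> C" for N by (rule order_trans[rotated])
  have nle: "(\<integral>\<^sup>+x. ennreal (h N x) \<partial>\<mu>) \<le> ennreal C" for N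
  proof -
    have "integrable \<mu> (h N)"
      by (rule integrable_const_bound[where B = "real (Suc N) powr g"]) (use h0 hb in auto)
    then have "(\<integral>\<^sup>+x. ennreal (h N x) \<partial>\<mu>) = ennreal (\<integral>x. h N x \<partial>\<mu>)"
      using h0 by (intro nn_integral_eq_integral) auto
    then show ?thesis using le by (simp add: ennreal_leI)
  qed
  have sup: "(SUP N. ennreal (h N x)) = ennreal (\<bar>x\<bar> powr g)" for x
  proof (rule antisym)
    show "(SUP N. ennreal (h N x)) \<le> ennreal (\<bar>x\<bar> powr g)"
      by (intro SUP_least ennreal_leI hle)
    obtain N where "\<bar>x\<bar> < real N" using reals_Archimedean2 by blast
    then have "h N x = \<bar>x\<bar> powr g" by (simp add: h_def)
    then show "ennreal (\<bar>x\<bar> powr g) \<le> (SUP N. ennreal (h N x))"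
      by (intro SUP_upper2[of N]) auto
  qed
  have inc: "incseq (\<lambda>N x. ennreal (h N x))"
    unfolding h_def incseq_def le_fun_def using g by (auto intro!: ennreal_leI powr_mono2)
  have "(\<integral>\<^sup>+x. ennreal (\<bar>x\<bar> powr g) \<partial>\<mu>) = (SUP N. \<integral>\<^sup>+x. ennreal (h N x) \<partial>\<mu>)"
    unfolding sup[symmetric] by (rule nn_integral_monotone_convergence_SUP[OF inc]) auto
  also have "\<dots> \<le> ennreal C" by (intro SUP_least nle)
  finally show ?thesis by (simp add: moment_bounded_def real_distribution_axioms)
qed

text \<open>Membership in \<open>Theta E\<close> need only be tested on Lipschitz functions of finitely many, and at least
\<open>d\<close>, coordinates: bounded continuous functions are limits of these from below, and \<open>E\<close> is
monotone.\<close>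

lemma Theta_I:
  assumes P: "P \<in> borel_probs" and le: "\<And>n f. n \<ge> d \<Longrightarrow> f \<in> cylinder_lipschitz n \<Longrightarrow> integral\<^sup>L P f \<le> ext E f"
  shows "P \<in> Theta E"
proof -
  interpret prob_space P by (rule borel_probsD[OF P])
  have s[measurable_cong]: "sets P = sets borel" by (rule borel_probsD[OF P])
  have "integral\<^sup>L P X \<le> E X" if X: "X \<in> Cb" for X
  proof -
    obtain f M where f: "\<And>k. f k \<in> cylinder_lipschitz k" "\<And>k w. f k w \<le> X w" "\<And>w. (\<lambda>k. f k w) \<longlonglongrightarrow> X w" "\<And>k w. \<bar>f k w\<bar> \<le> M"
      using inf_convolution[OF X] by metis
    have [measurable]: "f k \<in> borel_measurable borel" for k by (rule cylinder_lipschitz_measurable[OF f(1)])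
    have [measurable]: "X \<in> borel_measurable borel"
      using X by (auto simp: Cb_def intro: borel_measurable_continuous_onI)
    have "(\<lambda>k. integral\<^sup>L P (f k)) \<longlonglongrightarrow> integral\<^sup>L P X"
      by (rule integral_dominated_convergence[where w = "\<lambda>_. M"]) (use f in auto)
    moreover have "integral\<^sup>L P (f k) \<le> E X" for k
    proof -
      have "f k \<in> cylinder_lipschitz (max d k)" by (rule cylinder_lipschitz_mono[OF f(1)]) simp
      then have "integral\<^sup>L P (f k) \<le> ext E (f k)" by (rule le[rotated]) simp
      also have "\<dots> \<le> ext E X" using ext_le_ext_add[OF cylinder_lipschitz_Cb[OF f(1)[of k]] X, of 0] f(2) by simp
      finally show ?thesis by (simp add: ext_eq_on_Cb[OF sublinear X])
    qed
    ultimately show ?thesis by (intro LIMSEQ_le_const2) auto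
  qed
  then show ?thesis using P by (auto simp: Theta_def)
qed

end

section \<open>Prescribing the coordinates after time \<open>d\<close>\<close>

lemma cylinderD: "cylinder n A \<Longrightarrow> A \<in> sets borel" by (simp add: cylinder_def)

lemma cylinder_iff: "cylinder n A \<Longrightarrow> (\<And>i. i < n \<Longrightarrow> x i = y i) \<Longrightarrow> x \<in> A \<longleftrightarrow> y \<in> A"
  unfolding cylinder_def by metis

lemma cylinderI:
  assumes "A \<in> sets borel" "\<And>x y. (\<And>i. i < n \<Longrightarrow> x i = y i) \<Longrightarrow> x \<in> A \<Longrightarrow> y \<in> A"
  shows "cylinder n A"
  unfolding cylinder_def using assms by blast

lemma fun_upd_measurable_borel[measurable]:
  "(\<lambda>(w, x). w(n := x)) \<in> borel_measurable ((borel :: path measure) \<Otimes>\<^sub>M (borel :: real measure))"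
proof (rule measurable_coordinatewise_then_product)
  fix i show "(\<lambda>z. (case z of (w, x) \<Rightarrow> w(n := x)) i) \<in> borel_measurable ((borel :: path measure) \<Otimes>\<^sub>M (borel :: real measure))"
    by (cases "i = n") (auto simp: split_beta' intro: measurable_compose[OF measurable_fst measurable_product_coordinates])
qed

lemma fun_upd_measurable_right: "(\<lambda>x. w(n := x)) \<in> (borel :: real measure) \<rightarrow>\<^sub>M (borel :: path measure)"
proof (rule measurable_coordinatewise_then_product)
  show "(\<lambda>x. (w(n := x)) i) \<in> borel_measurable (borel :: real measure)" for i
    by (cases "i = n") auto
qed

text \<open>As the rule \<open>b\<close> looks only at the first \<open>d\<close> coordinates, the later coordinates can be made
independent, with known laws, once the first \<open>d\<close> are given.\<close>

locale switched_coins =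
  fixes P :: "path measure" and \<kappa> :: "bool \<Rightarrow> real measure" and b :: "nat \<Rightarrow> path \<Rightarrow> bool" and d :: nat
  assumes P: "P \<in> borel_probs"
    and \<kappa>: "\<And>c. real_distribution (\<kappa> c)"
    and b: "\<And>n. cylinder d {w. b n w}"
begin

text \<open>At each time one independent sample from each of the two laws is drawn, whichever the rule
selects; this keeps \<open>W\<close> a product measure that does not depend on the path.\<close>

definition W :: "(nat \<times> bool \<Rightarrow> real) measure" where
  "W = (\<Pi>\<^sub>M j\<in>UNIV. \<kappa> (snd j))"

definition paste :: "path \<times> (nat \<times> bool \<Rightarrow> real) \<Rightarrow> path" where
  "paste z = (\<lambda>i. if i < d then fst z i else snd z (i, b i (fst z)))"

definition Q :: "path measure" where
  "Q = distr (P \<Otimes>\<^sub>M W) borel paste"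

lemma prob_\<kappa>: "prob_space (\<kappa> c)" using \<kappa>[of c] by (simp add: real_distribution_def)

lemma sets_\<kappa>[measurable_cong]: "sets (\<kappa> c) = sets borel"
  using \<kappa>[of c] by (simp add: real_distribution.events_eq_borel)

lemma space_\<kappa>: "space (\<kappa> c) = UNIV" using sets_eq_imp_space_eq[OF sets_\<kappa>] by simp

lemma sets_P[measurable_cong]: "sets P = sets borel" and space_P: "space P = UNIV" and prob_P: "prob_space P"
  using borel_probsD[OF P] by auto

lemma prob_W: "prob_space W" unfolding W_def by (rule prob_space_PiM[OF prob_\<kappa>])

lemma sets_W[measurable_cong]: "sets W = sets (\<Pi>\<^sub>M j\<in>UNIV. borel)"
  unfolding W_def by (rule sets_PiM_cong) (auto simp: sets_\<kappa>)

lemma b_measurable[measurable]: "Measurable.pred borel (b n)"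
  using cylinderD[OF b[of n]] by (simp add: pred_def)

lemma b_cong: "(\<And>i. i < d \<Longrightarrow> x i = y i) \<Longrightarrow> b n x = b n y"
  using cylinder_iff[OF b[of n], of x y] by simp

lemma paste_measurable[measurable]: "paste \<in> borel_measurable (P \<Otimes>\<^sub>M W)"
proof (rule measurable_coordinatewise_then_product)
  fix i
  have f[measurable]: "fst \<in> borel_measurable (P \<Otimes>\<^sub>M W)"
    using measurable_fst[of P W] by (simp add: measurable_cong_sets[OF refl sets_P])
  have [measurable]: "(\<lambda>z. fst z i) \<in> borel_measurable (P \<Otimes>\<^sub>M W)"
    by (rule measurable_compose[OF f measurable_product_coordinates])
  have [measurable]: "(\<lambda>z. snd z j) \<in> borel_measurable (P \<Otimes>\<^sub>M W)" for j
    by measurable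
  have [measurable]: "Measurable.pred (P \<Otimes>\<^sub>M W) (\<lambda>z. b i (fst z))"
    by (rule measurable_compose[OF f b_measurable])
  have "(\<lambda>z. if b i (fst z) then snd z (i, True) else snd z (i, False)) \<in> borel_measurable (P \<Otimes>\<^sub>M W)"
    by measurable
  then have "(\<lambda>z. if i < d then fst z i else if b i (fst z) then snd z (i, True) else snd z (i, False)) \<in> borel_measurable (P \<Otimes>\<^sub>M W)"
    by (cases "i < d") auto
  also have "(\<lambda>z. if i < d then fst z i else if b i (fst z) then snd z (i, True) else snd z (i, False)) = (\<lambda>z. paste z i)"
    by (auto simp: paste_def fun_eq_iff)
  finally show "(\<lambda>z. paste z i) \<in> borel_measurable (P \<Otimes>\<^sub>M W)" .
qed

sublocale P: prob_space P by (rule prob_P)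
sublocale W: prob_space W by (rule prob_W)
sublocale PW: pair_prob_space P W ..

lemma Q_borel_probs: "Q \<in> borel_probs"
  unfolding borel_probs_def Q_def by (auto intro!: PW.prob_space_distr)

lemma sets_Q[measurable_cong]: "sets Q = sets borel" by (simp add: Q_def)
lemma space_Q: "space Q = UNIV" by (simp add: Q_def)

lemma Q_cylinder: assumes A: "cylinder d A" shows "emeasure Q A = emeasure P A"
proof -
  have A': "A \<in> sets borel" by (rule cylinderD[OF A])
  have "paste z \<in> A \<longleftrightarrow> fst z \<in> A" for z
    by (rule cylinder_iff[OF A]) (simp add: paste_def)
  then have eq: "paste -` A \<inter> space (P \<Otimes>\<^sub>M W) = A \<times> space W"
    by (auto simp: space_pair_measure space_P)
  have "emeasure Q A = emeasure (P \<Otimes>\<^sub>M W) (A \<times> space W)"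
    unfolding Q_def using A' by (simp add: emeasure_distr eq)
  also have "\<dots> = emeasure P A * emeasure W (space W)"
    using A' by (intro W.emeasure_pair_measure_Times) (auto simp: sets_P)
  finally show ?thesis by (simp add: W.emeasure_space_1)
qed

text \<open>The product measure is its own image, together with one more independent sample, under overwriting
coordinate \<open>j\<close> by that sample; Fubini's theorem does the rest.\<close>

lemma W_resample:
  assumes f: "f \<in> borel_measurable W"
  shows "(\<integral>\<^sup>+u. f u \<partial>W) = (\<integral>\<^sup>+u. (\<integral>\<^sup>+x. f (u(j := x)) \<partial>\<kappa> (snd j)) \<partial>W)"
proof -
  interpret K: prob_space "\<kappa> (snd j)" by (rule prob_\<kappa>)
  interpret KW: pair_prob_space "\<kappa> (snd j)" W ..
  have D: "distr (\<kappa> (snd j) \<Otimes>\<^sub>M W) W (\<lambda>(x, X). X(j := x)) = W"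
    using distr_pair_PiM_eq_PiM[of UNIV "\<lambda>j. \<kappa> (snd j)" j] prob_\<kappa> by (simp add: W_def)
  have m[measurable]: "(\<lambda>(x, X). X(j := x)) \<in> \<kappa> (snd j) \<Otimes>\<^sub>M W \<rightarrow>\<^sub>M W"
    unfolding W_def by (rule measurable_PiM_single') (auto simp: split_beta' space_pair_measure space_PiM space_\<kappa>)
  have f2[measurable]: "(\<lambda>z. f ((\<lambda>(x, X). X(j := x)) z)) \<in> borel_measurable (\<kappa> (snd j) \<Otimes>\<^sub>M W)"
    by (rule measurable_compose[OF m f])
  have "(\<integral>\<^sup>+u. f u \<partial>W) = (\<integral>\<^sup>+u. f u \<partial>distr (\<kappa> (snd j) \<Otimes>\<^sub>M W) W (\<lambda>(x, X). X(j := x)))"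
    by (simp add: D)
  also have "\<dots> = (\<integral>\<^sup>+z. f ((\<lambda>(x, X). X(j := x)) z) \<partial>(\<kappa> (snd j) \<Otimes>\<^sub>M W))"
    by (rule nn_integral_distr[OF m]) (use f in simp)
  also have "\<dots> = (\<integral>\<^sup>+u. (\<integral>\<^sup>+x. f ((\<lambda>(x, X). X(j := x)) (x, u)) \<partial>\<kappa> (snd j)) \<partial>W)"
    by (rule KW.nn_integral_snd[symmetric, OF f2])
  finally show ?thesis by simp
qed

lemma kernel_measurable:
  assumes [measurable]: "h \<in> borel_measurable (borel :: path measure)"
  shows "(\<lambda>w. \<integral>\<^sup>+x. h (w(n := x)) \<partial>\<kappa> (b n w)) \<in> borel_measurable borel"
proof -
  have *: "(\<lambda>w. \<integral>\<^sup>+x. h (w(n := x)) \<partial>\<kappa> c) \<in> borel_measurable borel" for c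
  proof -
    interpret K: prob_space "\<kappa> c" by (rule prob_\<kappa>)
    have "(\<lambda>z. h ((\<lambda>(w, x). w(n := x)) z)) \<in> borel_measurable ((borel :: path measure) \<Otimes>\<^sub>M \<kappa> c)"
      by measurable
    then have "(\<lambda>(w, x). h (w(n := x))) \<in> borel_measurable ((borel :: path measure) \<Otimes>\<^sub>M \<kappa> c)"
      by (simp add: split_beta')
    then show ?thesis by (rule K.borel_measurable_nn_integral)
  qed
  have "(\<lambda>w. if b n w then \<integral>\<^sup>+x. h (w(n := x)) \<partial>\<kappa> True else \<integral>\<^sup>+x. h (w(n := x)) \<partial>\<kappa> False) \<in> borel_measurable borel"
    using *[of True] *[of False] by measurable
  also have "(\<lambda>w. if b n w then \<integral>\<^sup>+x. h (w(n := x)) \<partial>\<kappa> True else \<integral>\<^sup>+x. h (w(n := x)) \<partial>\<kappa> False) = (\<lambda>w. \<integral>\<^sup>+x. h (w(n := x)) \<partial>\<kappa> (b n w))"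
    by (auto simp: fun_eq_iff)
  finally show ?thesis .
qed

text \<open>The one property of \<open>Q\<close> from which all statements on conditional laws follow: after time \<open>d\<close> any
coordinate may be replaced by a fresh sample from the law that the rule selects. It expresses the
conditional law of a coordinate without disintegrating \<open>Q\<close>.\<close>

lemma resample:
  assumes n: "n \<ge> d" and h[measurable]: "h \<in> borel_measurable (borel :: path measure)"
  shows "(\<integral>\<^sup>+w. h w \<partial>Q) = (\<integral>\<^sup>+w. (\<integral>\<^sup>+x. h (w(n := x)) \<partial>\<kappa> (b n w)) \<partial>Q)"
proof -
  have "(\<integral>\<^sup>+w. h w \<partial>Q) = (\<integral>\<^sup>+z. h (paste z) \<partial>(P \<Otimes>\<^sub>M W))"
    unfolding Q_def by (rule nn_integral_distr) auto
  also have "\<dots> = (\<integral>\<^sup>+w. (\<integral>\<^sup>+u. h (paste (w, u)) \<partial>W) \<partial>P)"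
    by (rule W.nn_integral_fst[symmetric]) measurable
  also have "\<dots> = (\<integral>\<^sup>+w. (\<integral>\<^sup>+u. (\<integral>\<^sup>+x. h ((paste (w, u))(n := x)) \<partial>\<kappa> (b n (paste (w, u)))) \<partial>W) \<partial>P)"
  proof (rule nn_integral_cong)
    fix w assume w: "w \<in> space P"
    have [measurable]: "(\<lambda>u. paste (w, u)) \<in> borel_measurable W"
      by (rule measurable_compose[OF measurable_Pair1'[OF w] paste_measurable])
    have "(\<integral>\<^sup>+u. h (paste (w, u)) \<partial>W) = (\<integral>\<^sup>+u. (\<integral>\<^sup>+x. h (paste (w, u((n, b n w) := x))) \<partial>\<kappa> (snd (n, b n w))) \<partial>W)"
      by (rule W_resample) measurable
    moreover have "paste (w, u((n, b n w) := x)) = (paste (w, u))(n := x)" for u x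
      using n by (auto simp: paste_def fun_eq_iff)
    moreover have "b n (paste (w, u)) = b n w" for u by (rule b_cong) (simp add: paste_def)
    ultimately show "(\<integral>\<^sup>+u. h (paste (w, u)) \<partial>W) = (\<integral>\<^sup>+u. (\<integral>\<^sup>+x. h ((paste (w, u))(n := x)) \<partial>\<kappa> (b n (paste (w, u)))) \<partial>W)"
      by simp
  qed
  also have "\<dots> = (\<integral>\<^sup>+z. (\<integral>\<^sup>+x. h ((paste z)(n := x)) \<partial>\<kappa> (b n (paste z))) \<partial>(P \<Otimes>\<^sub>M W))"
    by (rule W.nn_integral_fst) (rule measurable_compose[OF paste_measurable kernel_measurable[OF h]])
  also have "\<dots> = (\<integral>\<^sup>+w. (\<integral>\<^sup>+x. h (w(n := x)) \<partial>\<kappa> (b n w)) \<partial>Q)"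
    unfolding Q_def by (rule nn_integral_distr[symmetric]) (auto intro: kernel_measurable[OF h])
  finally show ?thesis .
qed

lemma Q_next_coordinate:
  assumes n: "n \<ge> d" and A: "cylinder n A" and Ac: "\<And>w. w \<in> A \<Longrightarrow> b n w = c" and B[measurable]: "B \<in> sets borel"
  shows "measure Q (A \<inter> {w. w n \<in> B}) = measure Q A * measure (\<kappa> c) B"
proof -
  interpret Q: prob_space Q by (rule borel_probsD[OF Q_borel_probs])
  interpret K: prob_space "\<kappa> c" by (rule prob_\<kappa>)
  have [measurable]: "A \<in> sets borel" by (rule cylinderD[OF A])
  have AB: "A \<inter> {w. w n \<in> B} \<in> sets borel"
    using measurable_sets[OF measurable_product_coordinates B, of n] by (auto simp: vimage_def)
  have "emeasure Q (A \<inter> {w. w n \<in> B}) = (\<integral>\<^sup>+w. indicator (A \<inter> {w. w n \<in> B}) w \<partial>Q)"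
    using AB by (intro nn_integral_indicator[symmetric]) (simp add: sets_Q)
  also have "\<dots> = (\<integral>\<^sup>+w. (\<integral>\<^sup>+x. indicator (A \<inter> {w. w n \<in> B}) (w(n := x)) \<partial>\<kappa> (b n w)) \<partial>Q)"
    by (rule resample[OF n]) (use AB in measurable)
  also have "\<dots> = (\<integral>\<^sup>+w. emeasure (\<kappa> c) B * indicator A w \<partial>Q)"
  proof (rule nn_integral_cong)
    fix w
    have "indicator (A \<inter> {w. w n \<in> B}) (w(n := x)) = (indicator A w * indicator B x :: ennreal)" for x
      using cylinder_iff[OF A, of "w(n := x)" w] by (auto simp: indicator_def)
    then show "(\<integral>\<^sup>+x. indicator (A \<inter> {w. w n \<in> B}) (w(n := x)) \<partial>\<kappa> (b n w)) = emeasure (\<kappa> c) B * indicator A w"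
      using Ac[of w] by (cases "w \<in> A") (auto simp: sets_\<kappa>)
  qed
  also have "\<dots> = emeasure (\<kappa> c) B * emeasure Q A"
    by (rule nn_integral_cmult_indicator) simp
  finally show ?thesis
    by (simp add: Q.emeasure_eq_measure K.emeasure_eq_measure ennreal_mult[symmetric] mult.commute)
qed

lemma Q_integral_le:
  fixes f v :: "path \<Rightarrow> real"
  assumes n: "n \<ge> d" and [measurable]: "f \<in> borel_measurable borel" "v \<in> borel_measurable borel"
    and f: "\<And>w. \<bar>f w\<bar> \<le> B" and v: "\<And>w. \<bar>v w\<bar> \<le> B"
    and le: "\<And>w. (\<integral>x. f (w(n := x)) \<partial>\<kappa> (b n w)) \<le> v w"
  shows "integral\<^sup>L Q f \<le> integral\<^sup>L Q v"
proof -
  interpret Q: prob_space Q by (rule borel_probsD[OF Q_borel_probs])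
  have fI: "integrable Q f" "integrable Q v"
    by (auto intro!: Q.integrable_const_bound[where B = B] f v)
  have f0: "0 \<le> f w + B" "0 \<le> v w + B" for w using f[of w] v[of w] by auto
  have "ennreal (integral\<^sup>L Q f + B) = (\<integral>\<^sup>+w. ennreal (f w + B) \<partial>Q)"
    using fI f0 by (subst nn_integral_eq_integral) (auto simp: Q.prob_space)
  also have "\<dots> = (\<integral>\<^sup>+w. (\<integral>\<^sup>+x. ennreal (f (w(n := x)) + B) \<partial>\<kappa> (b n w)) \<partial>Q)"
    by (rule resample[OF n]) measurable
  also have "\<dots> \<le> (\<integral>\<^sup>+w. ennreal (v w + B) \<partial>Q)"
  proof (rule nn_integral_mono)
    fix w
    interpret K: prob_space "\<kappa> (b n w)" by (rule prob_\<kappa>)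
    have [measurable]: "(\<lambda>x. f (w(n := x))) \<in> borel_measurable (\<kappa> (b n w))"
      unfolding measurable_cong_sets[OF sets_\<kappa> refl] by (rule measurable_compose[OF fun_upd_measurable_right]) fact
    have I: "integrable (\<kappa> (b n w)) (\<lambda>x. f (w(n := x)))"
      by (rule K.integrable_const_bound[where B = B]) (use f in auto)
    have "(\<integral>\<^sup>+x. ennreal (f (w(n := x)) + B) \<partial>\<kappa> (b n w)) = ennreal ((\<integral>x. f (w(n := x)) \<partial>\<kappa> (b n w)) + B)"
      using I f0 by (subst nn_integral_eq_integral) (auto simp: K.prob_space)
    also have "\<dots> \<le> ennreal (v w + B)" using le by (intro ennreal_leI) auto
    finally show "(\<integral>\<^sup>+x. ennreal (f (w(n := x)) + B) \<partial>\<kappa> (b n w)) \<le> ennreal (v w + B)" .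
  qed
  also have "\<dots> = ennreal (integral\<^sup>L Q v + B)"
    using fI f0 by (subst nn_integral_eq_integral) (auto simp: Q.prob_space)
  finally have "ennreal (integral\<^sup>L Q f + B) \<le> ennreal (integral\<^sup>L Q v + B)" .
  moreover have "0 \<le> integral\<^sup>L Q v + B"
  proof -
    have "0 \<le> (\<integral>w. v w + B \<partial>Q)" by (rule integral_nonneg_AE) (use f0 in auto)
    then show ?thesis using fI by (simp add: Q.prob_space)
  qed
  ultimately show ?thesis by simp
qed

text \<open>For a fixed path \<open>w\<close> the selected samples are independent under \<open>W\<close>, so the strong law applies with
the averages of the selected means as centering; Fubini's theorem then removes the condition that
\<open>w\<close> is fixed. The first \<open>d\<close> coordinates do not influence the limit.\<close>

lemma Q_sample_mean_AE:
  assumes mb: "\<And>c. moment_bounded g C (\<kappa> c)" and C: "C \<ge> 0" and g: "1 < g" "g \<le> 2"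
    and Z[measurable]: "Z \<in> borel_measurable borel"
    and Zdep: "\<And>x y. (\<And>i. i < d \<Longrightarrow> x i = y i) \<Longrightarrow> Z x = Z y"
    and avg: "\<And>w. (\<lambda>n. (\<Sum>k<n. \<integral>x. x \<partial>\<kappa> (b k w)) / real n) \<longlonglongrightarrow> Z w"
  shows "AE w in Q. (\<lambda>n. sample_mean n w) \<longlonglongrightarrow> Z w"
proof -
  have [measurable]: "sample_mean n \<in> borel_measurable borel" for n
    unfolding sample_mean_def[abs_def] xi_def by measurable
  have lim_iff: "((\<lambda>n. sample_mean n w) \<longlonglongrightarrow> Z w) \<longleftrightarrow> (\<forall>e. \<exists>N. \<forall>n\<ge>N. \<bar>sample_mean n w - Z w\<bar> < inverse (real (Suc e)))" for w
  proof
    assume "(\<lambda>n. sample_mean n w) \<longlonglongrightarrow> Z w"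
    then show "\<forall>e. \<exists>N. \<forall>n\<ge>N. \<bar>sample_mean n w - Z w\<bar> < inverse (real (Suc e))"
      by (auto simp: LIMSEQ_iff simp del: of_nat_Suc)
  next
    assume *: "\<forall>e. \<exists>N. \<forall>n\<ge>N. \<bar>sample_mean n w - Z w\<bar> < inverse (real (Suc e))"
    show "(\<lambda>n. sample_mean n w) \<longlonglongrightarrow> Z w"
    proof (rule LIMSEQ_I)
      fix r :: real assume "r > 0"
      then obtain e where e: "inverse (real (Suc e)) < r" using reals_Archimedean by blast
      from * obtain N where N: "\<forall>n\<ge>N. \<bar>sample_mean n w - Z w\<bar> < inverse (real (Suc e))" by blast
      show "\<exists>no. \<forall>n\<ge>no. norm (sample_mean n w - Z w) < r"
      proof (intro exI[of _ N] allI impI)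
        fix n assume "n \<ge> N"
        then have "\<bar>sample_mean n w - Z w\<bar> < inverse (real (Suc e))" using N by blast
        then show "norm (sample_mean n w - Z w) < r" using e by (simp del: of_nat_Suc)
      qed
    qed
  qed
  have pm[measurable]: "Measurable.pred borel (\<lambda>w. (\<lambda>n. sample_mean n w) \<longlonglongrightarrow> Z w)"
    unfolding lim_iff by measurable
  have fixed: "AE u in W. (\<lambda>n. sample_mean n (paste (w, u))) \<longlonglongrightarrow> Z (paste (w, u))" for w
  proof -
    define X where "X k u = u (k, b k w)" for k and u :: "nat \<times> bool \<Rightarrow> real"
    have [measurable]: "X k \<in> borel_measurable W" for k unfolding X_def by measurable
    have D: "distr W borel (X k) = \<kappa> (b k w)" for k
    proof -
      have "distr W borel (X k) = distr W (\<kappa> (snd (k, b k w))) (\<lambda>u. u (k, b k w))"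
        unfolding X_def by (rule distr_cong) (auto simp: sets_\<kappa>)
      also have "\<dots> = \<kappa> (snd (k, b k w))"
        unfolding W_def by (rule distr_PiM_component[OF prob_\<kappa>]) auto
      finally show ?thesis by simp
    qed
    have ind: "W.indep_vars (\<lambda>_. borel) X UNIV"
    proof (subst W.indep_vars_iff_distr_eq_PiM')
      have "distr W (\<Pi>\<^sub>M k\<in>UNIV. borel) (\<lambda>u. \<lambda>k\<in>UNIV. X k u) = distr W (\<Pi>\<^sub>M k\<in>UNIV. \<kappa> (snd (k, b k w))) (\<lambda>u. \<lambda>k\<in>UNIV. u (k, b k w))"
        unfolding X_def by (rule distr_cong) (auto intro!: sets_PiM_cong simp: sets_\<kappa>)
      also have "\<dots> = (\<Pi>\<^sub>M k\<in>UNIV. \<kappa> (snd (k, b k w)))"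
        unfolding W_def by (rule distr_PiM_reindex[OF prob_\<kappa>]) (auto simp: inj_on_def)
      also have "\<dots> = (\<Pi>\<^sub>M k\<in>UNIV. distr W borel (X k))" by (simp add: D)
      finally show "distr W (\<Pi>\<^sub>M k\<in>UNIV. borel) (\<lambda>u. \<lambda>k\<in>UNIV. X k u) = (\<Pi>\<^sub>M k\<in>UNIV. distr W borel (X k))" .
    qed auto
    have mean: "W.expectation (X k) = (\<integral>x. x \<partial>\<kappa> (b k w))" for k
      unfolding D[symmetric] by (subst integral_distr) auto
    have mom: "integrable W (\<lambda>u. \<bar>X k u\<bar> powr g)" "W.expectation (\<lambda>u. \<bar>X k u\<bar> powr g) \<le> C" for k
    proof -
      have 1: "integrable (distr W borel (X k)) (\<lambda>x. \<bar>x\<bar> powr g)" "(\<integral>x. \<bar>x\<bar> powr g \<partial>distr W borel (X k)) \<le> C"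
        unfolding D by (rule moment_bounded_integrable[OF mb C])+
      show "integrable W (\<lambda>u. \<bar>X k u\<bar> powr g)"
        using 1(1) by (subst (asm) integrable_distr_eq) auto
      show "W.expectation (\<lambda>u. \<bar>X k u\<bar> powr g) \<le> C"
        using 1(2) by (subst (asm) integral_distr) auto
    qed
    have "AE u in W. (\<lambda>n. (\<Sum>k<n. X k u - W.expectation (X k)) / real n) \<longlonglongrightarrow> 0"
      by (rule W.slln[OF g ind mom])
    then show ?thesis
    proof eventually_elim
      case (elim u)
      have "(\<lambda>n. (\<Sum>k<n. X k u - W.expectation (X k)) / real n + (\<Sum>k<n. W.expectation (X k)) / real n) \<longlonglongrightarrow> 0 + Z w"
        unfolding mean by (intro tendsto_add avg elim[unfolded mean])
      then have 1: "(\<lambda>n. (\<Sum>k<n. X k u) / real n) \<longlonglongrightarrow> Z w"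
        by (simp add: sum_subtractf diff_divide_distrib)
      \<comment> \<open>The contribution of the first \<open>d\<close> coordinates, which vanishes after division by \<open>n\<close>.\<close>
      define c where "c = (\<Sum>k<d. paste (w, u) k - X k u)"
      have "(\<Sum>k<n. paste (w, u) k - X k u) = c" if "n \<ge> d" for n
        unfolding c_def using that
        by (intro sum.mono_neutral_right) (auto simp: paste_def X_def)
      then have "(\<Sum>k<n. paste (w, u) k) = (\<Sum>k<n. X k u) + c" if "n \<ge> d" for n
        using that by (simp add: sum_subtractf algebra_simps)
      then have eq: "sample_mean n (paste (w, u)) = (\<Sum>k<n. X k u) / real n + c / real n" if "n \<ge> d" for n
        using that by (simp add: sample_mean_def xi_def add_divide_distrib)
      have "(\<lambda>n. (\<Sum>k<n. X k u) / real n + c / real n) \<longlonglongrightarrow> Z w + 0"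
        by (intro tendsto_add 1 lim_const_over_n)
      then have "(\<lambda>n. sample_mean n (paste (w, u))) \<longlonglongrightarrow> Z w"
        by (subst tendsto_cong[of _ "\<lambda>n. (\<Sum>k<n. X k u) / real n + c / real n"])
           (auto simp: eventually_sequentially eq intro!: exI[of _ d])
      moreover have "Z (paste (w, u)) = Z w" by (rule Zdep) (simp add: paste_def)
      ultimately show ?case by simp
    qed
  qed
  have "AE z in P \<Otimes>\<^sub>M W. (\<lambda>n. sample_mean n (paste z)) \<longlonglongrightarrow> Z (paste z)"
  proof (rule PW.AE_pair_measure)
    show "{x \<in> space (P \<Otimes>\<^sub>M W). (\<lambda>n. sample_mean n (paste x)) \<longlonglongrightarrow> Z (paste x)} \<in> sets (P \<Otimes>\<^sub>M W)"
      using measurable_compose[OF paste_measurable pm] by (simp add: pred_def)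
  qed (use fixed in auto)
  then show ?thesis
    unfolding Q_def using pm by (subst AE_distr_iff) (auto simp: pred_def)
qed

end

section \<open>Events of the first \<open>d\<close> coordinates\<close>

lemma rvec_measurable: "rvec d xi \<in> borel \<rightarrow>\<^sub>M Rn d"
  unfolding rvec_def[abs_def] xi_def by (rule measurable_restrict) (rule measurable_product_coordinates)

lemma rvec_cong: "(\<And>i. i < d \<Longrightarrow> x i = y i) \<Longrightarrow> rvec d xi x = rvec d xi y"
  by (auto simp: rvec_def xi_def fun_eq_iff)

lemma rvec_cylinder: assumes "A \<in> sets (Rn d)" shows "cylinder d (rvec d xi -` A)"
proof (rule cylinderI)
  show "rvec d xi -` A \<in> sets borel" using measurable_sets[OF rvec_measurable assms] by simp
  show "y \<in> rvec d xi -` A" if "\<And>i. i < d \<Longrightarrow> x i = y i" "x \<in> rvec d xi -` A" for x y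
    using rvec_cong[of d x y, OF that(1)] that(2) by simp
qed

lemma coord_algebra_cylinder:
  assumes "A \<in> sets (coord_algebra d)" shows "cylinder d A"
proof -
  have "A \<in> sigma_sets UNIV (\<Union>k<d. {xi k -` B | B. B \<in> sets borel})"
    using assms by (simp add: coord_algebra_def)
  then show ?thesis
  proof induction
    case (Basic a)
    then obtain k B where k: "k < d" "B \<in> sets borel" "a = xi k -` B" by auto
    have "(\<lambda>w::path. w k) -` B \<in> sets borel"
      using measurable_sets[OF measurable_product_coordinates k(2), of k] by simp
    then show ?case using k by (intro cylinderI) (auto simp: xi_def vimage_def)
  next
    case Empty then show ?case by (auto intro: cylinderI)
  next
    case (Compl a)
    then show ?case unfolding cylinder_def by (auto; metis)
  next
    case (Union a)
    then show ?case unfolding cylinder_def by (auto; metis)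
  qed
qed

lemma emeasure_marginal:
  assumes P: "P \<in> borel_probs" and A: "A \<in> sets (Rn d)"
  shows "emeasure (marginal d P) A = emeasure P (rvec d xi -` A)"
proof -
  have "rvec d xi \<in> P \<rightarrow>\<^sub>M Rn d"
    using rvec_measurable borel_probsD(2)[OF P] by (simp cong: measurable_cong_sets)
  then show ?thesis
    unfolding marginal_def using A borel_probsD(3)[OF P] by (simp add: emeasure_distr)
qed

text \<open>Extending a vector by zeros gives a path whose membership in \<open>A\<close> is that of every path with these
first coordinates, so \<open>A'\<close> may be taken as the preimage of \<open>A\<close> under this extension.\<close>

lemma cylinder_eq_rvec_vimage:
  assumes A: "cylinder d A"
  obtains A' where "A' \<in> sets (Rn d)" "A = rvec d xi -` A'"
proof -
  define e :: "(nat \<Rightarrow> real) \<Rightarrow> path" where "e v = (\<lambda>i. if i < d then v i else 0)" for v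
  have m: "e \<in> Rn d \<rightarrow>\<^sub>M borel"
  proof (rule measurable_coordinatewise_then_product)
    show "(\<lambda>v. e v i) \<in> borel_measurable (Rn d)" for i
      by (cases "i < d") (auto simp: e_def)
  qed
  have "e -` A \<inter> space (Rn d) \<in> sets (Rn d)" by (rule measurable_sets[OF m cylinderD[OF A]])
  moreover have "A = rvec d xi -` (e -` A \<inter> space (Rn d))"
  proof -
    have "rvec d xi w \<in> space (Rn d)" for w using measurable_space[OF rvec_measurable, of w d] by simp
    moreover have "e (rvec d xi w) \<in> A \<longleftrightarrow> w \<in> A" for w
      by (rule cylinder_iff[OF A]) (simp add: e_def rvec_def xi_def)
    ultimately show ?thesis by auto
  qed
  ultimately show ?thesis using that by blast
qed

lemma marginal_eq_cylinder:
  assumes PR: "P \<in> borel_probs" "R \<in> borel_probs" and eq: "marginal d P = marginal d R" and A: "cylinder d A"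
  shows "emeasure P A = emeasure R A"
  using cylinder_eq_rvec_vimage[OF A] emeasure_marginal[OF PR(1)] emeasure_marginal[OF PR(2)] eq by metis

lemma cylinder_marginal_eq:
  assumes PR: "P \<in> borel_probs" "R \<in> borel_probs" and eq: "\<And>A. cylinder d A \<Longrightarrow> emeasure P A = emeasure R A"
  shows "marginal d P = marginal d R"
proof (rule measure_eqI)
  show "sets (marginal d P) = sets (marginal d R)" by (simp add: marginal_def)
  fix A assume "A \<in> sets (marginal d P)"
  then have A: "A \<in> sets (Rn d)" by (simp add: marginal_def)
  then show "emeasure (marginal d P) A = emeasure (marginal d R) A"
    using emeasure_marginal[OF PR(1) A] emeasure_marginal[OF PR(2) A] eq[OF rvec_cylinder[OF A]] by simp
qed

lemma cylinder_mono: "cylinder d A \<Longrightarrow> d \<le> n \<Longrightarrow> cylinder n A"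
  unfolding cylinder_def by (meson less_le_trans)

lemma cylinder_Int: "cylinder n A \<Longrightarrow> cylinder n B \<Longrightarrow> cylinder n (A \<inter> B)"
  unfolding cylinder_def by (auto; metis)

lemma cylinder_Compl: "cylinder n A \<Longrightarrow> cylinder n (- A)"
  unfolding cylinder_def by (auto; metis)

text \<open>Together with a set that depends on the first \<open>d\<close> coordinates these form the
intersection-stable generator on which measures are compared.\<close>

definition strip :: "nat \<Rightarrow> nat \<Rightarrow> (nat \<Rightarrow> real set) \<Rightarrow> path set" where
  "strip d n B = {w. \<forall>i\<in>{d..<n}. w i \<in> B i}"

lemma coordinate_set: "B \<in> sets borel \<Longrightarrow> {w::path. w i \<in> B} \<in> sets borel"
  using measurable_sets[OF measurable_product_coordinates, of B i] by (simp add: vimage_def)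

lemma cylinder_strip:
  assumes "\<And>i. B i \<in> sets borel" shows "cylinder n (strip d n B)"
proof (rule cylinderI)
  have "strip d n B = UNIV \<inter> (\<Inter>i\<in>{d..<n}. {w. w i \<in> B i})" by (auto simp: strip_def)
  moreover have "UNIV \<inter> (\<Inter>i\<in>{d..<n}. {w::path. w i \<in> B i}) \<in> sets borel"
  proof (cases "{d..<n} = {}")
    case False
    then show ?thesis using assms by (intro sets.Int sets.finite_INT coordinate_set) auto
  qed simp
  ultimately show "strip d n B \<in> sets borel" by simp
qed (auto simp: strip_def)

lemma borel_probs_eqI:
  assumes PR: "P \<in> borel_probs" "R \<in> borel_probs"
    and eq: "\<And>n A B. n \<ge> d \<Longrightarrow> cylinder d A \<Longrightarrow> (\<And>i. B i \<in> sets borel) \<Longrightarrow> measure P (A \<inter> strip d n B) = measure R (A \<inter> strip d n B)"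
  shows "P = R"
proof (rule measure_eqI_PiM_infinite[where I = UNIV and M = "\<lambda>_. borel"])
  show "sets P = sets (Pi\<^sub>M UNIV (\<lambda>_. borel))" "sets R = sets (Pi\<^sub>M UNIV (\<lambda>_. borel))"
    using borel_probsD(2)[OF PR(1)] borel_probsD(2)[OF PR(2)] sets_PiM_equal_borel by auto
  interpret P: prob_space P by (rule borel_probsD[OF PR(1)])
  interpret R: prob_space R by (rule borel_probsD[OF PR(2)])
  show "finite_measure P" by unfold_locales
  fix A :: "nat \<Rightarrow> real set" and J :: "nat set" assume J: "finite J" and A: "\<And>i. i \<in> J \<Longrightarrow> A i \<in> sets (borel :: real measure)"
  define B where "B i = (if i \<in> J then A i else UNIV)" for i :: nat
  have B: "B i \<in> sets borel" for i using A by (auto simp: B_def)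
  obtain m where m: "\<And>i. i \<in> J \<Longrightarrow> i < m" using J unfolding finite_nat_set_iff_bounded by blast
  define n where "n = max m d"
  have "prod_emb UNIV (\<lambda>_. borel) J (Pi\<^sub>E J A) = {w. \<forall>i\<in>J. w i \<in> A i}"
    by (auto simp: prod_emb_def PiE_iff)
  also have "\<dots> = strip 0 d B \<inter> strip d n B"
  proof (intro set_eqI iffI)
    fix w assume w: "w \<in> strip 0 d B \<inter> strip d n B"
    have "w i \<in> A i" if i: "i \<in> J" for i
    proof -
      have "w i \<in> B i" using w m[OF i] by (cases "i < d") (auto simp: strip_def n_def)
      then show ?thesis using i by (simp add: B_def)
    qed
    then show "w \<in> {w. \<forall>i\<in>J. w i \<in> A i}" by simp
  qed (auto simp: strip_def B_def)
  finally have e: "prod_emb UNIV (\<lambda>_. borel) J (Pi\<^sub>E J A) = strip 0 d B \<inter> strip d n B" .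
  have "measure P (strip 0 d B \<inter> strip d n B) = measure R (strip 0 d B \<inter> strip d n B)"
    by (rule eq[OF _ cylinder_strip[OF B] B]) (simp add: n_def)
  then show "emeasure P (prod_emb UNIV (\<lambda>_. borel) J (Pi\<^sub>E J A)) = emeasure R (prod_emb UNIV (\<lambda>_. borel) J (Pi\<^sub>E J A))"
    unfolding e by (simp add: P.emeasure_eq_measure R.emeasure_eq_measure)
qed

section \<open>The prescribed law belongs to \<open>Theta\<close> and is extreme\<close>

lemma extreme_measuresD:
  assumes P: "P \<in> extreme_measures K" and QR: "Q \<in> K" "R \<in> K" and t: "0 < t" "t < 1"
    and conv: "\<And>A. A \<in> sets P \<Longrightarrow> measure P A = t * measure Q A + (1 - t) * measure R A"
  shows "Q = P \<and> R = P"
proof -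
  have "\<forall>Q\<in>K. \<forall>R\<in>K. \<forall>t\<in>{0<..<1}. (\<forall>A\<in>sets P. measure P A = t * measure Q A + (1 - t) * measure R A) \<longrightarrow> Q = P \<and> R = P"
    using P by (simp add: extreme_measures_def)
  from this[rule_format, OF QR, of t] show ?thesis using t conv by simp
qed

locale iid_switched_coins = iid_coordinates E + switched_coins P \<kappa> b d
  for E P \<kappa> b d +
  assumes P_Theta: "P \<in> Theta E" and d1: "d \<ge> 1" and \<kappa>_coordinate_laws: "\<And>c. \<kappa> c \<in> coordinate_laws E"
begin

text \<open>Backward integration: integrating coordinate \<open>n\<close> with its law under \<open>Q\<close> gives at most the inner
upper expectation, a Lipschitz function of the first \<open>n\<close> coordinates, to which the induction
hypothesis applies; independence reassembles the two expectations.\<close>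

lemma Q_cylinder_lipschitz_le:
  assumes "n \<ge> d" "f \<in> cylinder_lipschitz n" shows "integral\<^sup>L Q f \<le> ext E f"
  using assms
proof (induction n arbitrary: f rule: dec_induct)
  case base
  have [measurable]: "f \<in> borel_measurable borel" by (rule cylinder_lipschitz_measurable[OF base])
  have tr: "f (trunc d w) = f w" for w by (rule cylinder_lipschitz_cong[OF base]) (simp add: trunc_def)
  have "distr Q borel (trunc d) = distr P borel (trunc d)"
  proof (rule measure_eqI)
    fix A assume "A \<in> sets (distr Q borel (trunc d))"
    then have A: "A \<in> sets borel" by simp
    have "cylinder d (trunc d -` A)"
    proof (rule cylinderI)
      show "trunc d -` A \<in> sets borel" using measurable_sets[OF trunc_measurable A, of d] by simp
      show "y \<in> trunc d -` A" if "\<And>i. i < d \<Longrightarrow> x i = y i" "x \<in> trunc d -` A" for x y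
      proof -
        have "trunc d x = trunc d y" using that(1) by (auto simp: trunc_def fun_eq_iff)
        then show ?thesis using that(2) by simp
      qed
    qed
    then show "emeasure (distr Q borel (trunc d)) A = emeasure (distr P borel (trunc d)) A"
      using A Q_cylinder by (simp add: emeasure_distr space_P space_Q)
  qed simp
  moreover have "integral\<^sup>L Q f = (\<integral>w. f w \<partial>distr Q borel (trunc d))"
    by (subst integral_distr) (auto simp: tr)
  moreover have "integral\<^sup>L P f = (\<integral>w. f w \<partial>distr P borel (trunc d))"
    by (subst integral_distr) (auto simp: tr)
  ultimately have "integral\<^sup>L Q f = integral\<^sup>L P f" by simp
  then show ?case using ext_upper[OF P_Theta cylinder_lipschitz_Cb[OF base]] by simp
next
  case (step n f)
  have n1: "n \<ge> 1" using step d1 by simp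
  have f: "f \<in> cylinder_lipschitz (Suc n)" by fact
  obtain B L where fB: "\<And>w. \<bar>f w\<bar> \<le> B" and L: "L \<ge> 0" and fL: "\<And>x y. \<bar>f x - f y\<bar> \<le> L * L2_set (\<lambda>i. x i - y i) {..<Suc n}"
    using cylinder_lipschitzE[OF f] by metis
  define v where "v w = ext E (\<lambda>w'. f (w(n := w' n)))" for w
  have L2a: "L2_set (\<lambda>i. (w(n := s)) i - (w(n := t)) i) {..<Suc n} = \<bar>s - t\<bar>" for w :: path and s t
    by (simp add: L2_set_def)
  have L2b: "L2_set (\<lambda>i. (x(n := s)) i - (y(n := s)) i) {..<Suc n} = L2_set (\<lambda>i. x i - y i) {..<n}" for x y :: path and s
    by (simp add: L2_set_def)
  have bl: "(\<lambda>s. f (w(n := s))) \<in> bounded_lipschitz" for w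
    unfolding bounded_lipschitz_def using fB fL[of "w(n := _)" "w(n := _)", unfolded L2a] by (auto simp: bounded_iff)
  have cb: "(\<lambda>w'. f (w(n := w' n))) \<in> Cb" for w
    using cylinder_lipschitz_Cb[OF bounded_lipschitz_cylinder[OF bl[of w] lessI]] .
  have vB: "\<bar>v w\<bar> \<le> B" for w unfolding v_def by (rule ext_bounded[OF cb fB])
  have v: "v \<in> cylinder_lipschitz n"
  proof (rule cylinder_lipschitzI[OF vB])
    fix x y
    have "f (x(n := s)) \<le> f (y(n := s)) + L * L2_set (\<lambda>i. x i - y i) {..<n}"
      "f (y(n := s)) \<le> f (x(n := s)) + L * L2_set (\<lambda>i. x i - y i) {..<n}" for s
      using fL[of "x(n := s)" "y(n := s)", unfolded L2b] by linarith+
    then have "v x \<le> v y + L * L2_set (\<lambda>i. x i - y i) {..<n}" "v y \<le> v x + L * L2_set (\<lambda>i. x i - y i) {..<n}"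
      unfolding v_def by (auto intro!: ext_le_ext_add cb)
    then show "\<bar>v x - v y\<bar> \<le> L * L2_set (\<lambda>i. x i - y i) {..<n}" by linarith
  qed
  have "integral\<^sup>L Q f \<le> integral\<^sup>L Q v"
  proof (rule Q_integral_le[OF _ cylinder_lipschitz_measurable[OF f] cylinder_lipschitz_measurable[OF v] fB vB])
    show "d \<le> n" using step by simp
    fix w
    have "(\<integral>s. f (w(n := s)) \<partial>\<kappa> (b n w)) \<le> ext E (\<lambda>w'. f (w(n := w' 0)))"
      using \<kappa>_coordinate_laws[of "b n w"] bl[of w] by (auto simp: coordinate_laws_def)
    also have "\<dots> = v w" using ext_coordinate[OF bl[of w], of n] by (simp add: v_def)
    finally show "(\<integral>s. f (w(n := s)) \<partial>\<kappa> (b n w)) \<le> v w" .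
  qed
  also have "\<dots> \<le> ext E v" by (rule step.IH[OF v])
  also have "\<dots> = ext E f" unfolding v_def using ext_independent[OF n1 f] by simp
  finally show ?case .
qed

lemma Q_Theta: "Q \<in> Theta E"
  by (rule Theta_I[OF Q_borel_probs Q_cylinder_lipschitz_le])

text \<open>The induction step for extremality. The law \<open>\<kappa> c\<close> of the coordinate \<open>n\<close> under \<open>Q\<close> given \<open>V\<close> is the
convex combination, with the same weight \<open>t\<close>, of its laws under \<open>R\<close> and \<open>S\<close> given \<open>V\<close>; the weight is
unchanged because the three measures give \<open>V\<close> the same mass. Both laws are in \<open>coordinate_laws E\<close>,
where \<open>\<kappa> c\<close> is extreme.\<close>

lemma next_coordinate_extreme:
  assumes ext: "\<And>c. \<kappa> c \<in> extreme_measures (coordinate_laws E)"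
    and R: "R \<in> Theta E" and S: "S \<in> Theta E" and t: "0 < t" "t < 1"
    and conv: "\<And>A. A \<in> sets borel \<Longrightarrow> measure Q A = t * measure R A + (1 - t) * measure S A"
    and n: "n \<ge> d" and V: "cylinder n V" "\<And>w. w \<in> V \<Longrightarrow> b n w = c"
    and eqR: "measure R V = measure Q V" and eqS: "measure S V = measure Q V"
    and B: "B \<in> sets borel"
  shows "measure R (V \<inter> {w. w n \<in> B}) = measure Q (V \<inter> {w. w n \<in> B}) \<and> measure S (V \<inter> {w. w n \<in> B}) = measure Q (V \<inter> {w. w n \<in> B})"
proof -
  have n1: "n \<ge> 1" using n d1 by simp
  have Vb: "V \<in> sets borel" by (rule cylinderD[OF V(1)])
  have VB: "V \<inter> {w. w n \<in> B} \<in> sets borel" if "B \<in> sets borel" for B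
    using Vb coordinate_set[OF that] by auto
  have pos: "measure M (V \<inter> {w. w n \<in> B}) = measure M V * measure (distr (uniform_measure M V) borel (\<lambda>w. w n)) B"
    if M: "M \<in> Theta E" and V0: "measure M V > 0" and B: "B \<in> sets borel" for M B
  proof -
    interpret M: prob_space M by (rule borel_probsD[OF ThetaD[OF M]])
    have s[measurable_cong]: "sets M = sets borel" by (rule borel_probsD[OF ThetaD[OF M]])
    have sp: "space M = UNIV" by (rule borel_probsD[OF ThetaD[OF M]])
    have "measure (distr (uniform_measure M V) borel (\<lambda>w. w n)) B = measure (uniform_measure M V) {w. w n \<in> B}"
      using B by (subst measure_distr) (auto simp: sp vimage_def)
    also have "\<dots> = measure M (V \<inter> {w. w n \<in> B}) / measure M V"
      using V0 Vb coordinate_set[OF B] by (intro measure_uniform_measure) (auto simp: M.emeasure_eq_measure s)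
    finally show ?thesis using V0 by simp
  qed
  show ?thesis
  proof (cases "measure Q V = 0")
    case True
    have zero: "measure M (V \<inter> {w. w n \<in> B}) = 0" if M: "M \<in> Theta E" and V0: "measure M V = 0" for M
    proof -
      interpret M: prob_space M by (rule borel_probsD[OF ThetaD[OF M]])
      have "measure M (V \<inter> {w. w n \<in> B}) \<le> measure M V"
        using Vb by (intro M.finite_measure_mono) (auto simp: borel_probsD[OF ThetaD[OF M]])
      then show ?thesis using V0 measure_nonneg[of M "V \<inter> {w. w n \<in> B}"] by linarith
    qed
    then show ?thesis using True eqR eqS R S Q_Theta by auto
  next
    case False
    then have Q0: "measure Q V > 0" using measure_nonneg[of Q V] by linarith
    define r where "r = distr (uniform_measure R V) borel (\<lambda>w. w n)"
    define s where "s = distr (uniform_measure S V) borel (\<lambda>w. w n)"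
    have rs: "r \<in> coordinate_laws E" "s \<in> coordinate_laws E"
      unfolding r_def s_def using Q0 eqR eqS by (auto intro!: conditional_coordinate_law R S n1 V(1))
    have c: "measure (\<kappa> c) B' = t * measure r B' + (1 - t) * measure s B'" if B': "B' \<in> sets (\<kappa> c)" for B'
    proof -
      have B'b: "B' \<in> sets borel" using B' by (simp add: sets_\<kappa>)
      have "measure Q V * measure (\<kappa> c) B' = t * measure R (V \<inter> {w. w n \<in> B'}) + (1 - t) * measure S (V \<inter> {w. w n \<in> B'})"
        using Q_next_coordinate[OF n V B'b] conv[OF VB[OF B'b]] by simp
      also have "\<dots> = measure Q V * (t * measure r B' + (1 - t) * measure s B')"
        using pos[OF R _ B'b] pos[OF S _ B'b] Q0 eqR eqS by (simp add: r_def s_def algebra_simps)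
      finally show ?thesis using Q0 by simp
    qed
    have "r = \<kappa> c \<and> s = \<kappa> c"
      by (rule extreme_measuresD[OF ext rs t c])
    then show ?thesis
      using pos[OF R _ B] pos[OF S _ B] Q0 eqR eqS Q_next_coordinate[OF n V B] by (simp add: r_def s_def)
  qed
qed

text \<open>Each set is first split according to the value of the rule at the next time, since the previous
lemma needs the rule to be constant on the past event.\<close>

lemma strip_extreme:
  assumes ext: "\<And>c. \<kappa> c \<in> extreme_measures (coordinate_laws E)"
    and R: "R \<in> Theta E" and S: "S \<in> Theta E" and t: "0 < t" "t < 1"
    and conv: "\<And>A. A \<in> sets borel \<Longrightarrow> measure Q A = t * measure R A + (1 - t) * measure S A"
    and base: "\<And>A. cylinder d A \<Longrightarrow> measure R A = measure Q A \<and> measure S A = measure Q A"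
    and B: "\<And>i. B i \<in> sets borel" and n: "n \<ge> d" and A: "cylinder d A"
  shows "measure R (A \<inter> strip d n B) = measure Q (A \<inter> strip d n B) \<and> measure S (A \<inter> strip d n B) = measure Q (A \<inter> strip d n B)"
  using n A
proof (induction n arbitrary: A rule: dec_induct)
  case base
  have "strip d d B = UNIV" by (simp add: strip_def)
  then show ?case using assms(7)[OF base] by simp
next
  case (step n A)
  define A' where "A' c = A \<inter> {w. b n w = c}" for c
  have A': "cylinder d (A' c)" for c
  proof (cases c)
    case True then show ?thesis unfolding A'_def using cylinder_Int[OF step.prems b] by simp
  next
    case False
    have "{w. \<not> b n w} = - {w. b n w}" by auto
    then show ?thesis unfolding A'_def using cylinder_Int[OF step.prems cylinder_Compl[OF b]] False by simp
  qed
  define V where "V c = A' c \<inter> strip d n B" for c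
  have V: "cylinder n (V c)" for c
    unfolding V_def by (intro cylinder_Int cylinder_mono[OF A'] cylinder_strip B step.hyps)
  have one: "measure R (V c \<inter> {w. w n \<in> B n}) = measure Q (V c \<inter> {w. w n \<in> B n}) \<and> measure S (V c \<inter> {w. w n \<in> B n}) = measure Q (V c \<inter> {w. w n \<in> B n})" for c
    using step.IH[OF A'[of c]]
    by (intro next_coordinate_extreme[OF ext R S t conv _ V _ _ _ B, of _ c]) (use step.hyps in \<open>auto simp: V_def A'_def\<close>)
  have eq: "A \<inter> strip d (Suc n) B = (V True \<inter> {w. w n \<in> B n}) \<union> (V False \<inter> {w. w n \<in> B n})"
    using step.hyps by (auto simp: V_def A'_def strip_def less_Suc_eq)
  have add: "measure M (A \<inter> strip d (Suc n) B) = measure M (V True \<inter> {w. w n \<in> B n}) + measure M (V False \<inter> {w. w n \<in> B n})"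
    if M: "M \<in> borel_probs" for M
  proof -
    interpret M: prob_space M by (rule borel_probsD[OF M])
    have sets: "V c \<inter> {w. w n \<in> B n} \<in> sets M" for c
      using cylinderD[OF V[of c]] coordinate_set[OF B[of n], of n] borel_probsD(2)[OF M] by auto
    have "(V True \<inter> {w. w n \<in> B n}) \<inter> (V False \<inter> {w. w n \<in> B n}) = {}" by (auto simp: V_def A'_def)
    then show ?thesis unfolding eq by (rule M.finite_measure_Union[OF sets sets])
  qed
  show ?case
    using add[OF ThetaD[OF R]] add[OF ThetaD[OF S]] add[OF Q_borel_probs] one[of True] one[of False] by simp
qed

lemma Q_extreme:
  assumes ext: "\<And>c. \<kappa> c \<in> extreme_measures (coordinate_laws E)"
    and marg: "marginal d P \<in> extreme_measures (Xi E d)"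
  shows "Q \<in> extreme_measures (Theta E)"
proof -
  have margQ: "marginal d Q = marginal d P"
    by (rule cylinder_marginal_eq[OF Q_borel_probs P Q_cylinder])
  have "R = Q \<and> S = Q"
    if R: "R \<in> Theta E" and S: "S \<in> Theta E" and t: "0 < t" "t < 1"
      and conv0: "\<And>A. A \<in> sets Q \<Longrightarrow> measure Q A = t * measure R A + (1 - t) * measure S A" for R S t
  proof -
    have conv: "measure Q A = t * measure R A + (1 - t) * measure S A" if "A \<in> sets borel" for A
      using conv0[of A] that by (simp add: sets_Q)
    have RS: "R \<in> borel_probs" "S \<in> borel_probs" using R S by (auto dest: ThetaD)
    have mc: "measure (marginal d P) A = t * measure (marginal d R) A + (1 - t) * measure (marginal d S) A"
      if "A \<in> sets (marginal d P)" for A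
    proof -
      have A: "A \<in> sets (Rn d)" using that by (simp add: marginal_def)
      show ?thesis
        unfolding margQ[symmetric] using conv[OF cylinderD[OF rvec_cylinder[OF A]]]
          emeasure_marginal[OF Q_borel_probs A] emeasure_marginal[OF RS(1) A] emeasure_marginal[OF RS(2) A]
        by (simp add: measure_def)
    qed
    have "marginal d R \<in> Xi E d" "marginal d S \<in> Xi E d" using R S by (auto simp: Xi_def)
    then have "marginal d R = marginal d P \<and> marginal d S = marginal d P"
      by (rule extreme_measuresD[OF marg _ _ t mc])
    then have base: "measure R A = measure Q A \<and> measure S A = measure Q A" if "cylinder d A" for A
      using marginal_eq_cylinder[OF RS(1) Q_borel_probs _ that] marginal_eq_cylinder[OF RS(2) Q_borel_probs _ that] margQ
      by (simp add: measure_def)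
    note * = strip_extreme[OF ext R S t conv base]
    show ?thesis
      using borel_probs_eqI[of R Q d] borel_probs_eqI[of S Q d] RS Q_borel_probs * by blast
  qed
  then show ?thesis using Q_Theta unfolding extreme_measures_def by auto
qed

end

section \<open>Choice of the laws and of the switching rule\<close>

text \<open>The increments of \<open>\<lfloor>n \<theta>\<rfloor>\<close>: for \<open>\<theta>\<close> between zero and one they are zeros and ones, and those before
\<open>n\<close> sum to \<open>\<lfloor>n \<theta>\<rfloor>\<close>, so their frequency is \<open>\<theta>\<close>.\<close>

definition switch :: "real \<Rightarrow> nat \<Rightarrow> bool" where
  "switch \<theta> k \<longleftrightarrow> \<lfloor>real k * \<theta>\<rfloor> < \<lfloor>real (Suc k) * \<theta>\<rfloor>"

lemma switch_average:
  assumes z: "lo \<le> z" "z \<le> up" and \<theta>: "\<theta> = (z - lo) / (up - lo)"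
  shows "(\<lambda>n. (\<Sum>k<n. if switch \<theta> k then up else lo) / real n) \<longlonglongrightarrow> z"
proof -
  have \<theta>01: "0 \<le> \<theta>" "\<theta> \<le> 1" using z by (auto simp: \<theta> divide_le_eq)
  have step: "\<lfloor>real (Suc k) * \<theta>\<rfloor> = \<lfloor>real k * \<theta>\<rfloor> + (if switch \<theta> k then 1 else 0)" for k
  proof -
    have mono: "real k * \<theta> \<le> real (Suc k) * \<theta>" "real (Suc k) * \<theta> \<le> real k * \<theta> + 1"
      using \<theta>01 by (auto simp: algebra_simps)
    have "\<lfloor>real k * \<theta>\<rfloor> \<le> \<lfloor>real (Suc k) * \<theta>\<rfloor>" "\<lfloor>real (Suc k) * \<theta>\<rfloor> \<le> \<lfloor>real k * \<theta> + 1\<rfloor>"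
      by (rule floor_mono[OF mono(1)], rule floor_mono[OF mono(2)])
    then show ?thesis by (auto simp: switch_def simp del: of_nat_Suc)
  qed
  have sum: "(\<Sum>k<n. if switch \<theta> k then up else lo) = real n * lo + (up - lo) * of_int \<lfloor>real n * \<theta>\<rfloor>" for n
  proof (induction n)
    case (Suc n)
    then show ?case using step[of n] by (simp add: algebra_simps del: of_nat_Suc) (simp add: algebra_simps)
  qed simp
  have "(\<lambda>n. of_int \<lfloor>real n * \<theta>\<rfloor> / real n) \<longlonglongrightarrow> \<theta>"
  proof (rule tendsto_sandwich)
    show "eventually (\<lambda>n. \<theta> - 1 / real n \<le> of_int \<lfloor>real n * \<theta>\<rfloor> / real n) sequentially"
      using eventually_gt_at_top[of 0]
    proof eventually_elim
      case (elim n)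
      have "real n * \<theta> - 1 \<le> of_int \<lfloor>real n * \<theta>\<rfloor>" by linarith
      then have "(real n * \<theta> - 1) / real n \<le> of_int \<lfloor>real n * \<theta>\<rfloor> / real n" by (rule divide_right_mono) simp
      then show ?case using elim by (simp add: diff_divide_distrib)
    qed
    show "eventually (\<lambda>n. of_int \<lfloor>real n * \<theta>\<rfloor> / real n \<le> \<theta>) sequentially"
      using eventually_gt_at_top[of 0]
    proof eventually_elim
      case (elim n)
      have "of_int \<lfloor>real n * \<theta>\<rfloor> / real n \<le> (real n * \<theta>) / real n" by (rule divide_right_mono) auto
      then show ?case using elim by simp
    qed
    have "(\<lambda>n. \<theta> - 1 / real n) \<longlonglongrightarrow> \<theta> - 0" by (intro tendsto_diff tendsto_const lim_const_over_n)
    then show "(\<lambda>n. \<theta> - 1 / real n) \<longlonglongrightarrow> \<theta>" by simp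
  qed simp
  then have "(\<lambda>n. lo + (up - lo) * (of_int \<lfloor>real n * \<theta>\<rfloor> / real n)) \<longlonglongrightarrow> lo + (up - lo) * \<theta>"
    by (intro tendsto_intros)
  also have "lo + (up - lo) * \<theta> = z" using z by (cases "up = lo") (auto simp: \<theta>)
  finally have "(\<lambda>n. lo + (up - lo) * (of_int \<lfloor>real n * \<theta>\<rfloor> / real n)) \<longlonglongrightarrow> z" .
  moreover have "eventually (\<lambda>n. lo + (up - lo) * (of_int \<lfloor>real n * \<theta>\<rfloor> / real n)
      = (\<Sum>k<n. if switch \<theta> k then up else lo) / real n) sequentially"
    using eventually_gt_at_top[of 0] by eventually_elim (simp add: sum add_divide_distrib)
  ultimately show ?thesis by (rule Lim_transform_eventually)
qed

text \<open>An approximating function with upper distance below one is bounded, which bounds the moment of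
\<open>X\<close> uniformly over \<open>Theta E\<close>.\<close>

lemma Lp_moment:
  assumes X: "X \<in> Lp E p" and p: "p \<ge> 0"
  obtains C where "C \<ge> 0" "\<And>P. P \<in> Theta E \<Longrightarrow> (\<integral>\<^sup>+w. ennreal (\<bar>X w\<bar> powr p) \<partial>P) \<le> ennreal C"
proof -
  have [measurable]: "X \<in> borel_measurable borel" using X by (simp add: Lp_def)
  obtain Y where Y: "\<And>n. Y n \<in> Cb" and
    lim: "(\<lambda>n. SUP P\<in>Theta E. \<integral>\<^sup>+w. ennreal (\<bar>X w - Y n w\<bar> powr p) \<partial>P) \<longlonglongrightarrow> 0"
    using X by (auto simp: Lp_def)
  have "eventually (\<lambda>n. (SUP P\<in>Theta E. \<integral>\<^sup>+w. ennreal (\<bar>X w - Y n w\<bar> powr p) \<partial>P) < 1) sequentially"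
    by (rule order_tendstoD(2)[OF lim]) simp
  then obtain n where n: "(SUP P\<in>Theta E. \<integral>\<^sup>+w. ennreal (\<bar>X w - Y n w\<bar> powr p) \<partial>P) < 1"
    by (auto simp: eventually_sequentially)
  obtain B where B: "\<And>w. \<bar>Y n w\<bar> \<le> B" using Y[of n] by (auto simp: Cb_def bounded_iff)
  have [measurable]: "Y n \<in> borel_measurable borel"
    using Y[of n] by (auto simp: Cb_def intro: borel_measurable_continuous_onI)
  have "(\<integral>\<^sup>+w. ennreal (\<bar>X w\<bar> powr p) \<partial>P) \<le> ennreal (2 powr p * (1 + B powr p))" if P: "P \<in> Theta E" for P
  proof -
    interpret prob_space P by (rule borel_probsD[OF ThetaD[OF P]])
    have [measurable_cong]: "sets P = sets borel" by (rule borel_probsD[OF ThetaD[OF P]])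
    have le: "\<bar>X w\<bar> powr p \<le> 2 powr p * (\<bar>X w - Y n w\<bar> powr p + B powr p)" for w
    proof -
      have "\<bar>(X w - Y n w) + Y n w\<bar> powr p \<le> 2 powr p * (\<bar>X w - Y n w\<bar> powr p + \<bar>Y n w\<bar> powr p)"
        by (rule abs_add_powr_le[OF p])
      also have "\<dots> \<le> 2 powr p * (\<bar>X w - Y n w\<bar> powr p + B powr p)"
        by (intro mult_left_mono add_left_mono powr_mono2 B p) auto
      finally show ?thesis by simp
    qed
    have "(\<integral>\<^sup>+w. ennreal (\<bar>X w\<bar> powr p) \<partial>P) \<le> (\<integral>\<^sup>+w. ennreal (2 powr p) * (ennreal (\<bar>X w - Y n w\<bar> powr p) + ennreal (B powr p)) \<partial>P)"
      by (intro nn_integral_mono) (simp add: ennreal_mult[symmetric] ennreal_plus[symmetric] ennreal_leI le del: ennreal_plus)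
    also have "\<dots> = ennreal (2 powr p) * ((\<integral>\<^sup>+w. ennreal (\<bar>X w - Y n w\<bar> powr p) \<partial>P) + ennreal (B powr p))"
      by (simp add: nn_integral_cmult nn_integral_add emeasure_space_1)
    also have "\<dots> \<le> ennreal (2 powr p) * (1 + ennreal (B powr p))"
    proof (intro mult_left_mono add_right_mono)
      have "(\<integral>\<^sup>+w. ennreal (\<bar>X w - Y n w\<bar> powr p) \<partial>P) \<le> (SUP P\<in>Theta E. \<integral>\<^sup>+w. ennreal (\<bar>X w - Y n w\<bar> powr p) \<partial>P)"
        by (rule SUP_upper[OF P])
      then show "(\<integral>\<^sup>+w. ennreal (\<bar>X w - Y n w\<bar> powr p) \<partial>P) \<le> 1" using n by auto
    qed simp
    also have "\<dots> = ennreal (2 powr p * (1 + B powr p))"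
      by (simp add: ennreal_mult ennreal_plus)
    finally show ?thesis .
  qed
  then show ?thesis by (intro that[of "2 powr p * (1 + B powr p)"]) auto
qed

text \<open>For \<open>s = 1\<close> the mean of \<open>\<kappa>\<close> is at least the upper mean, for \<open>s = -1\<close> at most the lower mean, because the
first coordinate under a member of \<open>Theta E\<close> has a law among those over which \<open>\<kappa>\<close> is optimal.\<close>

lemma (in iid_coordinates) extreme_coordinate_law:
  assumes C: "\<And>P. P \<in> Theta E \<Longrightarrow> (\<integral>\<^sup>+w. ennreal (\<bar>w 0\<bar> powr g) \<partial>P) \<le> ennreal C" and C0: "C \<ge> 0" and g: "g > 1"
  obtains \<kappa> where "\<kappa> \<in> extreme_measures (coordinate_laws E)" "ext E (\<lambda>w. s * w 0) \<le> s * (\<integral>x. x \<partial>\<kappa>)"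
proof -
  have ne: "coordinate_laws E \<noteq> {}" using Theta_nonempty first_coordinate_law by blast
  obtain \<kappa> where \<kappa>: "\<kappa> \<in> extreme_measures (coordinate_laws E)" "\<And>\<mu>. \<mu> \<in> coordinate_laws E \<Longrightarrow> s * (\<integral>x. x \<partial>\<mu>) \<le> s * (\<integral>x. x \<partial>\<kappa>)"
  proof -
    have "\<exists>\<kappa>\<in>extreme_measures (coordinate_laws E). \<forall>\<mu>\<in>coordinate_laws E. s * (\<integral>x. x \<partial>\<mu>) \<le> s * (\<integral>x. x \<partial>\<kappa>)"
    proof (rule extreme_point_maximal_mean[OF _ C0 g _ ne])
      show "moment_bounded g C \<mu>" if "\<mu> \<in> coordinate_laws E" for \<mu>
        by (rule coordinate_laws_moment_bounded[OF C C0 g that])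
      show "\<mu> \<in> coordinate_laws E" if "\<And>n. u n \<in> coordinate_laws E" "real_distribution \<mu>" "weak_conv_m u \<mu>" for u \<mu>
        by (rule coordinate_laws_closed[OF that])
    qed
    then show ?thesis using that by blast
  qed
  have "ext E (\<lambda>w. s * w 0) \<le> s * (\<integral>x. x \<partial>\<kappa>)"
  proof (rule ext_least)
    fix P assume P: "P \<in> Theta E"
    have [measurable_cong]: "sets P = sets borel" by (rule borel_probsD[OF ThetaD[OF P]])
    have "(\<integral>w. s * w 0 \<partial>P) = s * (\<integral>x. x \<partial>distr P borel (\<lambda>w. w 0))"
      by (subst integral_distr) auto
    also have "\<dots> \<le> s * (\<integral>x. x \<partial>\<kappa>)" by (rule \<kappa>(2)[OF first_coordinate_law[OF P]])
    finally show "(\<integral>w. s * w 0 \<partial>P) \<le> s * (\<integral>x. x \<partial>\<kappa>)" .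
  qed
  then show ?thesis using that \<kappa>(1) by blast
qed

theorem theorem4p1:
  fixes E :: "(path \<Rightarrow> real) \<Rightarrow> real" and \<gamma> :: real and d :: nat
    and \<pi> :: "(nat \<Rightarrow> real) \<Rightarrow> real" and Z :: "path \<Rightarrow> real" and P :: "path measure"
  assumes "sublinear_expectation E"
    and "regular_expectation E"
    and "\<gamma> > 1"
    and "\<And>k. xi k \<in> Lp E \<gamma>"
    and "iid E xi"
    and "d \<ge> 1"
    and "\<pi> \<in> borel_measurable (Rn d)"
    and "Z = (\<lambda>\<omega>. \<pi> (rvec d xi \<omega>))"
    and "\<And>\<omega>. Z \<omega> \<in> {lower_mean E..upper_mean E}"
    and "P \<in> Theta E"
  shows "(\<exists>Q\<in>Theta E.
            (\<forall>A\<in>sets (coord_algebra d). emeasure Q A = emeasure P A) \<and>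
            (AE \<omega> in Q. (\<lambda>n. sample_mean n \<omega>) \<longlonglongrightarrow> Z \<omega>)) \<and>
         (marginal d P \<in> extreme_measures (Xi E d) \<longrightarrow>
          (\<exists>Q\<in>extreme_measures (Theta E).
            (\<forall>A\<in>sets (coord_algebra d). emeasure Q A = emeasure P A) \<and>
            (AE \<omega> in Q. (\<lambda>n. sample_mean n \<omega>) \<longlonglongrightarrow> Z \<omega>)))"
proof -
  interpret iid_coordinates E
    using assms(1,5) by unfold_locales
  \<comment> \<open>The expansion behind the strong law needs an order of at most two.\<close>
  define g where "g = min \<gamma> 2"
  have g: "1 < g" "g \<le> 2" "g \<le> \<gamma>" using assms(3) by (auto simp: g_def)
  obtain C0 where C0: "C0 \<ge> 0" "\<And>P. P \<in> Theta E \<Longrightarrow> (\<integral>\<^sup>+w. ennreal (\<bar>xi 0 w\<bar> powr \<gamma>) \<partial>P) \<le> ennreal C0"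
    using Lp_moment[OF assms(4)[of 0]] assms(3) by (metis less_eq_real_def less_trans zero_less_one)
  have C: "(\<integral>\<^sup>+w. ennreal (\<bar>w 0\<bar> powr g) \<partial>P) \<le> ennreal (1 + C0)" if P: "P \<in> Theta E" for P
  proof -
    interpret prob_space P by (rule borel_probsD[OF ThetaD[OF P]])
    have [measurable_cong]: "sets P = sets borel" by (rule borel_probsD[OF ThetaD[OF P]])
    have "(\<integral>\<^sup>+w. ennreal (\<bar>w 0\<bar> powr g) \<partial>P) \<le> (\<integral>\<^sup>+w. 1 + ennreal (\<bar>w 0\<bar> powr \<gamma>) \<partial>P)"
    proof (rule nn_integral_mono)
      fix w :: path
      have "\<bar>w 0\<bar> powr g \<le> 1 + \<bar>w 0\<bar> powr \<gamma>" by (rule abs_le_one_add_powr) (use g in auto)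
      then have "ennreal (\<bar>w 0\<bar> powr g) \<le> ennreal (1 + \<bar>w 0\<bar> powr \<gamma>)" by (rule ennreal_leI)
      then show "ennreal (\<bar>w 0\<bar> powr g) \<le> 1 + ennreal (\<bar>w 0\<bar> powr \<gamma>)" by (simp add: ennreal_plus)
    qed
    also have "\<dots> = 1 + (\<integral>\<^sup>+w. ennreal (\<bar>w 0\<bar> powr \<gamma>) \<partial>P)"
      by (subst nn_integral_add) (auto simp: emeasure_space_1)
    also have "\<dots> \<le> 1 + ennreal C0" using C0(2)[OF P] by (intro add_left_mono) (simp add: xi_def)
    also have "\<dots> = ennreal (1 + C0)" using C0(1) by (simp add: ennreal_plus)
    finally show ?thesis .
  qed
  have C1: "1 + C0 \<ge> 0" using C0(1) by simp
  obtain \<kappa>1 where \<kappa>1: "\<kappa>1 \<in> extreme_measures (coordinate_laws E)" "ext E (\<lambda>w. 1 * w 0) \<le> 1 * (\<integral>x. x \<partial>\<kappa>1)"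
    using extreme_coordinate_law[OF C C1 g(1)] by metis
  obtain \<kappa>0 where \<kappa>0: "\<kappa>0 \<in> extreme_measures (coordinate_laws E)" "ext E (\<lambda>w. - 1 * w 0) \<le> - 1 * (\<integral>x. x \<partial>\<kappa>0)"
    using extreme_coordinate_law[OF C C1 g(1)] by metis
  define up lo where "up = (\<integral>x. x \<partial>\<kappa>1)" and "lo = (\<integral>x. x \<partial>\<kappa>0)"
  have "upper_mean E = ext E (\<lambda>w. 1 * w 0)" by (simp add: upper_mean_def xi_def[abs_def])
  then have upper: "upper_mean E \<le> up" using \<kappa>1(2) by (simp add: up_def)
  have "lower_mean E = - ext E (\<lambda>w. - 1 * w 0)" by (simp add: lower_mean_def xi_def[abs_def])
  then have lower: "lo \<le> lower_mean E" using \<kappa>0(2) by (simp add: lo_def)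
  have Zlu: "lo \<le> Z w" "Z w \<le> up" for w using assms(9)[of w] upper lower by auto
  have Zm[measurable]: "Z \<in> borel_measurable borel"
    unfolding assms(8) by (rule measurable_compose[OF rvec_measurable assms(7)])
  have Zdep: "Z x = Z y" if "\<And>i. i < d \<Longrightarrow> x i = y i" for x y
    unfolding assms(8) using rvec_cong[of d x y, OF that] by simp
  define \<kappa> where "\<kappa> c = (if c then \<kappa>1 else \<kappa>0)" for c
  define b where "b n w = switch ((Z w - lo) / (up - lo)) n" for n w
  have \<kappa>e: "\<kappa> c \<in> extreme_measures (coordinate_laws E)" for c using \<kappa>0 \<kappa>1 by (simp add: \<kappa>_def)
  then have \<kappa>o: "\<kappa> c \<in> coordinate_laws E" for c by (simp add: extreme_measures_def)
  interpret iid_switched_coins E P \<kappa> b d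
  proof (intro iid_switched_coins.intro switched_coins.intro iid_switched_coins_axioms.intro iid_coordinates_axioms)
    show "P \<in> borel_probs" by (rule ThetaD[OF assms(10)])
    show "real_distribution (\<kappa> c)" for c using \<kappa>o[of c] by (simp add: coordinate_laws_def)
    show "cylinder d {w. b n w}" for n
    proof (rule cylinderI)
      have "Measurable.pred borel (b n)" unfolding b_def[abs_def] switch_def by measurable
      then show "{w. b n w} \<in> sets borel" by (simp add: pred_def)
      fix x y assume xy: "\<And>i. i < d \<Longrightarrow> x i = y i" and x: "x \<in> {w. b n w}"
      have "Z x = Z y" by (rule Zdep[OF xy])
      then show "y \<in> {w. b n w}" using x by (simp add: b_def)
    qed
    show "P \<in> Theta E" "d \<ge> 1" by fact+
    show "\<kappa> c \<in> coordinate_laws E" for c by (rule \<kappa>o)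
  qed
  have mb: "moment_bounded g (1 + C0) (\<kappa> c)" for c
    by (rule coordinate_laws_moment_bounded[OF C C1 g(1) \<kappa>o])
  have avg: "(\<lambda>n. (\<Sum>k<n. \<integral>x. x \<partial>\<kappa> (b k w)) / real n) \<longlonglongrightarrow> Z w" for w
  proof -
    have "(\<integral>x. x \<partial>\<kappa> (b k w)) = (if switch ((Z w - lo) / (up - lo)) k then up else lo)" for k
      by (simp add: \<kappa>_def b_def up_def lo_def)
    then show ?thesis using switch_average[OF Zlu(1)[of w] Zlu(2)[of w] refl] by simp
  qed
  have ae: "AE w in Q. (\<lambda>n. sample_mean n w) \<longlonglongrightarrow> Z w"
    by (rule Q_sample_mean_AE[OF mb C1 g(1,2) Zm Zdep avg])
  have agree: "\<forall>A\<in>sets (coord_algebra d). emeasure Q A = emeasure P A"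
    using Q_cylinder[OF coord_algebra_cylinder] by blast
  show ?thesis
    using Q_Theta ae agree Q_extreme[OF \<kappa>e] by blast
qed

end
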